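(* Let $X$ be a path-connected metric space, $x_0\in X$, such that $\mathbf{w}(X)$ is discrete, and let $N\trianglelefteq\pi_1(X,x_0)$ be a normal subgroup. Then $p_N:\widetilde{X}_N\to X$ has the unique path lifting property if and only if $X$ has transfinite products relative to $N$. In particular, $p_K:\widetilde{X}_K\to X$ has the unique path lifting property if $K=cl_{P,p_\tau}(N)$.
   Context: A map is a continuous function; $f_{\#}$ denotes the homomorphism induced on fundamental groups. For paths, $\alpha\cdot\beta$ is concatenation and $\alpha^{-}(t)=\alpha(1-t)$. $\mathbf{w}(X)\subseteq X$ is the subspace of points at which $X$ is not semilocally simply connected, i.e. points $x$ having no open neighborhood $U$ for which $\pi_1(U,x)\to\pi_1(X,x)$ is trivial. "Discrete" means discrete in the subspace topology. For a subgroup $K\leq\pi_1(X,x_0)$, $\widetilde{X}_K$ is the set of equivalence classes $K[\alpha]$ of paths $\alpha:[0,1]\to X$ with $\alpha(0)=x_0$, where $\alpha\sim\beta$ iff $\alpha(1)=\beta(1)$ and $[\alpha\cdot\beta^{-}]\in K$, with the topology generated by the sets $B(K[\alpha],U)=\{K[\alpha\cdot\epsilon]\mid\epsilon:[0,1]\to U\text{ a path},\ \epsilon(0)=\alpha(1)\}$, $U$ an open neighborhood of $\alpha(1)$ in $X$. The map $p_K:\widetilde{X}_K\to X$ is $p_K(K[\alpha])=\alpha(1)$. A map $f:Y\to X$ has the unique path lifting property if whenever $\alpha,\beta:[0,1]\to Y$ are paths with $\alpha(0)=\beta(0)$ and $f\circ\alpha=f\circ\beta$, then $\alpha=\beta$.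 Closed subgroups and closure: for a based space $(\mathbb{T},t_0)$, a subgroup $T\leq\pi_1(\mathbb{T},t_0)$ and $g\in\pi_1(\mathbb{T},t_0)$, a subgroup $H\leq\pi_1(X,x_0)$ is $(T,g)$-closed if for every map $f:(\mathbb{T},t_0)\to(X,x_0)$ with $f_{\#}(T)\leq H$ we have $f_{\#}(g)\in H$. The $(T,g)$-closure $cl_{T,g}(H)$ is the intersection of all $(T,g)$-closed subgroups of $\pi_1(X,x_0)$ containing $H$. The test space $\mathbb{H}^+$: let $C_n\subseteq\mathbb{R}^2$ be the circle of radius $\frac1n$ centered at $(\frac1n,0)$, $\mathbb{H}=\bigcup_{n\geq1}C_n$, $b_0=(0,0)$, and $\mathbb{H}^+=\mathbb{H}\cup([-1,0]\times\{0\})$ with basepoint $b_0^+=(-1,0)$. Let $\ell_n$ be the loop based at $b_0$ traversing $C_n$ once counterclockwise, $\iota:[0,1]\to\mathbb{H}^+$, $\iota(t)=(t-1,0)$, and $c_n=[\iota\cdot\ell_n\cdot\iota^{-}]$. Let $\mathcal{C}\subseteq[0,1]$ be the standard middle third Cantor set and write $[0,1]\setminus\mathcal{C}=\bigcup_{n\geq1}\bigcup_{k=1}^{2^{n-1}}I_n^k$, where $I_n^k$ are the components of length $\frac{1}{3^n}$, indexed by $k$ in their natural order. Let $\ell_\tau:[0,1]\to\mathbb{H}$ be the loop with $\ell_\tau(\mathcal{C})=\{b_0\}$ and equal to $\ell_{2^{n-1}+k-1}$ (linearly reparametrized) on $\overline{I_n^k}$. Let $f_{odd},f_{even}:\mathbb{H}\to\mathbb{H}$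 be the maps with $f_{odd}\circ\ell_n=\ell_{2n-1}$ and $f_{even}\circ\ell_n=\ell_{2n}$. Put $p_n=[\iota\cdot\ell_{2n-1}\cdot\ell_{2n}^{-}\cdot\iota^{-}]$, $P=\langle p_n\mid n\in\mathbb{N}\rangle\leq\pi_1(\mathbb{H}^+,b_0^+)$, and $p_\tau=[\iota\cdot(f_{odd}\circ\ell_\tau)\cdot(f_{even}\circ\ell_\tau)^{-}\cdot\iota^{-}]$. $X$ has transfinite products relative to $H\leq\pi_1(X,x_0)$ if for every pair of maps $a,b:(\mathbb{H}^+,b_0^+)\to(X,x_0)$ such that $a\circ\iota=b\circ\iota$ and $Ha_{\#}(c_n)=Hb_{\#}(c_n)$ for all $n\in\mathbb{N}$, we have $Ha_{\#}(g)=Hb_{\#}(g)$ for all $g\in\pi_1(\mathbb{H}^+,b_0^+)$. *)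

theory Defs
  imports "HOL-Analysis.Analysis" "HOL-Algebra.Generated_Groups"
begin

section \<open>The fundamental group\<close>

text \<open>
  A path is a function on the reals of which only the restriction to \<open>{0..1}\<close> matters;
  \<^const>\<open>homotopic_paths\<close> identifies functions that agree there.  For a path in \<open>X\<close>, homotopy is
  relative to the end points and takes place in the subspace \<open>X\<close>.
\<close>

definition path_class :: "'a::topological_space set \<Rightarrow> (real \<Rightarrow> 'a) \<Rightarrow> (real \<Rightarrow> 'a) set" where
  "path_class X p = {q. homotopic_paths X p q}"

definition fundamental_group ::
    "'a::topological_space set \<Rightarrow> 'a \<Rightarrow> (real \<Rightarrow> 'a) set monoid" where
  "fundamental_group X x0 =
     \<lparr>carrier = {path_class X p | p.
        path p \<and> path_image p \<subseteq> X \<and> pathstart p = x0 \<and> pathfinish p = x0},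
      monoid.mult = (\<lambda>c d. {r. \<exists>p\<in>c. \<exists>q\<in>d. homotopic_paths X (p +++ q) r}),
      one = path_class X (\<lambda>_. x0)\<rparr>"

text \<open>For a map \<open>f\<close> from \<open>Y\<close> to \<open>X\<close>, the homomorphism \<open>[p] \<mapsto> [f \<circ> p]\<close>; the source \<open>Y\<close> is not an argument.\<close>

definition induced_hom ::
    "'b::topological_space set \<Rightarrow> ('a \<Rightarrow> 'b) \<Rightarrow> (real \<Rightarrow> 'a) set \<Rightarrow> (real \<Rightarrow> 'b) set" where
  "induced_hom X f c = {q. \<exists>p\<in>c. homotopic_paths X (f \<circ> p) q}"

definition based_map ::
    "'a::topological_space set \<Rightarrow> 'a \<Rightarrow> 'b::topological_space set \<Rightarrow> 'b \<Rightarrow> ('a \<Rightarrow> 'b) \<Rightarrow> bool" where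
  "based_map Y y0 X x0 f \<longleftrightarrow> continuous_on Y f \<and> f \<in> Y \<rightarrow> X \<and> f y0 = x0"

lemma path_class_eq_iff:
  assumes "path p" "path_image p \<subseteq> X"
  shows "path_class X p = path_class X q \<longleftrightarrow> homotopic_paths X p q"
proof
  assume "path_class X p = path_class X q"
  moreover have "p \<in> path_class X p"
    using assms by (simp add: path_class_def)
  ultimately show "homotopic_paths X p q"
    by (simp add: path_class_def homotopic_paths_sym)
next
  assume "homotopic_paths X p q"
  then show "path_class X p = path_class X q"
    unfolding path_class_def by (blast intro: homotopic_paths_trans homotopic_paths_sym)
qed

lemma fundamental_group_mult:
  assumes "path p" "path_image p \<subseteq> X" "path q" "path_image q \<subseteq> X" "pathfinish p = pathstart q"
  shows "path_class X p \<otimes>\<^bsub>fundamental_group X x0\<^esub> path_class X q = path_class X (p +++ q)"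
proof -
  have "homotopic_paths X (p +++ q) r"
    if "homotopic_paths X p p'" "homotopic_paths X q q'" "homotopic_paths X (p' +++ q') r" for p' q' r
    using that assms by (meson homotopic_paths_join homotopic_paths_trans)
  moreover have "homotopic_paths X p p" "homotopic_paths X q q"
    using assms by auto
  ultimately show ?thesis
    unfolding fundamental_group_def path_class_def by (simp, blast)
qed

lemma induced_hom_path_class:
  assumes "continuous_on Y f" "f \<in> Y \<rightarrow> X" "path p" "path_image p \<subseteq> Y"
  shows "induced_hom X f (path_class Y p) = path_class X (f \<circ> p)"
proof -
  have "homotopic_paths Y p p"
    using assms by auto
  moreover have "homotopic_paths X (f \<circ> p) (f \<circ> q)" if "homotopic_paths Y p q" for q
    using that assms homotopic_paths_continuous_image by blast
  ultimately show ?thesis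
    unfolding induced_hom_def path_class_def by (blast intro: homotopic_paths_trans)
qed

text \<open>
  The library proves the unit and inverse laws up to homotopy only for paths in normed vector spaces.
\<close>

lemma homotopic_paths_const_right:
  fixes p :: "real \<Rightarrow> 'a::topological_space"
  assumes "path p" "path_image p \<subseteq> X"
  shows "homotopic_paths X p (p +++ (\<lambda>_. pathfinish p))"
proof (rule homotopic_paths_reparametrize [where f = "\<lambda>t. min (2 * t) 1"])
  show "continuous_on {0..1} (\<lambda>t::real. min (2 * t) 1)"
    by (intro continuous_intros)
qed (use assms in \<open>auto simp: joinpaths_def pathfinish_def min_def\<close>)

lemma homotopic_paths_const_left:
  fixes p :: "real \<Rightarrow> 'a::topological_space"
  assumes "path p" "path_image p \<subseteq> X"
  shows "homotopic_paths X p ((\<lambda>_. pathstart p) +++ p)"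
proof (rule homotopic_paths_reparametrize [where f = "\<lambda>t. max (2 * t - 1) 0"])
  show "continuous_on {0..1} (\<lambda>t::real. max (2 * t - 1) 0)"
    by (intro continuous_intros)
qed (use assms in \<open>auto simp: joinpaths_def pathstart_def max_def\<close>)

lemma homotopic_paths_inverse_right:
  fixes p :: "real \<Rightarrow> 'a::topological_space"
  assumes "path p" "path_image p \<subseteq> X"
  shows "homotopic_paths X (p +++ reversepath p) (\<lambda>_. pathstart p)"
proof -
  let ?\<phi> = "\<lambda>y::real \<times> real. (1 - fst y) * (1 - \<bar>2 * snd y - 1\<bar>)"
  have r: "?\<phi> y \<in> {0..1}" if "y \<in> {0..1} \<times> {0..1}" for y
    using that by (auto intro!: mult_le_one)
  have "continuous_on ({0..1} \<times> {0..1}) (p \<circ> ?\<phi>)"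
    using assms(1) r unfolding path_def
    by (intro continuous_on_compose continuous_intros) (auto elim!: continuous_on_subset)
  moreover have "p \<circ> ?\<phi> \<in> {0..1} \<times> {0..1} \<rightarrow> X"
    using assms(2) r unfolding path_image_def by fastforce
  moreover have "(p \<circ> ?\<phi>) (0, t) = (p +++ reversepath p) t" if "t \<in> {0..1}" for t
  proof (cases "t \<le> 1 / 2")
    case True
    then have "?\<phi> (0, t) = 2 * t" by simp
    with True show ?thesis by (simp add: joinpaths_def)
  next
    case False
    then have "?\<phi> (0, t) = 1 - (2 * t - 1)" by simp
    with False show ?thesis by (simp add: joinpaths_def reversepath_def)
  qed
  ultimately show ?thesis
    unfolding homotopic_paths
    by (intro exI [of _ "p \<circ> ?\<phi>"])
      (simp add: pathstart_def pathfinish_def joinpaths_def reversepath_def)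
qed

lemma group_fundamental_group:
  fixes x0 :: "'a::topological_space"
  assumes x0: "x0 \<in> X"
  shows "group (fundamental_group X x0)"
proof -
  define L where "L = {p. path p \<and> path_image p \<subseteq> X \<and> pathstart p = x0 \<and> pathfinish p = x0}"
  let ?G = "fundamental_group X x0"
  have carr: "carrier ?G = path_class X ` L"
    unfolding fundamental_group_def L_def by auto
  have one: "\<one>\<^bsub>?G\<^esub> = path_class X (\<lambda>_. x0)"
    unfolding fundamental_group_def by simp
  have const: "(\<lambda>_. x0) \<in> L"
    using x0 by (auto simp: L_def path_def path_image_def pathstart_def pathfinish_def)
  have join: "p +++ q \<in> L" if "p \<in> L" "q \<in> L" for p q
    using that by (auto simp: L_def path_image_join)
  have mult: "path_class X p \<otimes>\<^bsub>?G\<^esub> path_class X q = path_class X (p +++ q)"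
    if "p \<in> L" "q \<in> L" for p q
    using that by (intro fundamental_group_mult) (auto simp: L_def)
  have eq: "path_class X p = path_class X q" if "p \<in> L" "homotopic_paths X p q" for p q
    using that path_class_eq_iff by (auto simp: L_def)
  show ?thesis
  proof (rule groupI)
    fix c d assume "c \<in> carrier ?G" "d \<in> carrier ?G"
    then show "c \<otimes>\<^bsub>?G\<^esub> d \<in> carrier ?G"
      using join mult by (auto simp: carr)
  next
    show "\<one>\<^bsub>?G\<^esub> \<in> carrier ?G"
      using const by (simp add: one carr)
  next
    fix c d e assume "c \<in> carrier ?G" "d \<in> carrier ?G" "e \<in> carrier ?G"
    then obtain p q r where *: "p \<in> L" "q \<in> L" "r \<in> L"
      "c = path_class X p" "d = path_class X q" "e = path_class X r"
      by (auto simp: carr)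
    then have "homotopic_paths X (p +++ q +++ r) ((p +++ q) +++ r)"
      by (intro homotopic_paths_assoc) (auto simp: L_def)
    then have "path_class X (p +++ q +++ r) = path_class X ((p +++ q) +++ r)"
      using * join eq by blast
    then show "c \<otimes>\<^bsub>?G\<^esub> d \<otimes>\<^bsub>?G\<^esub> e = c \<otimes>\<^bsub>?G\<^esub> (d \<otimes>\<^bsub>?G\<^esub> e)"
      using * by (simp add: mult join)
  next
    fix c assume "c \<in> carrier ?G"
    then obtain p where p: "p \<in> L" "c = path_class X p"
      by (auto simp: carr)
    then have "homotopic_paths X p ((\<lambda>_. x0) +++ p)"
      using homotopic_paths_const_left [of p X] by (auto simp: L_def)
    then show "\<one>\<^bsub>?G\<^esub> \<otimes>\<^bsub>?G\<^esub> c = c"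
      using p const eq mult one by metis
    have r: "reversepath p \<in> L"
      using p by (auto simp: L_def)
    then have "homotopic_paths X (reversepath p +++ p) (\<lambda>_. x0)"
      using homotopic_paths_inverse_right [of "reversepath p" X] by (auto simp: L_def)
    then have "path_class X (reversepath p) \<otimes>\<^bsub>?G\<^esub> c = \<one>\<^bsub>?G\<^esub>"
      using p r join eq mult one by metis
    then show "\<exists>d\<in>carrier ?G. d \<otimes>\<^bsub>?G\<^esub> c = \<one>\<^bsub>?G\<^esub>"
      using r carr by blast
  qed
qed

section \<open>Points where a space is not semilocally simply connected\<close>

definition non_slsc :: "'a::topological_space set \<Rightarrow> 'a set" where
  "non_slsc X = {x \<in> X. \<not> (\<exists>U. openin (top_of_set X) U \<and> x \<in> U \<and>
     (\<forall>c\<in>carrier (fundamental_group U x).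
        induced_hom X (\<lambda>y. y) c = \<one>\<^bsub>fundamental_group X x\<^esub>))}"

section \<open>The space of path classes modulo a subgroup\<close>

definition coset_class ::
    "'a::topological_space set \<Rightarrow> 'a \<Rightarrow> (real \<Rightarrow> 'a) set set \<Rightarrow> (real \<Rightarrow> 'a) \<Rightarrow> (real \<Rightarrow> 'a) set" where
  "coset_class X x0 K \<alpha> = {\<beta>. path \<beta> \<and> path_image \<beta> \<subseteq> X \<and> pathstart \<beta> = x0 \<and>
     pathfinish \<alpha> = pathfinish \<beta> \<and> path_class X (\<alpha> +++ reversepath \<beta>) \<in> K}"

definition coset_nbhd ::
    "'a::topological_space set \<Rightarrow> 'a \<Rightarrow> (real \<Rightarrow> 'a) set set \<Rightarrow> (real \<Rightarrow> 'a) \<Rightarrow> 'a set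
      \<Rightarrow> (real \<Rightarrow> 'a) set set" where
  "coset_nbhd X x0 K \<alpha> U = {coset_class X x0 K (\<alpha> +++ \<epsilon>) | \<epsilon>.
     path \<epsilon> \<and> path_image \<epsilon> \<subseteq> U \<and> pathstart \<epsilon> = pathfinish \<alpha>}"

definition tilde_space ::
    "'a::topological_space set \<Rightarrow> 'a \<Rightarrow> (real \<Rightarrow> 'a) set set \<Rightarrow> (real \<Rightarrow> 'a) set topology" where
  "tilde_space X x0 K = topology_generated_by {coset_nbhd X x0 K \<alpha> U | \<alpha> U.
     path \<alpha> \<and> path_image \<alpha> \<subseteq> X \<and> pathstart \<alpha> = x0 \<and>
     openin (top_of_set X) U \<and> pathfinish \<alpha> \<in> U}"

text \<open>All members of a class have the same end point.\<close>

definition end_proj :: "(real \<Rightarrow> 'a::topological_space) set \<Rightarrow> 'a" where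
  "end_proj c = pathfinish (SOME \<alpha>. \<alpha> \<in> c)"

lemma coset_class_self:
  assumes "x0 \<in> X" "subgroup K (fundamental_group X x0)"
    and "path \<alpha>" "path_image \<alpha> \<subseteq> X" "pathstart \<alpha> = x0"
  shows "\<alpha> \<in> coset_class X x0 K \<alpha>"
proof -
  have "path_class X (\<alpha> +++ reversepath \<alpha>) = \<one>\<^bsub>fundamental_group X x0\<^esub>"
    using homotopic_paths_inverse_right [of \<alpha> X] assms(3-5)
    by (simp add: fundamental_group_def path_class_eq_iff path_image_join)
  then show ?thesis
    using assms by (simp add: coset_class_def subgroup.one_closed)
qed

lemma end_proj_coset_class:
  assumes "x0 \<in> X" "subgroup K (fundamental_group X x0)"
    and "path \<alpha>" "path_image \<alpha> \<subseteq> X" "pathstart \<alpha> = x0"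
  shows "end_proj (coset_class X x0 K \<alpha>) = pathfinish \<alpha>"
proof -
  have "(SOME \<beta>. \<beta> \<in> coset_class X x0 K \<alpha>) \<in> coset_class X x0 K \<alpha>"
    using coset_class_self [OF assms] by (rule someI [of "\<lambda>\<beta>. \<beta> \<in> coset_class X x0 K \<alpha>"])
  then show ?thesis
    by (simp add: end_proj_def coset_class_def)
qed

definition unique_path_lifting :: "'b topology \<Rightarrow> ('b \<Rightarrow> 'a) \<Rightarrow> bool" where
  "unique_path_lifting Y f \<longleftrightarrow>
     (\<forall>\<alpha> \<beta>. pathin Y \<alpha> \<longrightarrow> pathin Y \<beta> \<longrightarrow> \<alpha> 0 = \<beta> 0 \<longrightarrow>
        (\<forall>t\<in>{0..1}. f (\<alpha> t) = f (\<beta> t)) \<longrightarrow> (\<forall>t\<in>{0..1}. \<alpha> t = \<beta> t))"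

section \<open>Closed subgroups\<close>

definition Tg_closed ::
    "'b::topological_space set \<Rightarrow> 'b \<Rightarrow> (real \<Rightarrow> 'b) set set \<Rightarrow> (real \<Rightarrow> 'b) set
      \<Rightarrow> 'a::topological_space set \<Rightarrow> 'a \<Rightarrow> (real \<Rightarrow> 'a) set set \<Rightarrow> bool" where
  "Tg_closed S s0 T g X x0 H \<longleftrightarrow>
     (\<forall>f. based_map S s0 X x0 f \<longrightarrow> induced_hom X f ` T \<subseteq> H \<longrightarrow> induced_hom X f g \<in> H)"

definition Tg_closure ::
    "'b::topological_space set \<Rightarrow> 'b \<Rightarrow> (real \<Rightarrow> 'b) set set \<Rightarrow> (real \<Rightarrow> 'b) set
      \<Rightarrow> 'a::topological_space set \<Rightarrow> 'a \<Rightarrow> (real \<Rightarrow> 'a) set set \<Rightarrow> (real \<Rightarrow> 'a) set set" where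
  "Tg_closure S s0 T g X x0 H =
     \<Inter>{L. subgroup L (fundamental_group X x0) \<and> Tg_closed S s0 T g X x0 L \<and> H \<subseteq> L}"

section \<open>The test space\<close>

definition hawaiian_circle :: "nat \<Rightarrow> (real \<times> real) set" where
  "hawaiian_circle n = sphere (1 / real n, 0) (1 / real n)"

definition hawaiian :: "(real \<times> real) set" where
  "hawaiian = (\<Union>n\<in>{1..}. hawaiian_circle n)"

definition hawaiian_plus :: "(real \<times> real) set" where
  "hawaiian_plus = hawaiian \<union> ({-1..0} \<times> {0})"

definition base_plus :: "real \<times> real" where
  "base_plus = (-1, 0)"

text \<open>The loop starts at the leftmost point of the circle, that is, at angle \<open>pi\<close>.\<close>

definition hawaiian_loop :: "nat \<Rightarrow> real \<Rightarrow> real \<times> real" where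
  "hawaiian_loop n t = (1 / real n, 0) + (1 / real n) *\<^sub>R (cos (pi + 2 * pi * t), sin (pi + 2 * pi * t))"

definition whisker :: "real \<Rightarrow> real \<times> real" where
  "whisker t = (t - 1, 0)"

definition whisker_class :: "(real \<Rightarrow> real \<times> real) \<Rightarrow> (real \<Rightarrow> real \<times> real) set" where
  "whisker_class p = path_class hawaiian_plus (whisker +++ p +++ reversepath whisker)"

definition c_class :: "nat \<Rightarrow> (real \<Rightarrow> real \<times> real) set" where
  "c_class n = whisker_class (hawaiian_loop n)"

text \<open>
  The map of the Hawaiian earring with \<open>hawaiian_loop n t \<mapsto> hawaiian_loop (j n) t\<close>: scaling about
  the origin by \<open>n / j n\<close> carries the circle with index \<open>n\<close> onto the one with index \<open>j n\<close>.
\<close>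

definition hawaiian_map :: "(nat \<Rightarrow> nat) \<Rightarrow> real \<times> real \<Rightarrow> real \<times> real" where
  "hawaiian_map j z =
     (if z = (0, 0) then (0, 0)
      else let n = (THE n. n \<ge> 1 \<and> z \<in> hawaiian_circle n) in (real n / real (j n)) *\<^sub>R z)"

lemma hawaiian_loop_in_circle: "hawaiian_loop n t \<in> hawaiian_circle n"
proof -
  have "norm ((1 / real n) *\<^sub>R (cos \<theta>, sin \<theta>)) = 1 / real n" for \<theta> :: real
    by (simp only: norm_scaleR norm_Pair) simp
  then show ?thesis
    unfolding hawaiian_loop_def hawaiian_circle_def mem_sphere dist_norm
    by (metis add_diff_cancel_left' norm_minus_commute)
qed

lemma hawaiian_circle_disjoint:
  assumes "n \<ge> 1" "m \<ge> 1" "z \<in> hawaiian_circle n" "z \<in> hawaiian_circle m" "z \<noteq> (0, 0)"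
  shows "n = m"
proof -
  obtain x y where z: "z = (x, y)" by (cases z)
  have *: "x\<^sup>2 + y\<^sup>2 = 2 * x / real i" if "i \<ge> 1" "z \<in> hawaiian_circle i" for i
  proof -
    have "sqrt ((1 / real i - x)\<^sup>2 + y\<^sup>2) = 1 / real i"
      using that by (simp add: z hawaiian_circle_def dist_norm norm_Pair)
    then have "(1 / real i - x)\<^sup>2 + y\<^sup>2 = (1 / real i)\<^sup>2"
      by (metis real_sqrt_pow2 sum_power2_ge_zero)
    then show ?thesis
      by (simp add: power2_eq_square algebra_simps)
  qed
  have "x \<noteq> 0"
    using * [OF assms(1,3)] assms(5) z by auto
  moreover have "2 * x / real n = 2 * x / real m"
    using * assms by metis
  ultimately show ?thesis
    using assms(1,2) by (simp add: field_simps)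
qed

lemma hawaiian_map_loop:
  assumes "n \<ge> 1" "j n \<ge> 1"
  shows "hawaiian_map j (hawaiian_loop n t) = hawaiian_loop (j n) t"
proof -
  let ?z = "hawaiian_loop n t"
  have scale: "(real n / real (j n)) *\<^sub>R ?z = hawaiian_loop (j n) t"
    using assms by (simp add: hawaiian_loop_def field_simps)
  show ?thesis
  proof (cases "?z = (0, 0)")
    case True
    with scale show ?thesis by (simp add: hawaiian_map_def zero_prod_def)
  next
    case False
    then have "(THE i. i \<ge> 1 \<and> ?z \<in> hawaiian_circle i) = n"
      using assms hawaiian_loop_in_circle hawaiian_circle_disjoint by (intro the_equality) blast+
    with False scale show ?thesis by (simp add: hawaiian_map_def)
  qed
qed

definition f_odd :: "real \<times> real \<Rightarrow> real \<times> real" where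
  "f_odd = hawaiian_map (\<lambda>n. 2 * n - 1)"

definition f_even :: "real \<times> real \<Rightarrow> real \<times> real" where
  "f_even = hawaiian_map (\<lambda>n. 2 * n)"

fun cantor_stage :: "nat \<Rightarrow> real set" where
  "cantor_stage 0 = {0..1}"
| "cantor_stage (Suc n) = (\<lambda>x. x / 3) ` cantor_stage n \<union> (\<lambda>x. 2 / 3 + x / 3) ` cantor_stage n"

definition cantor_set :: "real set" where
  "cantor_set = (\<Inter>n. cantor_stage n)"

text \<open>
  For \<open>n \<ge> 1\<close> and \<open>1 \<le> k \<le> 2 ^ (n - 1)\<close>, the left end point of the \<open>k\<close>-th (from the left) component of
  length \<open>1 / 3 ^ n\<close> of the complement of the Cantor set in the unit interval.  At stage \<open>n + 1\<close>, the
  left and right thirds of the unit interval each contain a scaled copy of all gaps of stage \<open>n\<close>.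
\<close>

fun gap_left :: "nat \<Rightarrow> nat \<Rightarrow> real" where
  "gap_left 0 k = 0"
| "gap_left (Suc 0) k = 1 / 3"
| "gap_left (Suc (Suc n)) k =
     (if k \<le> 2 ^ n then gap_left (Suc n) k / 3 else 2 / 3 + gap_left (Suc n) (k - 2 ^ n) / 3)"

definition cantor_gap :: "nat \<Rightarrow> nat \<Rightarrow> real set" where
  "cantor_gap n k = {gap_left n k <..< gap_left n k + 1 / 3 ^ n}"

lemma cantor_stage_subset: "cantor_stage n \<subseteq> {0..1}"
  by (induction n) (auto simp: subset_iff)

lemma mem_cantor_stage_Suc:
  "x \<in> cantor_stage (Suc n) \<longleftrightarrow> 3 * x \<in> cantor_stage n \<or> 3 * x - 2 \<in> cantor_stage n"
proof -
  have "x \<in> (\<lambda>x. x / 3) ` A \<longleftrightarrow> 3 * x \<in> A" for A :: "real set"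
    by (auto simp: image_iff mult.commute intro!: bexI [of _ "3 * x"])
  moreover have "x \<in> (\<lambda>x. 2 / 3 + x / 3) ` A \<longleftrightarrow> 3 * x - 2 \<in> A" for A :: "real set"
    by (auto simp: image_iff field_simps intro!: bexI [of _ "3 * x - 2"])
  ultimately show ?thesis by simp
qed

lemma gap_left_bounds:
  assumes "n \<ge> 1" "k \<in> {1..2 ^ (n - 1)}"
  shows "0 < gap_left n k" "gap_left n k + 1 / 3 ^ n < 1"
proof -
  have "0 < gap_left n k \<and> gap_left n k + 1 / 3 ^ n < 1"
    using assms
  proof (induction n k rule: gap_left.induct)
    case (3 n k)
    show ?case
    proof (cases "k \<le> 2 ^ n")
      case True
      with 3 show ?thesis by auto
    next
      case False
      then have "k - 2 ^ n \<in> {1..2 ^ (Suc n - 1)}" using 3(4) by auto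
      with 3 False show ?thesis by (auto simp: field_simps)
    qed
  qed auto
  then show "0 < gap_left n k" "gap_left n k + 1 / 3 ^ n < 1" by auto
qed

lemma gap_left_mono:
  assumes "n \<ge> 1" "1 \<le> k" "k < l" "l \<le> 2 ^ (n - 1)"
  shows "gap_left n k + 1 / 3 ^ n < gap_left n l"
  using assms
proof (induction n k arbitrary: l rule: gap_left.induct)
  case (3 n k)
  consider "l \<le> 2 ^ n" | "k \<le> 2 ^ n" "2 ^ n < l" | "2 ^ n < k" by linarith
  then show ?case
  proof cases
    case 1
    then have "gap_left (Suc n) k + 1 / 3 ^ Suc n < gap_left (Suc n) l"
      using 3 by auto
    with 1 3(5) show ?thesis by auto
  next
    case 2
    have "gap_left (Suc n) k + 1 / 3 ^ Suc n < 1" "0 < gap_left (Suc n) (l - 2 ^ n)"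
      using 2 3(4-) by (intro gap_left_bounds; auto)+
    moreover have "(1::real) / 3 ^ Suc (Suc n) = (1 / 3 ^ Suc n) / 3" by simp
    ultimately show ?thesis using 2 by auto
  next
    case right: 3
    then have "gap_left (Suc n) (k - 2 ^ n) + 1 / 3 ^ Suc n < gap_left (Suc n) (l - 2 ^ n)"
      using 3 by (intro 3(2)) auto
    with right 3(5) show ?thesis by (auto simp: field_simps)
  qed
qed auto

lemma mem_cantor_gap_Suc:
  "x \<in> cantor_gap (Suc (Suc n)) k \<longleftrightarrow>
     (if k \<le> 2 ^ n then 3 * x \<in> cantor_gap (Suc n) k else 3 * x - 2 \<in> cantor_gap (Suc n) (k - 2 ^ n))"
  by (auto simp: cantor_gap_def field_simps)

lemma not_mem_cantor_stage_iff:
  assumes "x \<in> {0..1}"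
  shows "x \<notin> cantor_stage n \<longleftrightarrow> (\<exists>m\<in>{1..n}. \<exists>k\<in>{1..2 ^ (m - 1)}. x \<in> cantor_gap m k)"
  using assms
proof (induction n arbitrary: x)
  case (Suc n)
  have gap: "0 < x \<and> x < 1" if "x \<in> cantor_gap m k" "m \<ge> 1" "k \<in> {1..2 ^ (m - 1)}" for x m k
    using that gap_left_bounds [of m k] by (auto simp: cantor_gap_def)
  have range: "{1..Suc n} = insert 1 (Suc ` {1..n})"
    by (simp only: image_Suc_atLeastAtMost) auto
  have one: "(\<exists>k\<in>{1..2 ^ (1 - 1)}. x \<in> cantor_gap 1 k) \<longleftrightarrow> 1 / 3 < x \<and> x < 2 / 3"
    by (auto simp: cantor_gap_def)
  have step: "(\<exists>k\<in>{1..2 ^ (Suc m - 1)}. x \<in> cantor_gap (Suc m) k) \<longleftrightarrow>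
     (\<exists>k\<in>{1..2 ^ (m - 1)}. 3 * x \<in> cantor_gap m k) \<or> (\<exists>k\<in>{1..2 ^ (m - 1)}. 3 * x - 2 \<in> cantor_gap m k)"
    (is "?L \<longleftrightarrow> ?R1 \<or> ?R2") if m: "m \<in> {1..n}" for m
  proof -
    obtain i where i: "m = Suc i" using m by (cases m) auto
    show ?thesis
    proof
      assume ?L
      then obtain k where k: "k \<in> {1..2 ^ Suc i}" "x \<in> cantor_gap (Suc (Suc i)) k"
        by (auto simp: i)
      show "?R1 \<or> ?R2"
      proof (cases "k \<le> 2 ^ i")
        case True
        with k show ?thesis by (auto simp: i mem_cantor_gap_Suc)
      next
        case False
        with k show ?thesis
          by (intro disjI2 bexI [of _ "k - 2 ^ i"]) (auto simp: i mem_cantor_gap_Suc)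
      qed
    next
      assume "?R1 \<or> ?R2"
      then show ?L
      proof
        assume ?R1
        then obtain k where "k \<in> {1..2 ^ i}" "3 * x \<in> cantor_gap (Suc i) k" by (auto simp: i)
        then show ?L by (intro bexI [of _ k]) (auto simp: i mem_cantor_gap_Suc)
      next
        assume ?R2
        then obtain k where "k \<in> {1..2 ^ i}" "3 * x - 2 \<in> cantor_gap (Suc i) k" by (auto simp: i)
        then show ?L by (intro bexI [of _ "k + 2 ^ i"]) (auto simp: i mem_cantor_gap_Suc)
      qed
    qed
  qed
  have rhs: "(\<exists>m\<in>{1..Suc n}. \<exists>k\<in>{1..2 ^ (m - 1)}. x \<in> cantor_gap m k) \<longleftrightarrow>
      (1 / 3 < x \<and> x < 2 / 3) \<or>
      (\<exists>m\<in>{1..n}. \<exists>k\<in>{1..2 ^ (m - 1)}. 3 * x \<in> cantor_gap m k) \<or>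
      (\<exists>m\<in>{1..n}. \<exists>k\<in>{1..2 ^ (m - 1)}. 3 * x - 2 \<in> cantor_gap m k)"
  proof -
    have "(\<exists>m\<in>{1..Suc n}. Q m) \<longleftrightarrow> Q 1 \<or> (\<exists>m\<in>{1..n}. Q (Suc m))" for Q
      unfolding range by blast
    note this [of "\<lambda>m. \<exists>k\<in>{1..2 ^ (m - 1)}. x \<in> cantor_gap m k"]
    moreover have "(\<exists>m\<in>{1..n}. \<exists>k\<in>{1..2 ^ (Suc m - 1)}. x \<in> cantor_gap (Suc m) k) \<longleftrightarrow>
        (\<exists>m\<in>{1..n}. (\<exists>k\<in>{1..2 ^ (m - 1)}. 3 * x \<in> cantor_gap m k) \<or>
                      (\<exists>k\<in>{1..2 ^ (m - 1)}. 3 * x - 2 \<in> cantor_gap m k))"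
      by (rule bex_cong [OF refl step])
    ultimately show ?thesis
      unfolding one by (simp only: bex_disj_distrib)
  qed
  have gap': "0 < y \<and> y < 1" if "\<exists>m\<in>{1..n}. \<exists>k\<in>{1..2 ^ (m - 1)}. y \<in> cantor_gap m k" for y
    using that gap by (metis atLeastAtMost_iff)
  have stage: "0 \<le> y \<and> y \<le> 1" if "y \<in> cantor_stage n" for y
    using that cantor_stage_subset by fastforce
  consider "x \<le> 1 / 3" | "1 / 3 < x" "x < 2 / 3" | "2 / 3 \<le> x" by linarith
  then show ?case
  proof cases
    case 1
    then have "3 * x \<in> {0..1}" using Suc.prems by auto
    moreover have "3 * x - 2 \<notin> cantor_stage n" using 1 stage [of "3 * x - 2"] by auto
    moreover have "\<not> (\<exists>m\<in>{1..n}. \<exists>k\<in>{1..2 ^ (m - 1)}. 3 * x - 2 \<in> cantor_gap m k)"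
      using 1 gap' [of "3 * x - 2"] by linarith
    moreover have "\<not> 1 / 3 < x" using 1 by simp
    ultimately show ?thesis
      unfolding rhs mem_cantor_stage_Suc using Suc.IH [of "3 * x"] by blast
  next
    case 2
    then show ?thesis
      unfolding rhs mem_cantor_stage_Suc using stage [of "3 * x - 2"] stage [of "3 * x"] by auto
  next
    case 3
    then have "3 * x - 2 \<in> {0..1}" using Suc.prems by auto
    moreover have "3 * x \<notin> cantor_stage n" using 3 stage [of "3 * x"] by auto
    moreover have "\<not> (\<exists>m\<in>{1..n}. \<exists>k\<in>{1..2 ^ (m - 1)}. 3 * x \<in> cantor_gap m k)"
      using 3 gap' [of "3 * x"] by linarith
    moreover have "\<not> x < 2 / 3" using 3 by simp
    ultimately show ?thesis
      unfolding rhs mem_cantor_stage_Suc using Suc.IH [of "3 * x - 2"] by blast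
  qed
qed auto

lemma compl_cantor_set:
  "{0..1} - cantor_set = (\<Union>n\<in>{1..}. \<Union>k\<in>{1..2 ^ (n - 1)}. cantor_gap n k)"
proof (rule Set.set_eqI)
  fix x
  show "x \<in> {0..1} - cantor_set \<longleftrightarrow> x \<in> (\<Union>n\<in>{1..}. \<Union>k\<in>{1..2 ^ (n - 1)}. cantor_gap n k)"
  proof (cases "x \<in> {0..1}")
    case True
    have "x \<in> {0..1} - cantor_set \<longleftrightarrow> (\<exists>n. x \<notin> cantor_stage n)"
      using True by (simp add: cantor_set_def)
    also have "\<dots> \<longleftrightarrow> (\<exists>m\<in>{1..}. \<exists>k\<in>{1..2 ^ (m - 1)}. x \<in> cantor_gap m k)"
      unfolding not_mem_cantor_stage_iff [OF True] by (meson atLeastAtMost_iff atLeast_iff order_refl)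
    finally show ?thesis by simp
  next
    case False
    moreover have "x \<in> {0..1}" if "n \<ge> 1" "k \<in> {1..2 ^ (n - 1)}" "x \<in> cantor_gap n k" for n k
      using that(3) gap_left_bounds [OF that(1,2)] by (auto simp: cantor_gap_def)
    ultimately show ?thesis by blast
  qed
qed

lemma gap_ends_in_cantor_set:
  assumes "n \<ge> 1" "k \<in> {1..2 ^ (n - 1)}"
  shows "gap_left n k \<in> cantor_set" "gap_left n k + 1 / 3 ^ n \<in> cantor_set"
proof -
  have 01: "0 \<in> cantor_stage j \<and> 1 \<in> cantor_stage j" for j
    by (induction j) (auto simp: mem_cantor_stage_Suc simp del: cantor_stage.simps(2))
  have "gap_left n k \<in> cantor_stage j \<and> gap_left n k + 1 / 3 ^ n \<in> cantor_stage j" for j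
    using assms
  proof (induction n k arbitrary: j rule: gap_left.induct)
    case (2 k)
    with 01 show ?case
      by (cases j) (auto simp: mem_cantor_stage_Suc simp del: cantor_stage.simps(2))
  next
    case (3 n k)
    show ?case
    proof (cases j)
      case 0
      have "(0::real) < 1 / 3 ^ Suc (Suc n)" by simp
      then have "0 \<le> gap_left (Suc (Suc n)) k \<and> gap_left (Suc (Suc n)) k \<le> 1"
        "0 \<le> gap_left (Suc (Suc n)) k + 1 / 3 ^ Suc (Suc n) \<and>
         gap_left (Suc (Suc n)) k + 1 / 3 ^ Suc (Suc n) \<le> 1"
        using gap_left_bounds [OF 3(3,4)] by linarith+
      with 0 show ?thesis by (simp del: gap_left.simps power_Suc)
    next
      case (Suc i)
      show ?thesis
      proof (cases "k \<le> 2 ^ n")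
        case True
        then have "gap_left (Suc n) k \<in> cantor_stage i \<and>
            gap_left (Suc n) k + 1 / 3 ^ Suc n \<in> cantor_stage i"
          using 3 by auto
        with Suc True show ?thesis
          by (simp add: mem_cantor_stage_Suc distrib_left del: cantor_stage.simps(2))
      next
        case False
        then have "gap_left (Suc n) (k - 2 ^ n) \<in> cantor_stage i \<and>
            gap_left (Suc n) (k - 2 ^ n) + 1 / 3 ^ Suc n \<in> cantor_stage i"
          using 3(4) by (intro 3(2)) auto
        with Suc False show ?thesis
          by (simp add: mem_cantor_stage_Suc distrib_left del: cantor_stage.simps(2))
      qed
    qed
  qed auto
  then show "gap_left n k \<in> cantor_set" "gap_left n k + 1 / 3 ^ n \<in> cantor_set"
    by (auto simp: cantor_set_def)
qed

lemma cantor_gap_disjoint: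
  assumes "n \<ge> 1" "k \<in> {1..2 ^ (n - 1)}" "m \<ge> 1" "l \<in> {1..2 ^ (m - 1)}"
    and "t \<in> cantor_gap n k" "t \<in> cantor_gap m l"
  shows "n = m \<and> k = l"
proof -
  have no: "e \<notin> cantor_set" if "e \<in> cantor_gap i j" "i \<ge> 1" "j \<in> {1..2 ^ (i - 1)}" for e i j
    using that compl_cantor_set by blast
  have ends: "gap_left n k \<notin> cantor_gap m l" "gap_left n k + 1 / 3 ^ n \<notin> cantor_gap m l"
    "gap_left m l \<notin> cantor_gap n k" "gap_left m l + 1 / 3 ^ m \<notin> cantor_gap n k"
    using gap_ends_in_cantor_set assms(1-4) no by blast+
  then have eq: "gap_left n k = gap_left m l" "(1::real) / 3 ^ n = 1 / 3 ^ m"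
    using assms(5,6) by (auto simp: cantor_gap_def)
  then have "n = m" by (simp add: field_simps)
  moreover have "k = l"
  proof (rule ccontr)
    assume "k \<noteq> l"
    then consider "k < l" | "l < k" by linarith
    then show False
    proof cases
      case 1
      then have "gap_left n k + 1 / 3 ^ n < gap_left n l"
        using assms \<open>n = m\<close> by (intro gap_left_mono) auto
      with eq \<open>n = m\<close> show False by (smt (verit) zero_less_power divide_pos_pos)
    next
      case 2
      then have "gap_left n l + 1 / 3 ^ n < gap_left n k"
        using assms \<open>n = m\<close> by (intro gap_left_mono) auto
      with eq \<open>n = m\<close> show False by (smt (verit) zero_less_power divide_pos_pos)
    qed
  qed
  ultimately show ?thesis by simp
qed

definition tau_loop :: "real \<Rightarrow> real \<times> real" where
  "tau_loop t =
     (if t \<in> cantor_set then (0, 0)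
      else let (n, k) = (THE (n, k). n \<ge> 1 \<and> k \<in> {1..2 ^ (n - 1)} \<and> t \<in> cantor_gap n k)
           in hawaiian_loop (2 ^ (n - 1) + k - 1) (3 ^ n * (t - gap_left n k)))"

lemma tau_loop_gap:
  assumes "n \<ge> 1" "k \<in> {1..2 ^ (n - 1)}" "t \<in> closure (cantor_gap n k)"
  shows "tau_loop t = hawaiian_loop (2 ^ (n - 1) + k - 1) (3 ^ n * (t - gap_left n k))"
proof -
  have "closure (cantor_gap n k) = {gap_left n k..gap_left n k + 1 / 3 ^ n}"
    by (simp add: cantor_gap_def)
  then consider "t = gap_left n k" | "t = gap_left n k + 1 / 3 ^ n" | "t \<in> cantor_gap n k"
    using assms(3) by (fastforce simp: cantor_gap_def)
  then show ?thesis
  proof cases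
    case 1
    then show ?thesis
      using gap_ends_in_cantor_set(1) [OF assms(1,2)]
      by (simp add: tau_loop_def hawaiian_loop_def)
  next
    case 2
    then show ?thesis
      using gap_ends_in_cantor_set(2) [OF assms(1,2)]
      by (simp add: tau_loop_def hawaiian_loop_def)
  next
    case 3
    then have "t \<notin> cantor_set"
      using assms(1,2) compl_cantor_set by blast
    moreover have "(THE (n, k). n \<ge> 1 \<and> k \<in> {1..2 ^ (n - 1)} \<and> t \<in> cantor_gap n k) = (n, k)"
    proof (rule the_equality)
      show "case (n, k) of (n, k) \<Rightarrow> n \<ge> 1 \<and> k \<in> {1..2 ^ (n - 1)} \<and> t \<in> cantor_gap n k"
        using 3 assms(1,2) by simp
    next
      fix q :: "nat \<times> nat"
      assume "case q of (n, k) \<Rightarrow> n \<ge> 1 \<and> k \<in> {1..2 ^ (n - 1)} \<and> t \<in> cantor_gap n k"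
      then show "q = (n, k)"
        using cantor_gap_disjoint [OF _ _ assms(1,2) _ 3, of "fst q" "snd q"]
        by (cases q) simp
    qed
    ultimately show ?thesis by (simp add: tau_loop_def)
  qed
qed

definition p_class :: "nat \<Rightarrow> (real \<Rightarrow> real \<times> real) set" where
  "p_class n = whisker_class (hawaiian_loop (2 * n - 1) +++ reversepath (hawaiian_loop (2 * n)))"

definition P_group :: "(real \<Rightarrow> real \<times> real) set set" where
  "P_group = generate (fundamental_group hawaiian_plus base_plus) (p_class ` {1..})"

definition p_tau :: "(real \<Rightarrow> real \<times> real) set" where
  "p_tau = whisker_class ((f_odd \<circ> tau_loop) +++ reversepath (f_even \<circ> tau_loop))"

definition transfinite_products ::
    "'a::topological_space set \<Rightarrow> 'a \<Rightarrow> (real \<Rightarrow> 'a) set set \<Rightarrow> bool" where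
  "transfinite_products X x0 H \<longleftrightarrow>
     (\<forall>a b. based_map hawaiian_plus base_plus X x0 a \<longrightarrow> based_map hawaiian_plus base_plus X x0 b \<longrightarrow>
        (\<forall>t\<in>{0..1}. a (whisker t) = b (whisker t)) \<longrightarrow>
        (\<forall>n\<ge>1. H #>\<^bsub>fundamental_group X x0\<^esub> induced_hom X a (c_class n) =
               H #>\<^bsub>fundamental_group X x0\<^esub> induced_hom X b (c_class n)) \<longrightarrow>
        (\<forall>g\<in>carrier (fundamental_group hawaiian_plus base_plus).
           H #>\<^bsub>fundamental_group X x0\<^esub> induced_hom X a g =
           H #>\<^bsub>fundamental_group X x0\<^esub> induced_hom X b g))"

end

theory Submission
  imports Defs
begin

text \<open>
  Let \<open>K\<close> be a normal subgroup of the fundamental group.  Call two paths in \<open>X\<close> with the same ends congruent if they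
  differ by an element of \<open>K\<close> after a path from the base point has been put in front of both.  This is compatible with
  concatenation.  The points of \<^const>\<open>tilde_space\<close> are the congruence classes of paths that start at the base
  point, and all other paths act on them by concatenation.  A path in this space is a family of classes that changes by short paths
  between close times.  One lift of a path in \<open>X\<close> is obtained by appending its initial parts to the first class, and unique path
  lifting says that there is no other (\<open>unique_path_lifting_iff\<close>).

  Transfinite products follow from unique lifts (\<open>unique_lifts_imp_products\<close>).  Given maps \<open>a\<close> and \<open>b\<close> and a loop \<open>\<sigma>\<close>
  in the test space, follow \<open>a \<circ> \<sigma>\<close> up to the latest visit to the whisker and \<open>b \<circ> \<sigma>\<close> from there.  The
  excursions of \<open>\<sigma>\<close> are loops in single circles, so that \<open>a\<close> and \<open>b\<close> send them to congruent loops; this makes the family a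
  lift of \<open>b \<circ> \<sigma>\<close>.  Its end is the class of \<open>a \<circ> \<sigma>\<close>, and uniqueness yields the claim.

  The converse uses products over the gaps of the Cantor set (\<open>cantor_products\<close>).  Near a point where \<open>X\<close> is
  semilocally simply connected, every lift follows its trace.  The exceptional points are isolated from each other, and it remains
  to treat a path near one such point \<open>x\<close>.  The times when the path is at \<open>x\<close> form a closed set \<open>T\<close>.  Between two of these
  times the lift changes by a loop at \<open>x\<close>, which is short if the times are close.  Split an interval with ends
  in \<open>T\<close> at the gap of \<open>T\<close> around its midpoint, and repeat this with both parts.  The nodes of the resulting
  binary tree correspond to the gaps of the Cantor set.  Put on the gap of a node the loop of the whole interval, preceded and
  followed by the inverses of the loops of the two parts.  In the product over all nodes everything cancels but the loop of the
  initial interval.  These infinitely many cancellations amount to a genuine homotopy, because those at deep levels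
  are small (\<open>homotopic_word\<close>).  On the other hand, the loop at a node is congruent to the piece of the path over the gap
  of \<open>T\<close>, and the product of these pieces is the path.  So the congruence of the two Cantor products says that the lift
  follows the path (\<open>telescope\<close>).

  The Cantor product of a sequence of loops is the image of \<^const>\<open>tau_loop\<close> under a map of the test space.  For this reason Cantor
  products are provided not only by transfinite products but also by a normal subgroup that is closed for
  \<^const>\<open>P_group\<close> and \<^const>\<open>p_tau\<close>.  The closure of a normal subgroup is one, since it is again normal:
  conjugation can be absorbed by rerouting the whisker (\<open>normal_Tg_closure\<close>).
\<close>

section \<open>Path congruences\<close>

abbreviation path_in :: "'a::topological_space set \<Rightarrow> (real \<Rightarrow> 'a) \<Rightarrow> bool" where
  "path_in X p \<equiv> path p \<and> path_image p \<subseteq> X"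

text \<open>The end points may come in either order, so that reversing a subarc exchanges them.\<close>

abbreviation subarc :: "(real \<Rightarrow> 'a) \<Rightarrow> real \<Rightarrow> real \<Rightarrow> real \<Rightarrow> 'a" where
  "subarc g u v \<equiv> g \<circ> linepath u v"

lemma linepath_01: "u \<in> {0..1} \<Longrightarrow> v \<in> {0..1} \<Longrightarrow> t \<in> {0..1} \<Longrightarrow> linepath u v t \<in> {0..1::real}"
  using convex_bound_le [of u 1 v "1 - t" t] by (auto simp: linepath_def)

lemma linepath_in_segment:
  "t \<in> {0..1} \<Longrightarrow> linepath u v t \<in> closed_segment u v"
  by (metis imageI path_image_def path_image_linepath)

lemma path_image_subarc: "path_image (subarc g u v) = g ` closed_segment u v"
  by (simp add: path_image_compose)

lemma subarc_0_1: "subarc g 0 1 = g"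
  by (auto simp: linepath_def)

lemma subarc_subarc:
  fixes u v a b :: real
  shows "subarc (subarc g u v) a b = subarc g (linepath u v a) (linepath u v b)"
  by (auto simp: linepath_def fun_eq_iff algebra_simps intro!: arg_cong [of _ _ g])

lemma subarc_trivial: "subarc g u u = (\<lambda>_. g u)"
  by (auto simp: linepath_refl)

lemma reversepath_subarc: "reversepath (subarc g u v) = subarc g v u"
  by (metis path_compose_reversepath reversepath_linepath)

lemma closed_segment_01: "u \<in> {0..1} \<Longrightarrow> v \<in> {0..1} \<Longrightarrow> closed_segment u v \<subseteq> {0..1::real}"
  by (auto simp: closed_segment_eq_real_ivl)

lemma path_in_subarc:
  assumes "path_in X g" "u \<in> {0..1}" "v \<in> {0..1}"
  shows "path_in X (subarc g u v)"
proof
  have "g ` closed_segment u v \<subseteq> g ` {0..1}"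
    using assms by (intro image_mono closed_segment_01)
  then show "path_image (subarc g u v) \<subseteq> X"
    using assms unfolding path_image_subarc by (auto simp: path_image_def)
  show "path (subarc g u v)"
    using assms closed_segment_01 [of u v]
    by (intro path_continuous_image) (auto simp: path_def elim: continuous_on_subset)
qed

lemma path_in_join:
  "path_in X p \<Longrightarrow> path_in X q \<Longrightarrow> pathfinish p = pathstart q \<Longrightarrow> path_in X (p +++ q)"
  by (simp add: path_image_join)

lemma path_in_const: "x \<in> X \<Longrightarrow> path_in X (\<lambda>_. x)"
  by (auto simp: path_def path_image_def)

lemma pathstart_const [simp]: "pathstart (\<lambda>_. x) = x"
  and pathfinish_const [simp]: "pathfinish (\<lambda>_. x) = x"
  by (simp_all add: pathstart_def pathfinish_def)

text \<open>
  An interval is convex, so that paths in it with the same ends are homotopic by straight lines.  Hence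
  any two ways to run through a stretch of \<open>g\<close> that have the same ends are homotopic within that stretch.
\<close>

lemma homotopic_paths_through_interval:
  fixes C :: "real set"
  assumes "continuous_on C g" "convex C" "path_in C a" "path_in C b"
    and "pathstart a = pathstart b" "pathfinish a = pathfinish b"
  shows "homotopic_paths (g ` C) (g \<circ> a) (g \<circ> b)"
proof (rule homotopic_paths_continuous_image)
  have "closed_segment (a t) (b t) \<subseteq> C" if "t \<in> {0..1}" for t
    using assms that by (intro closed_segment_subset) (auto simp: path_image_def)
  then show "homotopic_paths C a b"
    using assms by (intro homotopic_paths_linear) auto
qed (use assms in auto)

lemma homotopic_subarc_join:
  assumes "continuous_on C g" "convex C" "u \<in> C" "v \<in> C" "w \<in> C"
  shows "homotopic_paths (g ` C) (subarc g u v +++ subarc g v w) (subarc g u w)"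
proof -
  have "homotopic_paths (g ` C) (g \<circ> (linepath u v +++ linepath v w)) (subarc g u w)"
    using assms closed_segment_subset [of _ C]
    by (intro homotopic_paths_through_interval) (auto simp: path_image_join)
  then show ?thesis
    by (simp add: path_compose_join)
qed

text \<open>
  A quotient of the fundamental groupoid of \<open>X\<close> with the same objects.  Homotopy of paths is one instance
  and serves for calculations in the fundamental groupoid itself; congruence modulo a subgroup of the
  fundamental group is the other.
\<close>

locale path_congruence =
  fixes X :: "'a::topological_space set"
    and R :: "(real \<Rightarrow> 'a) \<Rightarrow> (real \<Rightarrow> 'a) \<Rightarrow> bool"  (infix "\<simeq>" 50)
  assumes paths: "p \<simeq> q \<Longrightarrow> path_in X p \<and> path_in X q"
    and ends: "p \<simeq> q \<Longrightarrow> pathstart p = pathstart q \<and> pathfinish p = pathfinish q"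
    and homotopic: "homotopic_paths X p q \<Longrightarrow> p \<simeq> q"
    and sym: "p \<simeq> q \<Longrightarrow> q \<simeq> p"
    and trans: "p \<simeq> q \<Longrightarrow> q \<simeq> r \<Longrightarrow> p \<simeq> r"
    and join: "p \<simeq> p' \<Longrightarrow> q \<simeq> q' \<Longrightarrow> pathfinish p = pathstart q \<Longrightarrow> p +++ q \<simeq> p' +++ q'"
begin

declare trans [trans]

lemma refl: "path_in X p \<Longrightarrow> p \<simeq> p"
  by (simp add: homotopic)

lemma eq_on: "path_in X p \<Longrightarrow> (\<And>t. t \<in> {0..1} \<Longrightarrow> p t = q t) \<Longrightarrow> p \<simeq> q"
  by (rule homotopic, rule homotopic_paths_eq) auto

lemma assoc:
  assumes "path_in X p" "path_in X q" "path_in X r"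
    "pathfinish p = pathstart q" "pathfinish q = pathstart r"
  shows "(p +++ q) +++ r \<simeq> p +++ (q +++ r)"
  using assms by (intro homotopic homotopic_paths_sym [OF homotopic_paths_assoc]) auto

lemma const_right: "path_in X p \<Longrightarrow> pathfinish p = x \<Longrightarrow> p +++ (\<lambda>_. x) \<simeq> p"
  using homotopic_paths_const_right [of p X] homotopic sym by blast

lemma const_left: "path_in X p \<Longrightarrow> pathstart p = x \<Longrightarrow> (\<lambda>_. x) +++ p \<simeq> p"
  using homotopic_paths_const_left [of p X] homotopic sym by blast

lemma inverse_right: "path_in X p \<Longrightarrow> p +++ reversepath p \<simeq> (\<lambda>_. pathstart p)"
  using homotopic_paths_inverse_right [of p X] homotopic by blast

lemma inverse_left: "path_in X p \<Longrightarrow> reversepath p +++ p \<simeq> (\<lambda>_. pathfinish p)"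
  using inverse_right [of "reversepath p"] by simp

lemma subarc_join:
  assumes "path_in X g" "u \<in> {0..1}" "v \<in> {0..1}" "w \<in> {0..1}"
  shows "subarc g u v +++ subarc g v w \<simeq> subarc g u w"
  using homotopic_subarc_join [of "{0..1}" g u v w] assms
  by (intro homotopic) (auto simp: path_def path_image_def intro: homotopic_paths_subset)

text \<open>
  Paths act by concatenation on the classes of paths with a fixed starting point, and \<open>e\<close> carries the class
  of \<open>p\<close> to the class of \<open>q\<close>.  Following a class through a chain of steps replaces the regrouping and the
  insertion of inverses in calculations with concatenations.
\<close>

definition step :: "(real \<Rightarrow> 'a) \<Rightarrow> (real \<Rightarrow> 'a) \<Rightarrow> (real \<Rightarrow> 'a) \<Rightarrow> bool" where
  "step p e q \<longleftrightarrow> pathfinish p = pathstart e \<and> p +++ e \<simeq> q"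

lemma step_paths:
  assumes "step p e q"
  shows "path_in X p" "path_in X e" "path_in X q"
    "pathstart e = pathfinish p" "pathfinish e = pathfinish q" "pathstart q = pathstart p"
  using assms paths [of "p +++ e" q] ends [of "p +++ e" q]
  by (auto simp: step_def path_image_join)

lemma step_refl: "path_in X p \<Longrightarrow> pathfinish p = x \<Longrightarrow> step p (\<lambda>_. x) p"
  by (simp add: step_def const_right)

lemma step_self: "path_in X (p +++ e) \<Longrightarrow> pathfinish p = pathstart e \<Longrightarrow> step p e (p +++ e)"
  by (simp add: step_def refl)

lemma step_join:
  assumes "step p e q" "step q f r"
  shows "step p (e +++ f) r"
proof -
  note * = step_paths [OF assms(1)] step_paths [OF assms(2)]
  have "p +++ (e +++ f) \<simeq> (p +++ e) +++ f"
    using * by (intro sym [OF assoc]) auto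
  also have "(p +++ e) +++ f \<simeq> q +++ f"
    using * assms by (intro join refl) (auto simp: step_def)
  also have "q +++ f \<simeq> r"
    using assms by (simp add: step_def)
  finally show ?thesis
    using * by (simp add: step_def)
qed

lemma step_cong:
  assumes "step p e q" "p \<simeq> p'" "e \<simeq> e'" "q \<simeq> q'"
  shows "step p' e' q'"
proof -
  have "p' +++ e' \<simeq> p +++ e"
    using assms ends by (intro sym [OF join]) (auto simp: step_def)
  then show ?thesis
    using assms ends [OF assms(2)] ends [OF assms(3)] by (auto simp: step_def intro: trans)
qed

lemma step_cong1: "step p e q \<Longrightarrow> p \<simeq> p' \<Longrightarrow> step p' e q"
  and step_cong2: "step p e q \<Longrightarrow> e \<simeq> e' \<Longrightarrow> step p e' q"
  and step_cong3: "step p e q \<Longrightarrow> q \<simeq> q' \<Longrightarrow> step p e q'"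
  by (auto intro: step_cong refl dest: step_paths)

lemma step_reverse:
  assumes "step p e q"
  shows "step q (reversepath e) p"
proof -
  note * = step_paths [OF assms]
  have "q +++ reversepath e \<simeq> (p +++ e) +++ reversepath e"
    using * assms by (intro join refl sym [of "p +++ e" q]) (auto simp: step_def)
  also have "(p +++ e) +++ reversepath e \<simeq> p +++ (e +++ reversepath e)"
    using * by (intro assoc) auto
  also have "p +++ (e +++ reversepath e) \<simeq> p +++ (\<lambda>_. pathfinish p)"
    using * inverse_right [of e] by (intro join refl) auto
  also have "p +++ (\<lambda>_. pathfinish p) \<simeq> p"
    using * by (intro const_right) auto
  finally show ?thesis
    using * by (simp add: step_def)
qed

lemma step_reverse_iff: "step q (reversepath e) p \<longleftrightarrow> step p e q"
  using step_reverse by fastforce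

lemma step_target: "step p e q \<Longrightarrow> step p e r \<Longrightarrow> q \<simeq> r"
  unfolding step_def using sym trans by blast

text \<open>The action is free.  Two paths are thus shown to be congruent by carrying one class to the same class.\<close>

lemma step_unique:
  assumes "step p e q" "step p f q"
  shows "e \<simeq> f"
proof -
  note * = step_paths [OF assms(1)] step_paths [OF assms(2)]
  have key: "g \<simeq> reversepath p +++ q" if "step p g q" for g
  proof -
    note g = step_paths [OF that]
    have "g \<simeq> (\<lambda>_. pathfinish p) +++ g"
      using g by (intro sym [OF const_left]) auto
    also have "(\<lambda>_. pathfinish p) +++ g \<simeq> (reversepath p +++ p) +++ g"
      using g by (intro join refl sym [OF inverse_left]) auto
    also have "(reversepath p +++ p) +++ g \<simeq> reversepath p +++ (p +++ g)"
      using g by (intro assoc) auto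
    also have "reversepath p +++ (p +++ g) \<simeq> reversepath p +++ q"
      using g that by (intro join refl) (auto simp: step_def)
    finally show ?thesis .
  qed
  show ?thesis
    using key [OF assms(1)] key [OF assms(2)] sym trans by blast
qed

lemma reverse_cong:
  assumes "p \<simeq> q"
  shows "reversepath p \<simeq> reversepath q"
proof -
  have p: "path_in X p" "path_in X q" "pathstart p = pathstart q" "pathfinish p = pathfinish q"
    using paths [OF assms] ends [OF assms] by auto
  then have "pathstart p \<in> X" by (meson pathstart_in_path_image subsetD)
  then have "step (\<lambda>_. pathstart p) p p" 
    using p by (simp add: step_def const_left)
  then have "step p (reversepath p) (\<lambda>_. pathstart p)" "step p (reversepath q) (\<lambda>_. pathstart p)"
    using assms step_reverse step_cong2 step_cong3 step_cong1 sym by blast+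
  then show ?thesis by (rule step_unique)
qed

lemma step_subarc:
  assumes "step p (subarc g u v) q" "path_in X g" "u \<in> {0..1}" "v \<in> {0..1}" "w \<in> {0..1}"
  shows "step q (subarc g v w) r \<longleftrightarrow> step p (subarc g u w) r"
proof
  assume "step q (subarc g v w) r"
  then show "step p (subarc g u w) r"
    using step_cong2 [OF step_join [OF assms(1)] subarc_join] assms(2-) by blast
next
  assume *: "step p (subarc g u w) r"
  have "step q (reversepath (subarc g u v)) p" by (simp add: step_reverse_iff assms(1))
  then have "step q (subarc g v u) p"
    by (simp only: reversepath_subarc)
  then show "step q (subarc g v w) r"
    using step_cong2 [OF step_join [OF _ *] subarc_join] assms(2-) by blast
qed

lemma step_subarc_reverse: "step p (subarc g u v) q \<longleftrightarrow> step q (subarc g v u) p"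
  using step_reverse_iff [of q "subarc g u v" p] unfolding reversepath_subarc by blast

lemma cancel_left:
  assumes "p +++ q \<simeq> p +++ r" "pathfinish p = pathstart q" "pathfinish p = pathstart r"
  shows "q \<simeq> r"
proof -
  have "step p q (p +++ r)" "step p r (p +++ r)"
    using assms paths [OF assms(1)] by (simp_all add: step_def refl)
  then show ?thesis by (rule step_unique)
qed

lemma cancel_right:
  assumes "p +++ r \<simeq> q +++ r" "pathfinish p = pathstart r" "pathfinish q = pathstart r"
  shows "p \<simeq> q"
proof -
  have "step p r (q +++ r)" "step q r (q +++ r)"
    using assms paths [OF assms(1)] by (simp_all add: step_def refl)
  then show ?thesis using step_reverse step_target by blast
qed

lemma conjugate_iff:
  assumes "path_in X d" "pathstart a = pathfinish d" "pathfinish a = pathfinish d"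
    "pathstart b = pathfinish d" "pathfinish b = pathfinish d"
  shows "d +++ a +++ reversepath d \<simeq> d +++ b +++ reversepath d \<longleftrightarrow> a \<simeq> b"
proof
  assume "d +++ a +++ reversepath d \<simeq> d +++ b +++ reversepath d"
  then have "a +++ reversepath d \<simeq> b +++ reversepath d" using assms by (auto intro: cancel_left)
  then show "a \<simeq> b" using assms by (auto intro: cancel_right)
next
  assume "a \<simeq> b"
  then show "d +++ a +++ reversepath d \<simeq> d +++ b +++ reversepath d"
    using assms by (intro join refl) auto
qed

end

section \<open>Products of loops over the gaps of the Cantor set\<close>

text \<open>
  The definition of \<^const>\<open>tau_loop\<close> with arbitrary loops: the loop \<open>q i\<close> is run through over the \<open>i\<close>-th gap of
  the Cantor set, and all points of the Cantor set go to \<open>x\<close>.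
\<close>

definition cantor_product :: "'a \<Rightarrow> (nat \<Rightarrow> real \<Rightarrow> 'a) \<Rightarrow> real \<Rightarrow> 'a" where
  "cantor_product x q t =
     (if t \<in> cantor_set then x
      else let (n, k) = (THE (n, k). n \<ge> 1 \<and> k \<in> {1..2 ^ (n - 1)} \<and> t \<in> cantor_gap n k)
           in q (2 ^ (n - 1) + k - 1) (3 ^ n * (t - gap_left n k)))"

lemma tau_loop_eq_cantor_product: "tau_loop = cantor_product (0, 0) hawaiian_loop"
  by (rule ext) (simp add: tau_loop_def cantor_product_def)

lemma cantor_product_in_cantor_set: "t \<in> cantor_set \<Longrightarrow> cantor_product x q t = x"
  by (simp add: cantor_product_def)

lemma image_cantor_product: "f (cantor_product x q t) = cantor_product (f x) (\<lambda>i. f \<circ> q i) t"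
  by (simp add: cantor_product_def split: prod.split)

lemma cantor_product_gap:
  assumes n: "n \<ge> 1" "k \<in> {1..2 ^ (n - 1)}"
    and t: "gap_left n k \<le> t" "t \<le> gap_left n k + 1 / 3 ^ n"
    and q: "q (2 ^ (n - 1) + k - 1) 0 = x" "q (2 ^ (n - 1) + k - 1) 1 = x"
  shows "cantor_product x q t = q (2 ^ (n - 1) + k - 1) (3 ^ n * (t - gap_left n k))"
proof -
  consider "t = gap_left n k" | "t = gap_left n k + 1 / 3 ^ n" | "t \<in> cantor_gap n k"
    using t by (fastforce simp: cantor_gap_def)
  then show ?thesis
  proof cases
    case 1
    then show ?thesis
      using gap_ends_in_cantor_set(1) [OF n] q by (simp add: cantor_product_def)
  next
    case 2
    then show ?thesis
      using gap_ends_in_cantor_set(2) [OF n] q by (simp add: cantor_product_def)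
  next
    case 3
    then have "t \<notin> cantor_set"
      using n compl_cantor_set by blast
    moreover have "(THE (n, k). n \<ge> 1 \<and> k \<in> {1..2 ^ (n - 1)} \<and> t \<in> cantor_gap n k) = (n, k)"
    proof (rule the_equality)
      show "case (n, k) of (n, k) \<Rightarrow> n \<ge> 1 \<and> k \<in> {1..2 ^ (n - 1)} \<and> t \<in> cantor_gap n k"
        using 3 n by simp
    next
      fix q :: "nat \<times> nat"
      assume "case q of (n, k) \<Rightarrow> n \<ge> 1 \<and> k \<in> {1..2 ^ (n - 1)} \<and> t \<in> cantor_gap n k"
      then show "q = (n, k)"
        using cantor_gap_disjoint [OF _ _ n _ 3, of "fst q" "snd q"] by (cases q) simp
    qed
    ultimately show ?thesis by (simp add: cantor_product_def)
  qed
qed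

lemma cantor_set_or_gap:
  assumes "t \<in> {0..1}"
  obtains "t \<in> cantor_set"
  | n k where "n \<ge> 1" "k \<in> {1..2 ^ (n - 1)}" "t \<in> cantor_gap n k" "t \<notin> cantor_set"
  using assms compl_cantor_set by blast

text \<open>
  The enumeration \<open>(n, k) \<mapsto> 2 ^ (n - 1) + k - 1\<close> of the gaps is a bijection onto the positive integers, because
  the gaps of level \<open>n\<close> take the indices from \<open>2 ^ (n - 1)\<close> to \<open>2 ^ n - 1\<close>; level and position form its inverse.
\<close>

definition gap_level :: "nat \<Rightarrow> nat" where
  "gap_level i = (LEAST n. i < 2 ^ n)"

definition gap_pos :: "nat \<Rightarrow> nat" where
  "gap_pos i = i + 1 - 2 ^ (gap_level i - 1)"

lemma gap_level_index:
  assumes "n \<ge> 1" "k \<in> {1..2 ^ (n - 1)}"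
  shows "gap_level (2 ^ (n - 1) + k - 1) = n" "gap_pos (2 ^ (n - 1) + k - 1) = k"
proof -
  show *: "gap_level (2 ^ (n - 1) + k - 1) = n"
    unfolding gap_level_def
  proof (rule Least_equality)
    show "2 ^ (n - 1) + k - 1 < 2 ^ n" using assms by (cases n) auto
    fix m assume m: "2 ^ (n - 1) + k - 1 < (2::nat) ^ m"
    show "n \<le> m"
    proof (rule ccontr)
      assume "\<not> n \<le> m"
      then have "(2::nat) ^ m \<le> 2 ^ (n - 1)" by (intro power_increasing) auto
      moreover have "(2::nat) ^ (n - 1) \<le> 2 ^ (n - 1) + k - 1" using assms by auto
      ultimately show False using m by linarith
    qed
  qed
  show "gap_pos (2 ^ (n - 1) + k - 1) = k"
    unfolding gap_pos_def * using assms by auto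
qed

lemma gap_index_level:
  assumes "i \<ge> 1"
  shows "gap_level i \<ge> 1" "gap_pos i \<in> {1..2 ^ (gap_level i - 1)}"
    "2 ^ (gap_level i - 1) + gap_pos i - 1 = i"
proof -
  have less: "i < 2 ^ gap_level i"
    unfolding gap_level_def by (rule LeastI [of _ i]) simp
  show 1: "gap_level i \<ge> 1"
  proof (rule ccontr)
    assume "\<not> gap_level i \<ge> 1"
    then have "gap_level i = 0" by simp
    with less have "i < 2 ^ 0" by metis
    with assms show False by simp
  qed
  have ge: "2 ^ (gap_level i - 1) \<le> i"
  proof (rule ccontr)
    assume "\<not> 2 ^ (gap_level i - 1) \<le> i"
    then have "gap_level i \<le> gap_level i - 1"
      unfolding gap_level_def by (intro Least_le) auto
    with 1 show False by simp
  qed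
  have "(2::nat) ^ gap_level i = 2 * 2 ^ (gap_level i - 1)"
    using 1 by (cases "gap_level i") auto
  then show "gap_pos i \<in> {1..2 ^ (gap_level i - 1)}"
    using less ge by (auto simp: gap_pos_def)
  show "2 ^ (gap_level i - 1) + gap_pos i - 1 = i"
    using ge by (simp add: gap_pos_def)
qed

lemma cantor_product_cong:
  assumes "t \<in> {0..1}" and "\<And>i s. i \<ge> 1 \<Longrightarrow> s \<in> {0..1} \<Longrightarrow> q i s = q' i s"
    and "\<And>i. i \<ge> 1 \<Longrightarrow> q i 0 = x \<and> q i 1 = x"
  shows "cantor_product x q t = cantor_product x q' t"
  using assms(1)
proof (cases rule: cantor_set_or_gap)
  case 1
  then show ?thesis by (simp add: cantor_product_def)
next
  case (2 n k)
  let ?i = "2 ^ (n - 1) + k - 1"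
  have "?i \<ge> 1" using 2 by (simp add: Suc_leI)
  moreover have "3 ^ n * (t - gap_left n k) \<in> {0..1}"
    using 2 by (auto simp: cantor_gap_def field_simps)
  moreover have "q' ?i 0 = x" "q' ?i 1 = x"
    using assms(2) [of ?i 0] assms(2) [of ?i 1] assms(3) [of ?i] \<open>?i \<ge> 1\<close> by auto
  moreover have "cantor_product x q t = q ?i (3 ^ n * (t - gap_left n k))"
    using 2 assms(3) [OF \<open>?i \<ge> 1\<close>] by (intro cantor_product_gap) (auto simp: cantor_gap_def)
  moreover have "cantor_product x q' t = q' ?i (3 ^ n * (t - gap_left n k))"
    using 2 calculation by (intro cantor_product_gap) (auto simp: cantor_gap_def)
  ultimately show ?thesis
    using assms(2) by metis
qed

definition null_loops :: "'a::metric_space set \<Rightarrow> 'a \<Rightarrow> (nat \<Rightarrow> real \<Rightarrow> 'a) \<Rightarrow> bool" where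
  "null_loops X x q \<longleftrightarrow>
     (\<forall>i\<ge>1. path_in X (q i) \<and> pathstart (q i) = x \<and> pathfinish (q i) = x) \<and>
     (\<forall>r>0. \<exists>M. \<forall>i\<ge>M. path_image (q i) \<subseteq> ball x r)"

lemma null_loopsD:
  assumes "null_loops X x q" "i \<ge> 1"
  shows "path_in X (q i)" "pathstart (q i) = x" "pathfinish (q i) = x" "q i 0 = x" "q i 1 = x"
  using assms by (auto simp: null_loops_def pathstart_def pathfinish_def)

lemma pathstart_cantor_product: "pathstart (cantor_product x q) = x"
  and pathfinish_cantor_product: "pathfinish (cantor_product x q) = x"
proof -
  have "0 \<in> cantor_stage n \<and> 1 \<in> cantor_stage n" for n
    by (induction n) (auto simp: mem_cantor_stage_Suc simp del: cantor_stage.simps(2))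
  then show "pathstart (cantor_product x q) = x" "pathfinish (cantor_product x q) = x"
    by (auto simp: pathstart_def pathfinish_def cantor_product_def cantor_set_def)
qed

lemma path_image_cantor_product:
  assumes "\<And>i. i \<ge> 1 \<Longrightarrow> path_image (q i) \<subseteq> X" "x \<in> X"
    "\<And>i. i \<ge> 1 \<Longrightarrow> q i 0 = x \<and> q i 1 = x"
  shows "path_image (cantor_product x q) \<subseteq> X"
proof -
  have "cantor_product x q t \<in> X" if "t \<in> {0..1}" for t
    using that
  proof (cases rule: cantor_set_or_gap)
    case 1
    with assms show ?thesis by (simp add: cantor_product_def)
  next
    case (2 n k)
    let ?i = "2 ^ (n - 1) + k - 1"
    have i: "?i \<ge> 1" using 2 by (simp add: Suc_leI)
    moreover have "3 ^ n * (t - gap_left n k) \<in> {0..1}"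
      using 2 by (auto simp: cantor_gap_def field_simps)
    ultimately have "q ?i (3 ^ n * (t - gap_left n k)) \<in> X"
      using assms(1) unfolding path_image_def by blast
    moreover have "cantor_product x q t = q ?i (3 ^ n * (t - gap_left n k))"
      using 2 assms(3) [OF i] by (intro cantor_product_gap) (auto simp: cantor_gap_def)
    ultimately show ?thesis by simp
  qed
  then show ?thesis by (auto simp: path_image_def)
qed

text \<open>
  The loops shrink to \<open>x\<close>, and therefore the product is the uniform limit of the products in which all but
  finitely many loops are made constant.
\<close>

lemma path_cantor_product:
  fixes x :: "'a::metric_space"
  assumes "null_loops X x q"
  shows "path (cantor_product x q)"
proof -
  note q = null_loopsD [OF assms]
  define f where "f M = cantor_product x (\<lambda>i. if i < M then q i else (\<lambda>_. x))" for M
  have cont: "continuous_on {0..1} (f M)" for M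
  proof (induction M)
    case 0
    have "f 0 t = x" if "t \<in> {0..1}" for t
      by (simp add: f_def cantor_product_def split: prod.split)
    then have "continuous_on {0..1} (f 0) \<longleftrightarrow> continuous_on {0..1} (\<lambda>_::real. x)"
      by (intro continuous_on_cong) auto
    then show ?case by simp
  next
    case (Suc M)
    show ?case
    proof (cases "M = 0")
      (* No gap has index 0. *)
      case True
      have "f (Suc M) t = f M t" if "t \<in> {0..1}" for t
        using that unfolding f_def by (rule cantor_product_cong) (auto simp: True)
      then have "continuous_on {0..1} (f (Suc M)) \<longleftrightarrow> continuous_on {0..1} (f M)"
        by (intro continuous_on_cong) auto
      with Suc show ?thesis by simp
    next
      case False
      then have M: "M \<ge> 1" by simp
      define n k where "n = gap_level M" and "k = gap_pos M"
      have nk: "n \<ge> 1" "k \<in> {1..2 ^ (n - 1)}" "2 ^ (n - 1) + k - 1 = M"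
        unfolding n_def k_def using gap_index_level [OF M] by auto
      let ?J = "{gap_left n k..gap_left n k + 1 / 3 ^ n}"
      have J: "?J \<subseteq> {0..1}" using gap_left_bounds [OF nk(1,2)] by auto
      have fS: "f (Suc M) t = (if t \<in> ?J then q M (3 ^ n * (t - gap_left n k)) else f M t)"
        if "t \<in> {0..1}" for t
        using that
      proof (cases rule: cantor_set_or_gap)
        case 1
        show ?thesis
        proof (cases "t \<in> ?J")
          case True
          with 1 show ?thesis
            using cantor_product_gap [OF nk(1,2), of t q x] q [OF M] nk(3)
            by (simp add: f_def cantor_product_in_cantor_set)
        next
          case False
          with 1 show ?thesis unfolding f_def cantor_product_in_cantor_set [OF 1] by (simp only: if_False)
        qed
      next
        case (2 m l)
        then have i: "2 ^ (m - 1) + l - 1 \<ge> 1" by (simp add: Suc_leI)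
        have eq: "f N t = (if 2 ^ (m - 1) + l - 1 < N then q (2 ^ (m - 1) + l - 1) (3 ^ m * (t - gap_left m l)) else x)"
          for N
          unfolding f_def using 2 q [OF i] by (subst cantor_product_gap [OF 2(1,2)]) (auto simp: cantor_gap_def)
        show ?thesis
        proof (cases "t \<in> ?J")
          case True
          moreover have "t \<noteq> gap_left n k" "t \<noteq> gap_left n k + 1 / 3 ^ n"
            using gap_ends_in_cantor_set [OF nk(1,2)] 2(4) by metis+
          ultimately have "t \<in> cantor_gap n k"
            by (simp add: cantor_gap_def)
          then have "m = n" "l = k"
            using cantor_gap_disjoint 2 nk by blast+
          with True nk eq show ?thesis by simp
        next
          case False
          then have "t \<notin> cantor_gap n k" by (auto simp: cantor_gap_def)
          then have "(m, l) \<noteq> (n, k)" using 2(3) by auto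
          then have "2 ^ (m - 1) + l - 1 \<noteq> M"
            using nk gap_level_index [OF 2(1,2)] gap_level_index [OF nk(1,2)] by auto
          with False eq show ?thesis by auto
        qed
      qed
      have J3: "3 ^ n * (t - gap_left n k) \<in> {0..1}" if "t \<in> ?J" for t
        using that by (auto simp: field_simps)
      have "continuous_on ?J (q M \<circ> (\<lambda>t. 3 ^ n * (t - gap_left n k)))"
        using q(1) [OF M] J3 unfolding path_def
        by (intro continuous_on_compose continuous_intros) (auto elim!: continuous_on_subset)
      then have cq: "continuous_on ?J (\<lambda>t. q M (3 ^ n * (t - gap_left n k)))"
        by (simp add: comp_def)
      have "continuous_on (?J \<union> ({0..1} - cantor_gap n k))
              (\<lambda>t. if t \<in> ?J then q M (3 ^ n * (t - gap_left n k)) else f M t)"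
      proof (rule continuous_on_cases)
        show "closed ({0..1} - cantor_gap n k)"
          by (auto simp: cantor_gap_def intro!: closed_Diff)
        show "continuous_on ({0..1} - cantor_gap n k) (f M)"
          using Suc by (rule continuous_on_subset) auto
        show "\<forall>t. t \<in> ?J \<and> t \<notin> ?J \<or> t \<in> {0..1} - cantor_gap n k \<and> t \<in> ?J \<longrightarrow>
                q M (3 ^ n * (t - gap_left n k)) = f M t"
        proof (intro allI impI)
          fix t assume "t \<in> ?J \<and> t \<notin> ?J \<or> t \<in> {0..1} - cantor_gap n k \<and> t \<in> ?J"
          then have t: "t \<in> ?J" "t \<notin> cantor_gap n k" by auto
          then have "t = gap_left n k \<or> t = gap_left n k + 1 / 3 ^ n"
            by (fastforce simp: cantor_gap_def)
          then have "t \<in> cantor_set" using gap_ends_in_cantor_set [OF nk(1,2)] by auto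
          then show "q M (3 ^ n * (t - gap_left n k)) = f M t"
            using cantor_product_gap [OF nk(1,2), of t q x] q [OF M] nk(3) t
            by (simp add: f_def cantor_product_in_cantor_set)
        qed
      qed (use cq in auto)
      moreover have "?J \<union> ({0..1} - cantor_gap n k) = {0..1}"
        using J by (auto simp: cantor_gap_def)
      moreover have "continuous_on {0..1} (f (Suc M)) \<longleftrightarrow>
          continuous_on {0..1} (\<lambda>t. if t \<in> ?J then q M (3 ^ n * (t - gap_left n k)) else f M t)"
        using fS by (intro continuous_on_cong) auto
      ultimately show ?thesis
        by simp
    qed
  qed
  have "uniform_limit {0..1} f (cantor_product x q) sequentially"
  proof (rule uniform_limitI)
    fix r :: real assume r: "r > 0"
    then obtain M where M: "\<And>i. i \<ge> M \<Longrightarrow> path_image (q i) \<subseteq> ball x r"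
      using assms unfolding null_loops_def by blast
    show "\<forall>\<^sub>F n in sequentially. \<forall>t\<in>{0..1}. dist (f n t) (cantor_product x q t) < r"
    proof (rule eventually_sequentiallyI [of M], intro ballI)
      fix N t :: _ assume N: "M \<le> N" and "t \<in> {0..1::real}"
      from this(2) show "dist (f N t) (cantor_product x q t) < r"
      proof (cases rule: cantor_set_or_gap)
        case 1
        with r show ?thesis by (simp add: f_def cantor_product_in_cantor_set)
      next
        case (2 m l)
        let ?i = "2 ^ (m - 1) + l - 1" and ?s = "3 ^ m * (t - gap_left m l)"
        have i: "?i \<ge> 1" using 2 by (simp add: Suc_leI)
        have 1: "cantor_product x q t = q ?i ?s"
          using 2 q [OF i] by (subst cantor_product_gap [OF 2(1,2)]) (auto simp: cantor_gap_def)
        have 3: "f N t = (if ?i < N then q ?i ?s else x)"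
          unfolding f_def using 2 q [OF i] by (subst cantor_product_gap [OF 2(1,2)]) (auto simp: cantor_gap_def)
        have "?s \<in> {0..1}" using 2 by (auto simp: cantor_gap_def field_simps)
        then have "q ?i ?s \<in> ball x r" if "\<not> ?i < N"
        proof -
          have "path_image (q ?i) \<subseteq> ball x r" using M that N by simp
          with \<open>?s \<in> {0..1}\<close> show ?thesis unfolding path_image_def by blast
        qed
        then show ?thesis using 1 3 r by simp
      qed
    qed
  qed
  then show ?thesis
    unfolding path_def using cont by (intro uniform_limit_theorem [of _ f]) auto
qed

text \<open>
  The same product with the loops indexed by the level and the position of the gap, which suits the self-similarity
  of the Cantor set.
\<close>

definition cantor_tree_product :: "'a \<Rightarrow> (nat \<Rightarrow> nat \<Rightarrow> real \<Rightarrow> 'a) \<Rightarrow> real \<Rightarrow> 'a" where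
  "cantor_tree_product x q = cantor_product x (\<lambda>i. q (gap_level i) (gap_pos i))"

lemma cantor_tree_product_gap:
  assumes n: "n \<ge> 1" "k \<in> {1..2 ^ (n - 1)}"
    and t: "gap_left n k \<le> t" "t \<le> gap_left n k + 1 / 3 ^ n"
    and q: "q n k 0 = x" "q n k 1 = x"
  shows "cantor_tree_product x q t = q n k (3 ^ n * (t - gap_left n k))"
  unfolding cantor_tree_product_def
  using cantor_product_gap [OF n t, of "\<lambda>i. q (gap_level i) (gap_pos i)" x] q
  by (simp only: gap_level_index [OF n])

definition join3 :: "(real \<Rightarrow> 'a) \<Rightarrow> (real \<Rightarrow> 'a) \<Rightarrow> (real \<Rightarrow> 'a) \<Rightarrow> real \<Rightarrow> 'a" where
  "join3 p q r t = (if t \<le> 1 / 3 then p (3 * t) else if t \<le> 2 / 3 then q (3 * t - 1) else r (3 * t - 2))"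

lemma cantor_set_third:
  assumes "t \<in> cantor_set"
  shows "t \<le> 1 / 3 \<Longrightarrow> 3 * t \<in> cantor_set" "t \<ge> 2 / 3 \<Longrightarrow> 3 * t - 2 \<in> cantor_set"
proof -
  have *: "3 * t \<in> cantor_stage n \<or> 3 * t - 2 \<in> cantor_stage n" for n
    using assms by (auto simp: cantor_set_def mem_cantor_stage_Suc [symmetric] simp del: cantor_stage.simps)
  show "3 * t \<in> cantor_set" if "t \<le> 1 / 3"
  proof -
    have "3 * t - 2 \<notin> cantor_stage n" for n
      using that cantor_stage_subset [of n] by (force simp: subset_iff)
    with * show ?thesis by (auto simp: cantor_set_def)
  qed
  show "3 * t - 2 \<in> cantor_set" if "t \<ge> 2 / 3"
  proof -
    have "3 * t \<notin> cantor_stage n" for n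
      using that cantor_stage_subset [of n] by (force simp: subset_iff)
    with * show ?thesis by (auto simp: cantor_set_def)
  qed
qed

text \<open>
  On either side of its first gap the Cantor set is a copy of itself at one third of the scale.  Of the gaps
  of level \<open>n + 1\<close>, the first \<open>2 ^ (n - 1)\<close> lie in the left copy and the others in the right copy.
\<close>

lemma cantor_tree_product_self_similar:
  assumes q: "\<And>n k. q n k 0 = x \<and> q n k 1 = x" and t: "t \<in> {0..1}"
  shows "cantor_tree_product x q t =
    join3 (cantor_tree_product x (\<lambda>n. q (Suc n))) (q 1 1)
      (cantor_tree_product x (\<lambda>n k. q (Suc n) (k + 2 ^ (n - 1)))) t"
proof -
  let ?L = "cantor_tree_product x (\<lambda>n. q (Suc n))"
  let ?R = "cantor_tree_product x (\<lambda>n k. q (Suc n) (k + 2 ^ (n - 1)))"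
  have gap: "cantor_tree_product x q s = q n k (3 ^ n * (s - gap_left n k))"
    if "n \<ge> 1" "k \<in> {1..2 ^ (n - 1)}" "gap_left n k \<le> s" "s \<le> gap_left n k + 1 / 3 ^ n"
      "\<And>n k. q n k 0 = x \<and> q n k 1 = x" for q n k s
    using that by (intro cantor_tree_product_gap) auto
  consider "t \<le> 1 / 3" | "1 / 3 < t" "t \<le> 2 / 3" | "2 / 3 < t" by linarith
  then show ?thesis
  proof cases
    case 1
    from t have "cantor_tree_product x q t = ?L (3 * t)"
    proof (cases rule: cantor_set_or_gap)
      case 1
      with cantor_set_third(1) [OF 1] \<open>t \<le> 1 / 3\<close> show ?thesis
        by (simp add: cantor_tree_product_def cantor_product_in_cantor_set)
    next
      case (2 n k)
      have "n \<noteq> 1" using 1 2 by (auto simp: cantor_gap_def)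
      then obtain m where n: "n = Suc (Suc m)" using 2(1) by (metis One_nat_def not0_implies_Suc not_one_le_zero)
      have k: "k \<le> 2 ^ m"
      proof (rule ccontr)
        assume "\<not> k \<le> 2 ^ m"
        then have "0 < gap_left (Suc m) (k - 2 ^ m)" "gap_left n k = 2 / 3 + gap_left (Suc m) (k - 2 ^ m) / 3"
          using 2(2) by (auto simp: n intro!: gap_left_bounds)
        with 1 2(3) show False by (auto simp: cantor_gap_def)
      qed
      have "3 * t \<in> cantor_gap (Suc m) k" using 2(3) k by (simp add: n mem_cantor_gap_Suc)
      then have "?L (3 * t) = q n k (3 ^ Suc m * (3 * t - gap_left (Suc m) k))"
        using 2(2) k q by (subst gap [where n = "Suc m" and k = k]) (auto simp: n cantor_gap_def)
      moreover have "cantor_tree_product x q t = q n k (3 ^ n * (t - gap_left n k))"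
        using 2 q by (subst gap) (auto simp: cantor_gap_def)
      moreover have "3 ^ n * (t - gap_left n k) = 3 ^ Suc m * (3 * t - gap_left (Suc m) k)"
        using k by (simp add: n algebra_simps)
      ultimately show ?thesis by simp
    qed
    with 1 show ?thesis by (simp add: join3_def)
  next
    case 2
    then have "cantor_tree_product x q t = q 1 1 (3 ^ 1 * (t - gap_left 1 1))"
      using q by (intro gap) auto
    with 2 show ?thesis by (simp add: join3_def algebra_simps)
  next
    case 3
    from t have "cantor_tree_product x q t = ?R (3 * t - 2)"
    proof (cases rule: cantor_set_or_gap)
      case 1
      with cantor_set_third(2) [OF 1] \<open>2 / 3 < t\<close> show ?thesis
        by (simp add: cantor_tree_product_def cantor_product_in_cantor_set)
    next
      case (2 n k)
      have "n \<noteq> 1" using 3 2 by (auto simp: cantor_gap_def)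
      then obtain m where n: "n = Suc (Suc m)" using 2(1) by (metis One_nat_def not0_implies_Suc not_one_le_zero)
      have k: "\<not> k \<le> 2 ^ m"
      proof
        assume *: "k \<le> 2 ^ m"
        then have "gap_left (Suc m) k + 1 / 3 ^ Suc m < 1" "gap_left n k = gap_left (Suc m) k / 3"
          using 2(2) by (auto simp: n intro!: gap_left_bounds [of "Suc m", simplified])
        with 3 2(3) show False by (auto simp: cantor_gap_def n)
      qed
      have "3 * t - 2 \<in> cantor_gap (Suc m) (k - 2 ^ m)" using 2(3) k by (simp add: n mem_cantor_gap_Suc)
      then have "?R (3 * t - 2) = q n k (3 ^ Suc m * (3 * t - 2 - gap_left (Suc m) (k - 2 ^ m)))"
        using 2(2) k q by (subst gap [where n = "Suc m" and k = "k - 2 ^ m"]) (auto simp: n cantor_gap_def)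
      moreover have "cantor_tree_product x q t = q n k (3 ^ n * (t - gap_left n k))"
        using 2 q by (subst gap) (auto simp: cantor_gap_def)
      moreover have "3 ^ n * (t - gap_left n k) = 3 ^ Suc m * (3 * t - 2 - gap_left (Suc m) (k - 2 ^ m))"
        using k by (simp add: n algebra_simps)
      ultimately show ?thesis by simp
    qed
    with 3 show ?thesis by (simp add: join3_def)
  qed
qed

section \<open>Infinitely many cancellations in a tree of loops\<close>

lemma homotopic_join3:
  assumes "path_in Y p" "path_in Y q" "path_in Y r" "pathfinish p = pathstart q" "pathfinish q = pathstart r"
  shows "homotopic_paths Y (p +++ (q +++ r)) (join3 p q r)"
  \<comment> \<open>The first path takes up half of the nested concatenation but only a third of the balanced one; the
    minimum switches from slope \<open>3 / 2\<close> to slope \<open>3 / 4\<close> at \<open>t = 1 / 3\<close>.\<close>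
proof (rule homotopic_paths_reparametrize [where f = "\<lambda>t. min (3 * t / 2) (1 / 4 + 3 * t / 4)"])
  show "path (p +++ q +++ r)" "path_image (p +++ q +++ r) \<subseteq> Y"
    using assms by (auto simp: path_image_join)
  show "continuous_on {0..1} (\<lambda>t::real. min (3 * t / 2) (1 / 4 + 3 * t / 4))"
    by (intro continuous_intros) auto
  show "join3 p q r t = (p +++ q +++ r) (min (3 * t / 2) (1 / 4 + 3 * t / 4))" if "t \<in> {0..1}" for t
  proof -
    consider "t \<le> 1 / 3" | "1 / 3 < t" "t \<le> 2 / 3" | "2 / 3 < t" by linarith
    then show ?thesis
    proof cases
      case 1
      then have "min (3 * t / 2) (1 / 4 + 3 * t / 4) = 3 * t / 2" by (simp add: min_def)
      with 1 show ?thesis by (simp add: join3_def joinpaths_def)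
    next
      case 2
      then have "min (3 * t / 2) (1 / 4 + 3 * t / 4) = 1 / 4 + 3 * t / 4" by (simp add: min_def)
      moreover have "2 * (2 * (1 / 4 + 3 * t / 4) - 1) = 3 * t - 1" by (simp add: field_simps)
      ultimately show ?thesis using 2 by (simp add: join3_def joinpaths_def)
    next
      case 3
      then have "min (3 * t / 2) (1 / 4 + 3 * t / 4) = 1 / 4 + 3 * t / 4" by (simp add: min_def)
      moreover have "2 * (2 * (1 / 4 + 3 * t / 4) - 1) - 1 = 3 * t - 2" by (simp add: field_simps)
      ultimately show ?thesis using 3 by (simp add: join3_def joinpaths_def)
    qed
  qed
qed (auto simp: min_def)

lemma continuous_on_join3:
  fixes a c :: "real \<times> real \<Rightarrow> 'a::topological_space"
  assumes a: "continuous_on ({0..1} \<times> {0..1}) a" and b: "continuous_on {0..1} b"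
    and c: "continuous_on ({0..1} \<times> {0..1}) c"
    and ends: "\<And>s. s \<in> {0..1} \<Longrightarrow> a (s, 1) = b 0" "\<And>s. s \<in> {0..1} \<Longrightarrow> c (s, 0) = b 1"
    and phi: "continuous_on A \<phi>" "\<And>y. y \<in> A \<Longrightarrow> \<phi> y \<in> {0..1}" "A \<subseteq> UNIV \<times> {0..1}"
  shows "continuous_on A (\<lambda>y. join3 (\<lambda>t. a (\<phi> y, t)) b (\<lambda>t. c (\<phi> y, t)) (snd y))"
  unfolding join3_def
proof (rule continuous_on_cases_le)
  let ?A1 = "{y \<in> A. snd y \<le> 1 / 3}" and ?B = "{y \<in> A. 1 / 3 \<le> snd y}"
  have "continuous_on ?A1 (a \<circ> (\<lambda>y. (\<phi> y, 3 * snd y)))"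
    using phi by (intro continuous_on_compose continuous_intros)
      (force intro!: continuous_on_subset [OF a] elim!: continuous_on_subset)+
  then show "continuous_on ?A1 (\<lambda>y. a (\<phi> y, 3 * snd y))" by (simp add: comp_def)
  show "continuous_on ?B (\<lambda>y. if snd y \<le> 2 / 3 then b (3 * snd y - 1) else c (\<phi> y, 3 * snd y - 2))"
  proof (rule continuous_on_cases_le)
    have "continuous_on {y \<in> ?B. snd y \<le> 2 / 3} (b \<circ> (\<lambda>y. 3 * snd y - 1))"
      using phi by (intro continuous_on_compose continuous_intros) (auto intro!: continuous_on_subset [OF b])
    then show "continuous_on {y \<in> ?B. snd y \<le> 2 / 3} (\<lambda>y. b (3 * snd y - 1))" by (simp add: comp_def)
    have "continuous_on {y \<in> ?B. 2 / 3 \<le> snd y} (c \<circ> (\<lambda>y. (\<phi> y, 3 * snd y - 2)))"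
      using phi by (intro continuous_on_compose continuous_intros)
        (force intro!: continuous_on_subset [OF c] elim!: continuous_on_subset)+
    then show "continuous_on {y \<in> ?B. 2 / 3 \<le> snd y} (\<lambda>y. c (\<phi> y, 3 * snd y - 2))" by (simp add: comp_def)
    show "continuous_on ?B snd" by (intro continuous_intros)
    show "b (3 * snd y - 1) = c (\<phi> y, 3 * snd y - 2)" if "y \<in> ?B" "snd y = 2 / 3" for y
    proof -
      have "3 * snd y - 1 = 1" "3 * snd y - 2 = 0" using that by auto
      then show ?thesis using that(1) ends(2) phi(2) by (simp only:) auto
    qed
  qed
  show "continuous_on A snd" by (intro continuous_intros)
  show "a (\<phi> y, 3 * snd y) = (if snd y \<le> 2 / 3 then b (3 * snd y - 1) else c (\<phi> y, 3 * snd y - 2))"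
    if "y \<in> A" "snd y = 1 / 3" for y
  proof -
    have "3 * snd y - 1 = 0" "3 * snd y = 1" using that by auto
    then show ?thesis using that(1) ends(1) phi(2) by (simp only:) auto
  qed
qed

text \<open>
  The infinite binary tree of gaps, labelled by starting from a state \<open>s\<close> and moving to the states \<open>l s\<close> and
  \<open>r s\<close> for the gaps to the left and to the right of the first one; a gap gets the label \<open>z\<close> of the state that
  it reaches.  The recursion is that of \<^const>\<open>gap_left\<close>.  Levels start at 1, and level 0 has an arbitrary value.
\<close>

fun gap_label :: "('s \<Rightarrow> 's) \<Rightarrow> ('s \<Rightarrow> 's) \<Rightarrow> ('s \<Rightarrow> 'b) \<Rightarrow> 's \<Rightarrow> nat \<Rightarrow> nat \<Rightarrow> 'b" where
  "gap_label l r z s 0 k = z s"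
| "gap_label l r z s (Suc 0) k = z s"
| "gap_label l r z s (Suc (Suc n)) k =
     (if k \<le> 2 ^ n then gap_label l r z (l s) (Suc n) k else gap_label l r z (r s) (Suc n) (k - 2 ^ n))"

text \<open>
  The loop \<open>e s\<close> is what the product of all labels below the state \<open>s\<close> is meant to be: up to homotopy, it
  splits into the corresponding loops of the two children with the label \<open>z s\<close> between them.  Splitting again and
  again never ends, so that this does not by itself identify \<open>e s\<close> with the infinite product.  It does so
  if the splitting homotopies become small.  States that occur at depth \<open>n\<close> satisfy \<open>I n\<close>, and their splitting
  takes place in the set \<open>B n\<close>; these sets shrink to the base point.
\<close>

locale shrinking_tree =
  fixes l r :: "'s \<Rightarrow> 's" and z e :: "'s \<Rightarrow> real \<Rightarrow> 'a::metric_space"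
    and I :: "nat \<Rightarrow> 's \<Rightarrow> bool" and B :: "nat \<Rightarrow> 'a set" and x :: 'a
  assumes child: "I n s \<Longrightarrow> I (Suc n) (l s)" "I n s \<Longrightarrow> I (Suc n) (r s)"
    and antimono: "B (Suc n) \<subseteq> B n" and shrink: "0 < \<rho> \<Longrightarrow> \<exists>n. B n \<subseteq> ball x \<rho>"
    and x: "x \<in> B n"
    and z: "z s 0 = x" "z s 1 = x" "I n s \<Longrightarrow> path_in (B n) (z s)"
    and e: "I n s \<Longrightarrow> pathstart (e s) = x \<and> pathfinish (e s) = x"
    and split: "I n s \<Longrightarrow> homotopic_paths (B n) (e s) (e (l s) +++ (z s +++ e (r s)))"
begin

lemma antimono_le: "m \<le> n \<Longrightarrow> B n \<subseteq> B m"
  using antimono by (rule lift_Suc_antimono_le)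

abbreviation lab :: "'s \<Rightarrow> nat \<Rightarrow> nat \<Rightarrow> real \<Rightarrow> 'a" where
  "lab \<equiv> gap_label l r z"

definition word :: "'s \<Rightarrow> real \<Rightarrow> 'a" where
  "word s = cantor_tree_product x (lab s)"

lemma lab_ends: "lab s n k 0 = x \<and> lab s n k 1 = x"
proof (induction n arbitrary: s k)
  case (Suc n)
  then show ?case by (cases n) (auto simp: z)
qed (simp add: z)

lemma path_in_lab: "I m s \<Longrightarrow> path_in (B (m + n)) (lab s (Suc n) k)"
proof (induction n arbitrary: m s k)
  case 0
  then show ?case using z(3) by simp
next
  case (Suc n)
  then show ?case using child [of m s] by (metis add_Suc_shift gap_label.simps(3))
qed

abbreviation letter :: "'s \<Rightarrow> nat \<Rightarrow> real \<Rightarrow> 'a" where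
  "letter s i \<equiv> lab s (gap_level i) (gap_pos i)"

lemma path_in_letter:
  assumes "I m s" "i \<ge> 1"
  shows "path_in (B (m + gap_level i - 1)) (letter s i)"
  using path_in_lab [OF assms(1), of "gap_level i - 1" "gap_pos i"] gap_index_level(1) [OF assms(2)]
  by simp

lemma null_loops_letter:
  assumes "I 0 s"
  shows "null_loops (B 0) x (letter s)"
  unfolding null_loops_def
proof (intro conjI allI impI)
  fix i :: nat assume i: "1 \<le> i"
  show "path (letter s i)" "path_image (letter s i) \<subseteq> B 0"
    using path_in_letter [OF assms i] antimono_le [of 0] by auto
  show "pathstart (letter s i) = x" "pathfinish (letter s i) = x"
    by (simp_all add: pathstart_def pathfinish_def lab_ends)
next
  fix \<rho> :: real assume "\<rho> > 0"
  then obtain N where N: "B N \<subseteq> ball x \<rho>" using shrink by blast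
  show "\<exists>M. \<forall>i\<ge>M. path_image (letter s i) \<subseteq> ball x \<rho>"
  proof (intro exI allI impI)
    fix i :: nat assume i: "2 ^ N \<le> i"
    have "i < 2 ^ gap_level i"
      unfolding gap_level_def by (rule LeastI [of _ i]) simp
    with i have "(2::nat) ^ N < 2 ^ gap_level i" by linarith
    then have "N < gap_level i" by (simp add: power_strict_increasing_iff)
    moreover have "i \<ge> 1" using i by (metis le_trans one_le_numeral one_le_power)
    ultimately have "path_image (letter s i) \<subseteq> B (gap_level i - 1)" "N \<le> gap_level i - 1"
      using path_in_letter [OF assms, of i] by auto
    then show "path_image (letter s i) \<subseteq> ball x \<rho>"
      using antimono_le [of N "gap_level i - 1"] N by blast
  qed
qed

lemma word_in:
  assumes "I m s" "t \<in> {0..1}"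
  shows "word s t \<in> B m"
proof -
  have "path_image (word s) \<subseteq> B m"
    unfolding word_def cantor_tree_product_def
  proof (rule path_image_cantor_product)
    fix i :: nat assume i: "i \<ge> 1"
    then have "m \<le> m + gap_level i - 1" using gap_index_level(1) [of i] by linarith
    then show "path_image (letter s i) \<subseteq> B m"
      using path_in_letter [OF assms(1) i] antimono_le by blast
  qed (use x lab_ends in auto)
  with assms show ?thesis by (auto simp: path_image_def)
qed

lemma word_ends: "word s 0 = x" "word s 1 = x"
  using pathstart_cantor_product [of x] pathfinish_cantor_product [of x]
  by (simp_all add: word_def cantor_tree_product_def pathstart_def pathfinish_def)

lemma word_split:
  assumes "t \<in> {0..1}"
  shows "word s t = join3 (word (l s)) (z s) (word (r s)) t"
proof -
  have "cantor_tree_product x (\<lambda>n. lab s (Suc n)) u = word (l s) u" if "u \<in> {0..1}" for u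
    unfolding word_def cantor_tree_product_def
  proof (rule cantor_product_cong [OF that])
    fix i :: nat and v :: real assume i: "1 \<le> i"
    obtain m where m: "gap_level i = Suc m" using gap_index_level(1) [OF i] by (cases "gap_level i") auto
    then show "lab s (Suc (gap_level i)) (gap_pos i) v = lab (l s) (gap_level i) (gap_pos i) v"
      using gap_index_level(2) [OF i] by simp
  qed (simp add: lab_ends)
  moreover have "cantor_tree_product x (\<lambda>n k. lab s (Suc n) (k + 2 ^ (n - 1))) u = word (r s) u"
    if "u \<in> {0..1}" for u
    unfolding word_def cantor_tree_product_def
  proof (rule cantor_product_cong [OF that])
    fix i :: nat and v :: real assume i: "1 \<le> i"
    obtain m where m: "gap_level i = Suc m" using gap_index_level(1) [OF i] by (cases "gap_level i") auto
    then show "lab s (Suc (gap_level i)) (gap_pos i + 2 ^ (gap_level i - 1)) v = lab (r s) (gap_level i) (gap_pos i) v"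
      using gap_index_level(2) [OF i] by simp
  qed (simp add: lab_ends)
  ultimately show ?thesis
    using cantor_tree_product_self_similar [of "lab s" x t] lab_ends assms
    unfolding word_def by (simp add: join3_def)
qed

text \<open>
  The choice depends on the depth and not only on the state, because a homotopy chosen without regard to the depth
  need not be small.
\<close>

definition split_homotopy :: "nat \<Rightarrow> 's \<Rightarrow> real \<times> real \<Rightarrow> 'a" where
  "split_homotopy n s = (SOME h. continuous_on ({0..1} \<times> {0..1}) h \<and> h \<in> ({0..1} \<times> {0..1}) \<rightarrow> B n \<and>
     (\<forall>t\<in>{0..1}. h (0, t) = join3 (e (l s)) (z s) (e (r s)) t) \<and> (\<forall>t\<in>{0..1}. h (1, t) = e s t) \<and>
     (\<forall>u\<in>{0..1}. h (u, 0) = x \<and> h (u, 1) = x))"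

lemma split_homotopy:
  assumes "I n s"
  shows "continuous_on ({0..1} \<times> {0..1}) (split_homotopy n s)"
    "u \<in> {0..1} \<Longrightarrow> t \<in> {0..1} \<Longrightarrow> split_homotopy n s (u, t) \<in> B n"
    "t \<in> {0..1} \<Longrightarrow> split_homotopy n s (0, t) = join3 (e (l s)) (z s) (e (r s)) t"
    "t \<in> {0..1} \<Longrightarrow> split_homotopy n s (1, t) = e s t"
    "u \<in> {0..1} \<Longrightarrow> split_homotopy n s (u, 0) = x" "u \<in> {0..1} \<Longrightarrow> split_homotopy n s (u, 1) = x"
proof -
  have "path_in (B n) (e (l s) +++ (z s +++ e (r s)))"
    using homotopic_paths_imp_path [OF split [OF assms]] homotopic_paths_imp_subset [OF split [OF assms]] by auto
  moreover have ends: "pathfinish (e (l s)) = pathstart (z s)" "pathfinish (z s) = pathstart (e (r s))"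
    using e [OF child(1) [OF assms]] e [OF child(2) [OF assms]] z(1,2)
    by (auto simp: pathstart_def pathfinish_def)
  ultimately have "path_in (B n) (e (l s))" "path_in (B n) (e (r s))"
    by (auto simp: path_image_join)
  then have "homotopic_paths (B n) (e (l s) +++ (z s +++ e (r s))) (join3 (e (l s)) (z s) (e (r s)))"
    using ends z(3) [OF assms] by (intro homotopic_join3) auto
  then have hom: "homotopic_paths (B n) (join3 (e (l s)) (z s) (e (r s))) (e s)"
    using split [OF assms] homotopic_paths_sym homotopic_paths_trans by blast
  have ends3: "pathstart (join3 (e (l s)) (z s) (e (r s))) = x" "pathfinish (join3 (e (l s)) (z s) (e (r s))) = x"
    using e [OF child(1) [OF assms]] e [OF child(2) [OF assms]] by (auto simp: join3_def pathstart_def pathfinish_def)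
  from hom have "\<exists>h::real \<times> real \<Rightarrow> 'a. continuous_on ({0..1} \<times> {0..1}) h \<and> h \<in> ({0..1} \<times> {0..1}) \<rightarrow> B n \<and>
     (\<forall>t\<in>{0..1}. h (0, t) = join3 (e (l s)) (z s) (e (r s)) t) \<and> (\<forall>t\<in>{0..1}. h (1, t) = e s t) \<and>
     (\<forall>u\<in>{0..1}. h (u, 0) = x \<and> h (u, 1) = x)"
    unfolding homotopic_paths ends3 by (simp add: pathstart_def pathfinish_def)
  note * = someI_ex [OF this, folded split_homotopy_def]
  show "continuous_on ({0..1} \<times> {0..1}) (split_homotopy n s)"
    "u \<in> {0..1} \<Longrightarrow> t \<in> {0..1} \<Longrightarrow> split_homotopy n s (u, t) \<in> B n"
    "t \<in> {0..1} \<Longrightarrow> split_homotopy n s (0, t) = join3 (e (l s)) (z s) (e (r s)) t"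
    "t \<in> {0..1} \<Longrightarrow> split_homotopy n s (1, t) = e s t"
    "u \<in> {0..1} \<Longrightarrow> split_homotopy n s (u, 0) = x" "u \<in> {0..1} \<Longrightarrow> split_homotopy n s (u, 1) = x"
    using * by blast+
qed

lemma path_e: "I n s \<Longrightarrow> path_in (B n) (e s)"
  using homotopic_paths_imp_path [OF split] homotopic_paths_imp_subset [OF split] by blast

text \<open>
  Read backwards in the first coordinate, this homotopy starts with \<open>e s\<close>, splits it during the time from 1 to
  \<open>1 / 2\<close>, then splits the two children from \<open>1 / 2\<close> to \<open>1 / 4\<close>, and so on for \<open>n\<close> generations, after which it
  rests.
\<close>

primrec expand :: "nat \<Rightarrow> nat \<Rightarrow> 's \<Rightarrow> real \<times> real \<Rightarrow> 'a" where
  "expand 0 d s = (\<lambda>y. e s (snd y))"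
| "expand (Suc n) d s = (\<lambda>y. if 1 / 2 \<le> fst y then split_homotopy d s (2 * fst y - 1, snd y)
     else join3 (\<lambda>t. expand n (Suc d) (l s) (2 * fst y, t)) (z s)
            (\<lambda>t. expand n (Suc d) (r s) (2 * fst y, t)) (snd y))"

lemma expand_1: "I d s \<Longrightarrow> t \<in> {0..1} \<Longrightarrow> expand n d s (1, t) = e s t"
  by (cases n) (auto simp: split_homotopy)

lemma expand_Suc_half:
  assumes "I d s" "t \<in> {0..1}" "u \<in> {0..1 / 2}"
  shows "expand (Suc n) d s (u, t) = join3 (\<lambda>t. expand n (Suc d) (l s) (2 * u, t)) (z s)
            (\<lambda>t. expand n (Suc d) (r s) (2 * u, t)) t"
proof (cases "u = 1 / 2")
  case True
  have "3 * t \<in> {0..1}" if "t \<le> 1 / 3" using that assms by auto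
  moreover have "3 * t - 2 \<in> {0..1}" if "\<not> t \<le> 2 / 3" using that assms by auto
  ultimately show ?thesis
    using assms(1,2) split_homotopy(3) [OF assms(1,2)] child by (simp add: join3_def expand_1 True)
qed (use assms in auto)

lemma expand_ends:
  assumes "I d s" "u \<in> {0..1}"
  shows "expand n d s (u, 0) = x \<and> expand n d s (u, 1) = x"
  using assms
proof (induction n arbitrary: d s u)
  case 0
  then show ?case using e by (auto simp: pathstart_def pathfinish_def)
next
  case (Suc n)
  have "expand n (Suc d) (l s) (2 * u, 0) = x" "expand n (Suc d) (r s) (2 * u, 1) = x" if "\<not> 1 / 2 \<le> u"
    using that Suc by (auto simp: child)
  moreover have "split_homotopy d s (2 * u - 1, 0) = x" "split_homotopy d s (2 * u - 1, 1) = x" if "1 / 2 \<le> u"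
    using that Suc.prems split_homotopy by auto
  ultimately show ?case by (simp add: join3_def)
qed

lemma expand_in:
  assumes "I d s" "u \<in> {0..1}" "t \<in> {0..1}"
  shows "expand n d s (u, t) \<in> B d"
  using assms
proof (induction n arbitrary: d s u t)
  case 0
  then show ?case using path_e [of d s] by (auto simp: path_image_def)
next
  case (Suc n)
  show ?case
  proof (cases "1 / 2 \<le> u")
    case True
    with Suc.prems show ?thesis by (auto simp: split_homotopy)
  next
    case False
    have "expand n (Suc d) (l s) (2 * u, 3 * t) \<in> B (Suc d)" if "t \<le> 1 / 3"
      using that False Suc by (auto simp: child)
    moreover have "expand n (Suc d) (r s) (2 * u, 3 * t - 2) \<in> B (Suc d)" if "2 / 3 < t"
      using that False Suc by (auto simp: child)
    moreover have "z s (3 * t - 1) \<in> B d" if "1 / 3 < t" "t \<le> 2 / 3"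
      using that z(3) [OF Suc.prems(1)] by (auto simp: path_image_def)
    ultimately show ?thesis using False antimono [of d] by (auto simp: join3_def)
  qed
qed

lemma continuous_on_expand:
  assumes "I d s"
  shows "continuous_on ({0..1} \<times> {0..1}) (expand n d s)"
  using assms
proof (induction n arbitrary: d s)
  case 0
  have "continuous_on ({0..1} \<times> {0..1}) (e s \<circ> (snd :: real \<times> real \<Rightarrow> real))"
    using path_e [OF 0] unfolding path_def
    by (intro continuous_on_compose continuous_intros) (auto elim!: continuous_on_subset)
  then show ?case by (simp add: comp_def)
next
  case (Suc n)
  let ?S = "{0..1} \<times> {0..1} :: (real \<times> real) set"
  let ?f = "\<lambda>y. split_homotopy d s (2 * fst y - 1, snd y)"
  let ?g = "\<lambda>y. join3 (\<lambda>t. expand n (Suc d) (l s) (2 * fst y, t)) (z s)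
            (\<lambda>t. expand n (Suc d) (r s) (2 * fst y, t)) (snd y)"
  have eq: "?f y = ?g y" if "y \<in> ?S" "fst y = 1 / 2" for y
  proof -
    have "?f y = expand (Suc n) d s (1 / 2, snd y)" by (simp add: that(2))
    also have "\<dots> = ?g y" using that(1) Suc.prems by (subst expand_Suc_half) (auto simp: that(2))
    finally show ?thesis .
  qed
  have "continuous_on ?S (\<lambda>y. if fst y \<le> 1 / 2 then ?g y else ?f y)"
  proof (rule continuous_on_cases_le)
    have "continuous_on {y \<in> ?S. 1 / 2 \<le> fst y} (split_homotopy d s \<circ> (\<lambda>y. (2 * fst y - 1, snd y)))"
      by (intro continuous_on_compose continuous_intros)
        (force intro!: continuous_on_subset [OF split_homotopy(1) [OF Suc.prems]])
    then show "continuous_on {y \<in> ?S. 1 / 2 \<le> fst y} ?f" by (simp add: comp_def)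
    show "continuous_on {y \<in> ?S. fst y \<le> 1 / 2} ?g"
    proof (rule continuous_on_join3)
      show "continuous_on ?S (expand n (Suc d) (l s))" "continuous_on ?S (expand n (Suc d) (r s))"
        using Suc child by blast+
      show "continuous_on {0..1} (z s)" using z(3) [OF Suc.prems] by (simp add: path_def)
    qed (use Suc.prems child expand_ends z in \<open>auto intro!: continuous_intros\<close>)
    show "?g y = ?f y" if "y \<in> ?S" "fst y = 1 / 2" for y
      using eq [OF that] by simp
    show "continuous_on ?S fst" by (intro continuous_intros)
  qed
  moreover have "expand (Suc n) d s y = (if fst y \<le> 1 / 2 then ?g y else ?f y)" if "y \<in> ?S" for y
    using eq [OF that] by auto
  ultimately show ?case by (simp cong: continuous_on_cong)
qed

text \<open>By time \<open>1 / 2 ^ n\<close> only \<open>n\<close> generations have been split, so that further ones make no difference.\<close>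

lemma expand_stable:
  assumes "I d s" "t \<in> {0..1}" "1 / 2 ^ n \<le> u" "u \<le> 1" "n \<le> m"
  shows "expand m d s (u, t) = expand n d s (u, t)"
  using assms
proof (induction n arbitrary: m d s u t)
  case 0
  then have "u = 1" by simp
  with 0 expand_1 [of d s t] show ?case by simp
next
  case (Suc n)
  obtain k where m: "m = Suc k" "n \<le> k" using Suc.prems by (cases m) auto
  show ?case
  proof (cases "1 / 2 \<le> u")
    case True
    then show ?thesis by (simp add: m)
  next
    case False
    have "1 / 2 ^ n \<le> 2 * u" using Suc.prems by (simp add: field_simps)
    then have "expand k (Suc d) (l s) (2 * u, t') = expand n (Suc d) (l s) (2 * u, t')"
      "expand k (Suc d) (r s) (2 * u, t') = expand n (Suc d) (r s) (2 * u, t')" if "t' \<in> {0..1}" for t'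
      using that Suc.IH [of "Suc d" "l s" t' "2 * u" k] Suc.IH [of "Suc d" "r s" t' "2 * u" k]
        Suc.prems(1) child False m(2) by auto
    with False Suc.prems(2) show ?thesis by (simp add: m join3_def)
  qed
qed

text \<open>
  After \<open>n\<close> generations, everything outside the remaining states of depth \<open>d + n\<close> already agrees with the
  infinite product, and what belongs to such a state stays inside \<open>B (d + n)\<close> forever.
\<close>

lemma expand_near_word:
  assumes "I d s" "t \<in> {0..1}" "0 \<le> u" "u \<le> 1 / 2 ^ n" "n \<le> m"
  shows "expand m d s (u, t) = word s t \<or> expand m d s (u, t) \<in> B (d + n) \<and> word s t \<in> B (d + n)"
  using assms
proof (induction n arbitrary: m d s u t)
  case 0
  then show ?case by (simp add: expand_in word_in)
next
  case (Suc n)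
  obtain k where m: "m = Suc k" "n \<le> k" using Suc.prems by (cases m) auto
  have u: "2 * u \<le> 1 / 2 ^ n" using Suc.prems by (simp add: field_simps)
  have "(1::real) / 2 ^ n \<le> 1" by simp
  then have "2 * u \<le> 1" using u by linarith
  then have u2: "u \<in> {0..1 / 2}" using Suc.prems by auto
  have eq: "expand m d s (u, t) = join3 (\<lambda>t. expand k (Suc d) (l s) (2 * u, t)) (z s)
            (\<lambda>t. expand k (Suc d) (r s) (2 * u, t)) t"
    unfolding m using Suc.prems u2 by (intro expand_Suc_half) auto
  have IH: "expand k (Suc d) (l s) (2 * u, t') = word (l s) t' \<or>
       expand k (Suc d) (l s) (2 * u, t') \<in> B (d + Suc n) \<and> word (l s) t' \<in> B (d + Suc n)"
      "expand k (Suc d) (r s) (2 * u, t') = word (r s) t' \<or>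
       expand k (Suc d) (r s) (2 * u, t') \<in> B (d + Suc n) \<and> word (r s) t' \<in> B (d + Suc n)"
    if "t' \<in> {0..1}" for t'
    using that Suc.IH [of "Suc d" "l s" t' "2 * u" k] Suc.IH [of "Suc d" "r s" t' "2 * u" k]
      Suc.prems(1,3) child u m(2) by auto
  show ?case
    unfolding eq word_split [OF Suc.prems(2)]
    using IH(1) [of "3 * t"] IH(2) [of "3 * t - 2"] Suc.prems(2) by (auto simp: join3_def)
qed

text \<open>
  The homotopies with more and more generations converge uniformly, by the two preceding lemmas for times above and
  below \<open>1 / 2 ^ n\<close>.  The limit is given pointwise by the stable values, and at time 0 by the infinite
  product.
\<close>

theorem homotopic_word:
  assumes s: "I 0 s"
  shows "homotopic_paths (B 0) (word s) (e s)"
proof -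
  define N where "N u = (LEAST n. 1 / 2 ^ n \<le> u)" for u :: real
  have N: "1 / 2 ^ N u \<le> u" if u: "u > 0" for u :: real
  proof -
    obtain n where "(1 / 2 :: real) ^ n < u" using real_arch_pow_inv [OF u, of "1 / 2"] by fastforce
    then have "1 / 2 ^ n \<le> u" by (simp add: power_one_over)
    then show ?thesis unfolding N_def by (rule LeastI)
  qed
  define K where "K y = (if fst y = 0 then word s (snd y) else expand (N (fst y)) 0 s y)" for y
  have "uniform_limit ({0..1} \<times> {0..1}) (\<lambda>n. expand n 0 s) K sequentially"
  proof (rule uniform_limitI)
    fix \<rho> :: real assume "\<rho> > 0"
    then obtain M where M: "B M \<subseteq> ball x (\<rho> / 2)" using shrink [of "\<rho> / 2"] by auto
    have near: "dist a b < \<rho>" if "a \<in> B M" "b \<in> B M" for a b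
      using that M by (metis dist_commute dist_triangle_half_r mem_ball subsetD)
    show "\<forall>\<^sub>F n in sequentially. \<forall>y\<in>{0..1} \<times> {0..1}. dist (expand n 0 s y) (K y) < \<rho>"
    proof (rule eventually_sequentiallyI [of M], intro ballI)
      fix n and y :: "real \<times> real" assume n: "M \<le> n" and "y \<in> {0..1} \<times> {0..1}"
      then obtain u t where y: "y = (u, t)" and u: "u \<in> {0..1}" and t: "t \<in> {0..1}" by auto
      show "dist (expand n 0 s y) (K y) < \<rho>"
      proof (cases "1 / 2 ^ M \<le> u")
        case True
        then have "u > 0" by (meson divide_pos_pos less_le_trans zero_less_numeral zero_less_one zero_less_power)
        have "N u \<le> M" unfolding N_def using True by (rule Least_le)
        then have "expand n 0 s y = expand (N u) 0 s y"
          unfolding y using s u t n N [OF \<open>u > 0\<close>] by (intro expand_stable) auto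
        then show ?thesis using \<open>u > 0\<close> \<open>\<rho> > 0\<close> by (simp add: K_def y)
      next
        case False
        have 1: "expand m 0 s y = word s t \<or> expand m 0 s y \<in> B M \<and> word s t \<in> B M" if "M \<le> m" for m
          using expand_near_word [OF s t, of u M m] that False u by (auto simp: y)
        have "M \<le> N u" if "u > 0"
        proof (rule ccontr)
          assume "\<not> M \<le> N u"
          then have "(1::real) / 2 ^ M \<le> 1 / 2 ^ N u"
            by (intro divide_left_mono power_increasing) auto
          with N [OF that] False show False by linarith
        qed
        then have "K y = word s t \<or> K y \<in> B M \<and> word s t \<in> B M"
          using 1 u by (cases "u = 0") (auto simp: K_def y)
        with 1 [OF n] near \<open>\<rho> > 0\<close> show ?thesis by (metis dist_self)
      qed
    qed
  qed
  then have "continuous_on ({0..1} \<times> {0..1}) K"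
    using continuous_on_expand [OF s] by (intro uniform_limit_theorem [of _ "\<lambda>n. expand n 0 s"]) auto
  moreover have "K \<in> {0..1} \<times> {0..1} \<rightarrow> B 0"
    using s by (auto simp: K_def word_in expand_in)
  moreover have "K (1, t) = e s t" if "t \<in> {0..1}" for t
    using that s by (simp add: K_def expand_1)
  ultimately show ?thesis
    unfolding homotopic_paths
    using s by (intro exI [of _ K]) (auto simp: K_def pathstart_def pathfinish_def word_ends expand_ends)
qed

end

section \<open>Telescoping products over a closed set of times\<close>

lemma path_congruence_homotopic_paths:
  fixes Y :: "'a::topological_space set"
  shows "path_congruence Y (homotopic_paths Y)"
  by unfold_locales
    (auto simp: homotopic_paths_imp_path homotopic_paths_imp_subset homotopic_paths_imp_pathstart
      homotopic_paths_imp_pathfinish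
      intro: homotopic_paths_sym homotopic_paths_trans homotopic_paths_join
      dest: homotopic_paths_imp_subset homotopic_paths_imp_path)

lemma homotopic_paths_insert:
  assumes "path_in Y p" "path_in Y q" "path_in Y r" "pathstart p = pathstart q" "pathfinish r = pathfinish q"
  shows "homotopic_paths Y q (p +++ ((reversepath p +++ (q +++ reversepath r)) +++ r))"
proof -
  interpret path_congruence Y "homotopic_paths Y" by (rule path_congruence_homotopic_paths)
  define c where "c = (\<lambda>_::real. pathstart q)"
  have from_c: "step c a a" if "path_in Y a" "pathstart a = pathstart q" for a
    using that by (simp add: step_def c_def const_left)
  have "step q (reversepath r) (q +++ reversepath r)"
    using assms by (intro step_self path_in_join) auto
  moreover from this have "step (q +++ reversepath r) r q"
    using step_reverse by fastforce
  ultimately have "step c (p +++ ((reversepath p +++ (q +++ reversepath r)) +++ r)) q"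
    using from_c [of p] from_c [of q] step_reverse [of c p p] assms by (auto intro: step_join)
  then show ?thesis
    using from_c [of q] assms by (auto intro: step_unique)
qed

lemma uniformly_close_on_compact:
  assumes "compact T"
    and near: "\<And>t. t \<in> T \<Longrightarrow> \<exists>\<eta>>0. \<forall>s\<in>T. dist s t < \<eta> \<longrightarrow> Q t s"
    and comb: "\<And>t s s'. Q t s \<Longrightarrow> Q t s' \<Longrightarrow> Q' s s'"
  shows "\<exists>\<eta>>0. \<forall>s\<in>T. \<forall>s'\<in>T. dist s s' < \<eta> \<longrightarrow> Q' s s'"
proof -
  obtain \<eta> where \<eta>: "\<And>t. t \<in> T \<Longrightarrow> \<eta> t > 0" "\<And>t s. t \<in> T \<Longrightarrow> s \<in> T \<Longrightarrow> dist s t < \<eta> t \<Longrightarrow> Q t s"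
    using near by metis
  obtain e where e: "e > 0" "\<And>s. s \<in> T \<Longrightarrow> \<exists>G \<in> (\<lambda>t. ball t (\<eta> t)) ` T. ball s e \<subseteq> G"
  proof (rule Heine_Borel_lemma [OF assms(1), of "(\<lambda>t. ball t (\<eta> t)) ` T"])
    show "T \<subseteq> \<Union> ((\<lambda>t. ball t (\<eta> t)) ` T)" using \<eta>(1) by force
  qed auto
  have "Q' s s'" if s: "s \<in> T" "s' \<in> T" "dist s s' < e" for s s'
  proof -
    obtain t where t: "t \<in> T" "ball s e \<subseteq> ball t (\<eta> t)" using e(2) [OF s(1)] by auto
    then have "s \<in> ball t (\<eta> t)" "s' \<in> ball t (\<eta> t)"
      using s e(1) by (meson centre_in_ball mem_ball subsetD)+
    then show ?thesis using \<eta>(2) t(1) s comb by (metis dist_commute mem_ball)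
  qed
  with e(1) show ?thesis by blast
qed

locale metric_path_congruence = path_congruence X R
  for X :: "'a::metric_space set" and R (infix "\<simeq>" 50)
begin

text \<open>
  The only infinite products that the uniqueness of lifts needs.  Both conditions of the theorem, transfinite
  products and closedness for the test element \<^const>\<open>p_tau\<close>, provide them.
\<close>

definition cantor_products :: bool where
  "cantor_products \<longleftrightarrow> (\<forall>x\<in>X. \<forall>q q'. null_loops X x q \<longrightarrow> null_loops X x q' \<longrightarrow>
     (\<forall>i\<ge>1. q i \<simeq> q' i) \<longrightarrow> cantor_product x q \<simeq> cantor_product x q')"

lemma step_across:
  assumes "path_in X p" "path_in X q" "pathstart p = pathstart q"
  shows "step p (reversepath p +++ q) q"
proof -
  have "step (\<lambda>_. pathstart p) p p" "step (\<lambda>_. pathstart p) q q"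
    using assms by (auto simp: step_def const_left)
  then show ?thesis using step_reverse step_join by blast
qed

text \<open>
  Loops \<open>E u v\<close> that carry \<open>P u\<close> to \<open>P v\<close> and are short whenever \<open>u\<close> and \<open>v\<close> are close.  Compactness makes the
  hypothesis uniform.  To have one choice of loops serve for all radii, each loop is chosen within a ball whose
  radius exceeds the infimum of the possible radii by at most the distance of \<open>u\<close> and \<open>v\<close>.
\<close>

lemma short_connections:
  assumes "compact T"
    and P: "\<And>t. t \<in> T \<Longrightarrow> path_in X (P t) \<and> pathstart (P t) = b \<and> pathfinish (P t) = x"
    and near: "\<And>t \<rho>. t \<in> T \<Longrightarrow> 0 < \<rho> \<Longrightarrow>
      \<exists>\<eta>>0. \<forall>s\<in>T. dist s t < \<eta> \<longrightarrow> (\<exists>\<epsilon>. path_image \<epsilon> \<subseteq> ball x \<rho> \<and> step (P t) \<epsilon> (P s))"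
  obtains E where "\<And>u v. u \<in> T \<Longrightarrow> v \<in> T \<Longrightarrow> step (P u) (E u v) (P v)"
    "\<And>\<rho>. 0 < \<rho> \<Longrightarrow> \<exists>\<eta>>0. \<forall>u\<in>T. \<forall>v\<in>T. dist u v < \<eta> \<longrightarrow> path_image (E u v) \<subseteq> ball x \<rho>"
proof -
  define radii where "radii u v = {\<rho>. 0 < \<rho> \<and> (\<exists>\<epsilon>. path_image \<epsilon> \<subseteq> ball x \<rho> \<and> step (P u) \<epsilon> (P v))}" for u v
  have bdd: "bdd_below (radii u v)" for u v
    unfolding bdd_below_def radii_def by (intro exI [of _ 0]) auto
  have ne: "radii u v \<noteq> {}" if "u \<in> T" "v \<in> T" for u v
  proof -
    let ?\<epsilon> = "reversepath (P u) +++ P v"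
    have "step (P u) ?\<epsilon> (P v)" using P that by (intro step_across) auto
    moreover from this have "bounded (path_image ?\<epsilon>)"
      by (meson bounded_path_image step_paths(2))
    then obtain \<rho> where "\<rho> > 0" "path_image ?\<epsilon> \<subseteq> ball x \<rho>"
      using bounded_subset_ballD by blast
    ultimately show ?thesis by (auto simp: radii_def)
  qed
  have "\<exists>\<epsilon>. step (P u) \<epsilon> (P v) \<and> path_image \<epsilon> \<subseteq> ball x (Inf (radii u v) + dist u v)"
    if uv: "u \<in> T" "v \<in> T" "u \<noteq> v" for u v
  proof -
    have "Inf (radii u v) < Inf (radii u v) + dist u v" using uv by simp
    then obtain \<rho> where \<rho>: "\<rho> \<in> radii u v" "\<rho> < Inf (radii u v) + dist u v"
      using cInf_lessD [OF ne [OF uv(1,2)]] by blast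
    then obtain \<epsilon> where "path_image \<epsilon> \<subseteq> ball x \<rho>" "step (P u) \<epsilon> (P v)"
      unfolding radii_def by blast
    then show ?thesis using subset_ball [OF less_imp_le [OF \<rho>(2)], of x] by blast
  qed
  then obtain E' where E': "\<And>u v. u \<in> T \<Longrightarrow> v \<in> T \<Longrightarrow> u \<noteq> v \<Longrightarrow>
      step (P u) (E' u v) (P v) \<and> path_image (E' u v) \<subseteq> ball x (Inf (radii u v) + dist u v)"
    by metis
  define E where "E u v = (if u = v then (\<lambda>_. x) else E' u v)" for u v
  show thesis
  proof (rule that [of E])
    show "step (P u) (E u v) (P v)" if "u \<in> T" "v \<in> T" for u v
    proof (cases "u = v")
      case True
      then show ?thesis using P [OF that(2)] step_refl [of "P v" x] by (simp add: E_def)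
    next
      case False
      then show ?thesis using E' that by (simp add: E_def)
    qed
  next
    fix \<rho> :: real assume \<rho>: "0 < \<rho>"
    have "\<exists>\<eta>>0. \<forall>u\<in>T. \<forall>v\<in>T. dist u v < \<eta> \<longrightarrow> (\<exists>\<epsilon>. path_image \<epsilon> \<subseteq> ball x (\<rho> / 2) \<and> step (P u) \<epsilon> (P v))"
    proof (rule uniformly_close_on_compact [OF assms(1) near])
      fix t s s' assume "\<exists>\<epsilon>. path_image \<epsilon> \<subseteq> ball x (\<rho> / 2) \<and> step (P t) \<epsilon> (P s)"
        "\<exists>\<epsilon>. path_image \<epsilon> \<subseteq> ball x (\<rho> / 2) \<and> step (P t) \<epsilon> (P s')"
      then obtain \<epsilon> \<epsilon>' where \<epsilon>: "path_image \<epsilon> \<subseteq> ball x (\<rho> / 2)" "step (P t) \<epsilon> (P s)"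
        "path_image \<epsilon>' \<subseteq> ball x (\<rho> / 2)" "step (P t) \<epsilon>' (P s')" by blast
      then have "step (P s) (reversepath \<epsilon> +++ \<epsilon>') (P s')"
        using step_reverse step_join by blast
      moreover have "path_image (reversepath \<epsilon> +++ \<epsilon>') \<subseteq> ball x (\<rho> / 2)"
        using \<epsilon> by (intro subset_path_image_join) auto
      ultimately show "\<exists>\<epsilon>. path_image \<epsilon> \<subseteq> ball x (\<rho> / 2) \<and> step (P s) \<epsilon> (P s')" by blast
    qed (use \<rho> in auto)
    then obtain \<eta> where \<eta>: "\<eta> > 0" "\<And>u v. u \<in> T \<Longrightarrow> v \<in> T \<Longrightarrow> dist u v < \<eta> \<Longrightarrow> \<rho> / 2 \<in> radii u v"
      using \<rho> unfolding radii_def by auto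
    show "\<exists>\<eta>>0. \<forall>u\<in>T. \<forall>v\<in>T. dist u v < \<eta> \<longrightarrow> path_image (E u v) \<subseteq> ball x \<rho>"
    proof (intro exI conjI ballI impI)
      show "min \<eta> (\<rho> / 2) > 0" using \<eta> \<rho> by simp
      fix u v assume uv: "u \<in> T" "v \<in> T" "dist u v < min \<eta> (\<rho> / 2)"
      show "path_image (E u v) \<subseteq> ball x \<rho>"
      proof (cases "u = v")
        case True
        then show ?thesis using \<rho> by (auto simp: E_def path_image_def)
      next
        case False
        have "Inf (radii u v) \<le> \<rho> / 2" using \<eta>(2) uv bdd by (intro cInf_lower) auto
        then have "Inf (radii u v) + dist u v \<le> \<rho>" using uv by auto
        then show ?thesis using E' [OF uv(1,2) False] False by (auto simp: E_def intro: subset_ball)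
      qed
    qed
  qed
qed

text \<open>
  The classes \<open>P t\<close> are a lift over a closed set \<open>T\<close> of times at which \<open>g\<close> is at \<open>x\<close>.  They follow \<open>g\<close> across the gaps of
  \<open>T\<close> and change only by short loops between close times, and it has to be shown that they follow \<open>g\<close>
  altogether.  When \<open>T\<close> is a Cantor set this is not a matter of gaps alone.

  An interval with ends \<open>u\<close> and \<open>v\<close> in \<open>T\<close> is split at the gap of \<open>T\<close> around its midpoint, with ends \<open>lo\<close> and
  \<open>hi\<close>, into two intervals of at most half the length.  Repeating this yields a binary tree with two
  labellings.  The first puts \<open>E u lo\<close> reversed, then \<open>E u v\<close>, then \<open>E hi v\<close> reversed on the node: these labels
  are designed to cancel against their neighbours, and their infinite product is homotopic to \<open>E 0 1\<close>.  The second
  puts the piece of \<open>g\<close> from \<open>lo\<close> to \<open>hi\<close> on the node, and its infinite product is homotopic to \<open>g\<close>.  At each node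
  both labels carry \<open>P lo\<close> to \<open>P hi\<close> and are hence congruent.  As Cantor products respect the congruence,
  \<open>E 0 1\<close> is congruent to \<open>g\<close>.
\<close>

theorem telescope:
  assumes cp: cantor_products
    and g: "path_in X g"
    and T: "closed T" "T \<subseteq> {0..1}" "0 \<in> T" "1 \<in> T"
    and gT: "\<And>t. t \<in> T \<Longrightarrow> g t = x"
    and P: "\<And>t. t \<in> T \<Longrightarrow> path_in X (P t) \<and> pathstart (P t) = b \<and> pathfinish (P t) = x"
    and near: "\<And>t \<rho>. t \<in> T \<Longrightarrow> 0 < \<rho> \<Longrightarrow>
      \<exists>\<eta>>0. \<forall>s\<in>T. dist s t < \<eta> \<longrightarrow> (\<exists>\<epsilon>. path_image \<epsilon> \<subseteq> ball x \<rho> \<and> step (P t) \<epsilon> (P s))"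
    and gap: "\<And>u v. u \<in> T \<Longrightarrow> v \<in> T \<Longrightarrow> u < v \<Longrightarrow> T \<inter> {u<..<v} = {} \<Longrightarrow> step (P u) (subarc g u v) (P v)"
  shows "step (P 0) g (P 1)"
proof -
  have "compact T" using T by (metis closed_Int_compact compact_Icc inf.absorb1)
  then obtain E where E: "\<And>u v. u \<in> T \<Longrightarrow> v \<in> T \<Longrightarrow> step (P u) (E u v) (P v)"
    and small: "\<And>\<rho>. 0 < \<rho> \<Longrightarrow> \<exists>\<eta>>0. \<forall>u\<in>T. \<forall>v\<in>T. dist u v < \<eta> \<longrightarrow> path_image (E u v) \<subseteq> ball x \<rho>"
    using short_connections [OF _ P near] by metis
  have Eends: "pathstart (E u v) = x" "pathfinish (E u v) = x" "path_in X (E u v)" if "u \<in> T" "v \<in> T" for u v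
    using step_paths [OF E [OF that]] P that by auto
  have cont: "continuous_on {0..1} g" using g by (simp add: path_def)
  define lo where "lo s = Sup (T \<inter> {fst s..(fst s + snd s) / 2})" for s
  define hi where "hi s = Inf (T \<inter> {(fst s + snd s) / 2..snd s})" for s
  define I where "I n s \<longleftrightarrow> fst s \<in> T \<and> snd s \<in> T \<and> fst s \<le> snd s \<and> snd s - fst s \<le> 1 / 2 ^ n" for n :: nat and s
  have I0: "I n s \<Longrightarrow> I 0 s" for n s
  proof -
    have "(1::real) / 2 ^ n \<le> 1" by simp
    then have "a \<le> 1 / 2 ^ n \<Longrightarrow> a \<le> 1" for a :: real by linarith
    then show "I n s \<Longrightarrow> I 0 s" by (simp add: I_def)
  qed
  have lo: "lo s \<in> T" "fst s \<le> lo s" "lo s \<le> (fst s + snd s) / 2"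
    and hi: "hi s \<in> T" "(fst s + snd s) / 2 \<le> hi s" "hi s \<le> snd s"
    and no: "T \<inter> {lo s<..<hi s} = {}" if "I n s" for n s
  proof -
    let ?m = "(fst s + snd s) / 2"
    let ?L = "T \<inter> {fst s..?m}" and ?H = "T \<inter> {?m..snd s}"
    have "fst s \<in> ?L" "snd s \<in> ?H" using that by (auto simp: I_def)
    then have ne: "?L \<noteq> {}" "?H \<noteq> {}" by blast+
    have cl: "closed ?L" "closed ?H" using T by auto
    have bd: "bdd_above ?L" "bdd_below ?H" by auto
    have "lo s \<in> ?L" unfolding lo_def using ne cl bd by (intro closed_contains_Sup) auto
    moreover have "hi s \<in> ?H" unfolding hi_def using ne cl bd by (intro closed_contains_Inf) auto
    ultimately show lh: "lo s \<in> T" "fst s \<le> lo s" "lo s \<le> ?m" "hi s \<in> T" "?m \<le> hi s" "hi s \<le> snd s" by auto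
    have "t \<notin> T" if t: "lo s < t" "t < hi s" for t
    proof
      assume "t \<in> T"
      show False
      proof (cases "t \<le> ?m")
        case True
        with \<open>t \<in> T\<close> t lh have "t \<in> ?L" by auto
        then have "t \<le> lo s" unfolding lo_def using bd by (intro cSup_upper)
        with t show False by simp
      next
        case False
        with \<open>t \<in> T\<close> t lh have "t \<in> ?H" by auto
        then have "hi s \<le> t" unfolding hi_def using bd by (intro cInf_lower)
        with t show False by simp
      qed
    qed
    then show "T \<inter> {lo s<..<hi s} = {}" by auto
  qed
  define l where "l s = (fst s, lo s)" for s
  define r where "r s = (hi s, snd s)" for s
  define z1 where "z1 s = (if I 0 s then reversepath (E (fst s) (lo s)) +++ (E (fst s) (snd s) +++ reversepath (E (hi s) (snd s)))
    else (\<lambda>_. x))" for s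
  define z2 where "z2 s = (if I 0 s then subarc g (lo s) (hi s) else (\<lambda>_. x))" for s
  define e1 where "e1 s = E (fst s) (snd s)" for s
  define e2 where "e2 s = subarc g (fst s) (snd s)" for s
  \<comment> \<open>All points met by the connecting loops and by \<open>g\<close> over intervals of length at most \<open>1 / 2 ^ n\<close>.\<close>
  define B where "B n = insert x (\<Union>s\<in>Collect (I n). path_image (E (fst s) (snd s)) \<union> g ` {fst s..snd s})" for n
  have child: "I (Suc n) (l s)" "I (Suc n) (r s)" if "I n s" for n s
  proof -
    have *: "a \<le> 1 / 2 ^ Suc n \<longleftrightarrow> 2 * a \<le> 1 / 2 ^ n" for a :: real by (simp add: field_simps)
    show "I (Suc n) (l s)" "I (Suc n) (r s)"
      using that lo [OF that] hi [OF that] unfolding I_def l_def r_def fst_conv snd_conv * by auto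
  qed
  have mono: "I (Suc n) s \<Longrightarrow> I n s" for n s
    using power_increasing [of n "Suc n" "2::real"] by (auto simp: I_def field_simps)
  have BX: "B n \<subseteq> X" for n
  proof -
    have "x \<in> X" using gT [OF T(3)] g by (metis pathstart_def pathstart_in_path_image subsetD)
    moreover have "path_image (E (fst s) (snd s)) \<subseteq> X" if "I n s" for s
      using Eends that by (auto simp: I_def)
    moreover have "g ` {fst s..snd s} \<subseteq> X" if "I n s" for s
    proof -
      have "{fst s..snd s} \<subseteq> {0..1}" using that T(2) by (auto simp: I_def)
      then show ?thesis using g by (auto simp: path_image_def)
    qed
    ultimately show ?thesis unfolding B_def by blast
  qed
  have antimono: "B (Suc n) \<subseteq> B n" for n
    using mono [of n] unfolding B_def by blast
  have xB: "x \<in> B n" for n by (simp add: B_def)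
  have EB: "path_image (E u v) \<subseteq> B n" and gB: "g ` {u..v} \<subseteq> B n" if "I n (u, v)" for n u v
    using that unfolding B_def by auto
  have shrink: "\<exists>n. B n \<subseteq> ball x \<rho>" if "0 < \<rho>" for \<rho>
  proof -
    obtain \<eta>1 where \<eta>1: "\<eta>1 > 0" "\<And>u v. u \<in> T \<Longrightarrow> v \<in> T \<Longrightarrow> dist u v < \<eta>1 \<Longrightarrow> path_image (E u v) \<subseteq> ball x \<rho>"
      using small [OF \<open>0 < \<rho>\<close>] by blast
    have "uniformly_continuous_on {0..1} g"
      using cont by (intro compact_uniformly_continuous) auto
    then obtain \<eta>2 where \<eta>2: "\<eta>2 > 0" "\<And>s t. s \<in> {0..1} \<Longrightarrow> t \<in> {0..1} \<Longrightarrow> dist s t < \<eta>2 \<Longrightarrow> dist (g s) (g t) < \<rho>"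
      using \<open>0 < \<rho>\<close> unfolding uniformly_continuous_on_def by metis
    have "0 < min \<eta>1 \<eta>2" using \<eta>1 \<eta>2 by simp
    then obtain n where "(1 / 2 :: real) ^ n < min \<eta>1 \<eta>2"
      using real_arch_pow_inv [of "min \<eta>1 \<eta>2" "1 / 2"] by fastforce
    then have n: "1 / 2 ^ n < \<eta>1" "1 / 2 ^ n < \<eta>2" by (auto simp: power_one_over)
    have "path_image (E (fst s) (snd s)) \<subseteq> ball x \<rho>" if "I n s" for s
      using that n by (intro \<eta>1) (auto simp: I_def dist_real_def)
    moreover have "g t \<in> ball x \<rho>" if "I n s" "t \<in> {fst s..snd s}" for s t
    proof -
      have "fst s \<in> {0..1}" "t \<in> {0..1}" using that T(2) by (auto simp: I_def)
      moreover have "dist (fst s) t < \<eta>2" using that n by (auto simp: I_def dist_real_def)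
      ultimately have "dist (g (fst s)) (g t) < \<rho>" by (rule \<eta>2)
      then show ?thesis using gT that by (simp add: I_def)
    qed
    ultimately have "B n \<subseteq> ball x \<rho>" using that by (auto simp: B_def)
    then show ?thesis ..
  qed
  have sub: "I n (fst s, lo s)" "I n (hi s, snd s)" "I n (lo s, hi s)" if "I n s" for n s
    using lo [OF that] hi [OF that] that by (auto simp: I_def)
  have z1_in: "path_in (B n) (z1 s)" if "I n s" for n s
  proof -
    have "fst s \<in> T" "snd s \<in> T" using that by (auto simp: I_def)
    then show ?thesis
      using I0 [OF that] Eends lo [OF that] hi [OF that] EB [OF sub(1) [OF that]] EB [OF sub(2) [OF that]]
        EB [of n "fst s" "snd s"] that
      by (auto simp: z1_def path_image_join)
  qed
  interpret t1: shrinking_tree l r z1 e1 I B x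
  proof
    fix s
    have "pathstart (z1 s) = x \<and> pathfinish (z1 s) = x"
    proof (cases "I 0 s")
      case True
      then have "fst s \<in> T" "snd s \<in> T" by (auto simp: I_def)
      then show ?thesis using Eends lo(1) [OF True] hi(1) [OF True] True by (simp add: z1_def)
    qed (simp add: z1_def)
    then show "z1 s 0 = x" "z1 s 1 = x" by (simp_all add: pathstart_def pathfinish_def)
  next
    fix n s assume s: "I n s"
    then have "fst s \<in> T" "snd s \<in> T" by (auto simp: I_def)
    then show "pathstart (e1 s) = x \<and> pathfinish (e1 s) = x"
      using Eends by (auto simp: e1_def)
    have EBn: "path_in (B n) (E u v)" if "I n (u, v)" for u v
      using that EB [OF that] Eends(3) by (auto simp: I_def)
    have "homotopic_paths (B n) (E (fst s) (snd s)) (E (fst s) (lo s) +++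
        ((reversepath (E (fst s) (lo s)) +++ (E (fst s) (snd s) +++ reversepath (E (hi s) (snd s)))) +++ E (hi s) (snd s)))"
      using \<open>fst s \<in> T\<close> \<open>snd s \<in> T\<close> Eends lo(1) [OF s] hi(1) [OF s] sub [OF s] s
      by (intro homotopic_paths_insert EBn) auto
    then show "homotopic_paths (B n) (e1 s) (e1 (l s) +++ (z1 s +++ e1 (r s)))"
      using I0 [OF s] by (simp add: e1_def l_def r_def z1_def)
  qed (use child antimono shrink xB z1_in in auto)
  have subarc_B: "path_in (B n) (subarc g u v)" if "I n (u, v)" for n u v
  proof -
    have uv: "u \<in> {0..1}" "v \<in> {0..1}" "u \<le> v" using that T(2) by (auto simp: I_def)
    show ?thesis
      using path_in_subarc [OF g uv(1,2)] gB [OF that] uv by (simp add: path_image_subarc closed_segment_eq_real_ivl)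
  qed
  interpret t2: shrinking_tree l r z2 e2 I B x
  proof
    fix s show "z2 s 0 = x" "z2 s 1 = x"
      using gT lo(1) [of 0 s] hi(1) [of 0 s] by (auto simp: z2_def linepath_def)
  next
    fix n s assume s: "I n s"
    then have ST: "fst s \<in> T" "snd s \<in> T" by (auto simp: I_def)
    then show "pathstart (e2 s) = x \<and> pathfinish (e2 s) = x"
      using gT by (simp add: e2_def pathstart_compose pathfinish_compose)
    show "path_in (B n) (z2 s)"
      using subarc_B [OF sub(3) [OF s]] I0 [OF s] by (simp add: z2_def)
    let ?C = "{fst s..snd s}"
    have "fst s \<in> {0..1}" "snd s \<in> {0..1}" using ST T(2) by auto
    then have "?C \<subseteq> {0..1}" by auto
    then have C: "continuous_on ?C g" "fst s \<in> ?C" "snd s \<in> ?C" "lo s \<in> ?C" "hi s \<in> ?C"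
      using cont s ST T(2) lo [OF s] hi [OF s] by (auto simp: I_def elim!: continuous_on_subset)
    interpret h: path_congruence "g ` ?C" "homotopic_paths (g ` ?C)" by (rule path_congruence_homotopic_paths)
    have "homotopic_paths (g ` ?C) (subarc g (lo s) (hi s) +++ subarc g (hi s) (snd s)) (subarc g (lo s) (snd s))"
      using C by (intro homotopic_subarc_join) auto
    moreover have 1: "homotopic_paths (g ` ?C) (subarc g (fst s) (lo s) +++ subarc g (lo s) (snd s)) (subarc g (fst s) (snd s))"
      using C by (intro homotopic_subarc_join) auto
    moreover have "path_in (g ` ?C) (subarc g (fst s) (lo s))"
      using h.paths [OF 1] by (auto simp: path_image_join pathstart_compose pathfinish_compose)
    ultimately have "homotopic_paths (g ` ?C) (e2 s) (e2 (l s) +++ (z2 s +++ e2 (r s)))"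
      using I0 [OF s] unfolding e2_def z2_def l_def r_def
      by (auto intro!: h.sym [OF h.trans [OF h.join]] h.refl simp: pathstart_compose pathfinish_compose)
    then show "homotopic_paths (B n) (e2 s) (e2 (l s) +++ (z2 s +++ e2 (r s)))"
      using gB [of n "fst s" "snd s"] s by (auto elim: homotopic_paths_subset)
  qed (use child antimono shrink xB in auto)
  have z12: "z1 s \<simeq> z2 s" if "I n s" for n s
  proof (rule step_unique)
    have ST: "fst s \<in> T" "snd s \<in> T" using that by (auto simp: I_def)
    show "step (P (lo s)) (z1 s) (P (hi s))"
      using I0 [OF that] step_join [OF step_reverse [OF E [OF ST(1) lo(1) [OF that]]]
          step_join [OF E [OF ST] step_reverse [OF E [OF hi(1) [OF that] ST(2)]]]]
      by (simp add: z1_def)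
    show "step (P (lo s)) (z2 s) (P (hi s))"
    proof (cases "lo s < hi s")
      case True
      then show ?thesis using gap lo(1) [OF that] hi(1) [OF that] no [OF that] I0 [OF that] by (simp add: z2_def)
    next
      case False
      then have "hi s = lo s" using lo(3) [OF that] hi(2) [OF that] by simp
      then show ?thesis
        using I0 [OF that] P [OF lo(1) [OF that]] gT [OF lo(1) [OF that]]
        by (simp add: z2_def subarc_trivial step_refl)
    qed
  qed
  have lab12: "gap_label l r z1 s (Suc n) k \<simeq> gap_label l r z2 s (Suc n) k" if "I m s" for m s n k
    using that
  proof (induction n arbitrary: m s k)
    case 0
    then show ?case using z12 by simp
  next
    case (Suc n)
    then show ?case using child [OF Suc.prems] by simp
  qed
  have root: "I 0 (0, 1)" using T by (simp add: I_def)
  have nl: "null_loops X x q" if "null_loops (B 0) x q" for q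
    using that BX [of 0] unfolding null_loops_def by blast
  have "cantor_product x (t1.letter (0, 1)) \<simeq> cantor_product x (t2.letter (0, 1))"
  proof -
    have "t1.letter (0, 1) i \<simeq> t2.letter (0, 1) i" if "i \<ge> 1" for i
      using lab12 [OF root, of "gap_level i - 1"] gap_index_level(1) [OF that] by simp
    moreover have "x \<in> X" using xB BX by blast
    ultimately show ?thesis
      using cp nl [OF t1.null_loops_letter [OF root]] nl [OF t2.null_loops_letter [OF root]]
      unfolding cantor_products_def by blast
  qed
  then have words: "t1.word (0, 1) \<simeq> t2.word (0, 1)"
    by (simp add: t1.word_def t2.word_def cantor_tree_product_def)
  have "t1.word (0, 1) \<simeq> E 0 1"
    using t1.homotopic_word [OF root] BX [of 0] homotopic homotopic_paths_subset
    unfolding e1_def fst_conv snd_conv by blast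
  moreover have "t2.word (0, 1) \<simeq> g"
    using t2.homotopic_word [OF root] BX [of 0] homotopic homotopic_paths_subset
    unfolding e2_def fst_conv snd_conv subarc_0_1 by blast
  ultimately have "E 0 1 \<simeq> g"
    using words sym trans by blast
  then show ?thesis
    using step_cong2 [OF E [OF T(3,4)]] by blast
qed

end

section \<open>Lifts of a path to the space of path classes\<close>

context metric_path_congruence
begin

text \<open>A continuous path of congruence classes, given by representatives.\<close>

definition path_lift :: "'a \<Rightarrow> (real \<Rightarrow> real \<Rightarrow> 'a) \<Rightarrow> bool" where
  "path_lift x0 A \<longleftrightarrow> (\<forall>t\<in>{0..1}. path_in X (A t) \<and> pathstart (A t) = x0) \<and>
     (\<forall>t\<in>{0..1}. \<forall>\<rho>>0. \<exists>\<eta>>0. \<forall>s\<in>{0..1}. dist s t < \<eta> \<longrightarrow>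
        (\<exists>\<epsilon>. path_image \<epsilon> \<subseteq> ball (pathfinish (A t)) \<rho> \<and> step (A t) \<epsilon> (A s)))"

abbreviation trace :: "(real \<Rightarrow> real \<Rightarrow> 'a) \<Rightarrow> real \<Rightarrow> 'a" where
  "trace A \<equiv> \<lambda>t. pathfinish (A t)"

text \<open>Appending the initial parts of the trace to \<open>A 0\<close> defines one lift of the trace, and any lift is that one.\<close>

definition unique_lifts :: "'a \<Rightarrow> bool" where
  "unique_lifts x0 \<longleftrightarrow> (\<forall>A. path_lift x0 A \<longrightarrow> step (A 0) (trace A) (A 1))"

lemma path_liftD:
  assumes "path_lift x0 A"
  shows "t \<in> {0..1} \<Longrightarrow> path_in X (A t)" "t \<in> {0..1} \<Longrightarrow> pathstart (A t) = x0"
    "t \<in> {0..1} \<Longrightarrow> 0 < \<rho> \<Longrightarrow> \<exists>\<eta>>0. \<forall>s\<in>{0..1}. dist s t < \<eta> \<longrightarrow>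
        (\<exists>\<epsilon>. path_image \<epsilon> \<subseteq> ball (pathfinish (A t)) \<rho> \<and> step (A t) \<epsilon> (A s))"
  using assms unfolding path_lift_def by blast+

lemma trace_close:
  assumes "path_lift x0 A" "t \<in> {0..1}" "0 < \<rho>"
  obtains \<eta> where "\<eta> > 0"
    "\<And>s. s \<in> {0..1} \<Longrightarrow> dist s t < \<eta> \<Longrightarrow>
       trace A s \<in> ball (trace A t) \<rho> \<and> (\<exists>\<epsilon>. path_image \<epsilon> \<subseteq> ball (trace A t) \<rho> \<and> step (A t) \<epsilon> (A s))"
proof -
  obtain \<eta> where \<eta>: "\<eta> > 0" "\<And>s. s \<in> {0..1} \<Longrightarrow> dist s t < \<eta> \<Longrightarrow>
       (\<exists>\<epsilon>. path_image \<epsilon> \<subseteq> ball (trace A t) \<rho> \<and> step (A t) \<epsilon> (A s))"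
    using path_liftD(3) [OF assms] by blast
  show thesis
  proof (rule that [OF \<eta>(1)])
    fix s assume "s \<in> {0..1::real}" "dist s t < \<eta>"
    then obtain \<epsilon> where "path_image \<epsilon> \<subseteq> ball (trace A t) \<rho>" "step (A t) \<epsilon> (A s)"
      using \<eta>(2) by blast
    moreover from this have "trace A s \<in> path_image \<epsilon>"
      using step_paths(5) [of "A t" \<epsilon> "A s"] by (metis pathfinish_in_path_image)
    ultimately show "trace A s \<in> ball (trace A t) \<rho> \<and> (\<exists>\<epsilon>. path_image \<epsilon> \<subseteq> ball (trace A t) \<rho> \<and> step (A t) \<epsilon> (A s))"
      by blast
  qed
qed

lemma path_in_trace:
  assumes "path_lift x0 A"
  shows "path_in X (trace A)"
proof
  show "path (trace A)"
    unfolding path_def continuous_on_iff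
  proof (intro ballI allI impI)
    fix t \<rho> :: real assume "t \<in> {0..1}" "0 < \<rho>"
    then obtain \<eta> where "\<eta> > 0" "\<And>s. s \<in> {0..1} \<Longrightarrow> dist s t < \<eta> \<Longrightarrow> trace A s \<in> ball (trace A t) \<rho>"
      using trace_close [OF assms] by metis
    then show "\<exists>\<eta>>0. \<forall>s\<in>{0..1}. dist s t < \<eta> \<longrightarrow> dist (trace A s) (trace A t) < \<rho>"
      by (metis dist_commute mem_ball)
  qed
  show "path_image (trace A) \<subseteq> X"
    using path_liftD(1) [OF assms] pathfinish_in_path_image unfolding path_image_def [of "trace A"]
    by blast
qed

lemma dist_linepath_01:
  fixes u v :: real
  assumes "u \<in> {0..1}" "v \<in> {0..1}"
  shows "dist (linepath u v s) (linepath u v t) \<le> dist s t"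
proof -
  have "linepath u v s - linepath u v t = (v - u) * (s - t)"
    by (simp add: linepath_def algebra_simps)
  moreover have "\<bar>(v - u) * (s - t)\<bar> \<le> 1 * \<bar>s - t\<bar>"
    unfolding abs_mult using assms by (intro mult_right_mono) auto
  ultimately show ?thesis by (simp add: dist_real_def)
qed

lemma path_lift_subarc:
  assumes "path_lift x0 A" "u \<in> {0..1}" "v \<in> {0..1}"
  shows "path_lift x0 (A \<circ> linepath u v)"
  unfolding path_lift_def
proof (intro conjI ballI allI impI)
  fix t :: real assume t: "t \<in> {0..1}"
  note lt = linepath_01 [OF assms(2,3)]
  show "path ((A \<circ> linepath u v) t)" "path_image ((A \<circ> linepath u v) t) \<subseteq> X"
    "pathstart ((A \<circ> linepath u v) t) = x0"
    using path_liftD(1,2) [OF assms(1) lt [OF t]] by auto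
  fix \<rho> :: real assume "0 < \<rho>"
  then obtain \<eta> where \<eta>: "\<eta> > 0" "\<And>s. s \<in> {0..1} \<Longrightarrow> dist s (linepath u v t) < \<eta> \<Longrightarrow>
      \<exists>\<epsilon>. path_image \<epsilon> \<subseteq> ball (trace A (linepath u v t)) \<rho> \<and> step (A (linepath u v t)) \<epsilon> (A s)"
    using path_liftD(3) [OF assms(1) lt [OF t]] by blast
  show "\<exists>\<eta>>0. \<forall>s\<in>{0..1}. dist s t < \<eta> \<longrightarrow>
      (\<exists>\<epsilon>. path_image \<epsilon> \<subseteq> ball (pathfinish ((A \<circ> linepath u v) t)) \<rho> \<and>
         step ((A \<circ> linepath u v) t) \<epsilon> ((A \<circ> linepath u v) s))"
    using \<eta> lt dist_linepath_01 [OF assms(2,3)] by (metis comp_apply le_less_trans)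
qed

definition standard_at :: "(real \<Rightarrow> real \<Rightarrow> 'a) \<Rightarrow> real \<Rightarrow> bool" where
  "standard_at A t \<longleftrightarrow> (\<exists>\<eta>>0. \<forall>s\<in>{0..1}. dist s t < \<eta> \<longrightarrow> step (A t) (subarc (trace A) t s) (A s))"

lemma standard_at_subarc:
  assumes "standard_at A (linepath u v t)" "u \<in> {0..1}" "v \<in> {0..1}"
    and t: "t \<in> {0..1}"
  shows "standard_at (A \<circ> linepath u v) t"
proof -
  have "subarc (trace (A \<circ> linepath u v)) t s = subarc (trace A) (linepath u v t) (linepath u v s)" for s
    using subarc_subarc [of "trace A" u v t s] by (simp add: comp_def)
  moreover have "linepath u v s \<in> {0..1}" if "s \<in> {0..1}" for s
    using that assms by (intro linepath_01)
  ultimately show ?thesis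
    using assms(1) dist_linepath_01 [OF assms(2,3), of _ t] unfolding standard_at_def
    by (metis comp_apply le_less_trans)
qed

lemma standard_interval:
  assumes A: "path_lift x0 A" and J: "connected J" "J \<subseteq> {0..1}" "\<And>t. t \<in> J \<Longrightarrow> standard_at A t"
    and st: "s \<in> J" "t \<in> J"
  shows "step (A s) (subarc (trace A) s t) (A t)"
proof (rule connected_equivalence_relation [OF J(1) st])
  fix u v assume "step (A u) (subarc (trace A) u v) (A v)"
  then show "step (A v) (subarc (trace A) v u) (A u)"
    by (simp only: step_subarc_reverse)
next
  fix u v w assume *: "step (A u) (subarc (trace A) u v) (A v)" "step (A v) (subarc (trace A) v w) (A w)"
    "u \<in> J" "v \<in> J" "w \<in> J"
  then have "u \<in> {0..1}" "v \<in> {0..1}" "w \<in> {0..1}" using J(2) by blast+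
  then show "step (A u) (subarc (trace A) u w) (A w)"
    using step_subarc [OF *(1) path_in_trace [OF A]] *(2) by blast
next
  fix t assume t: "t \<in> J"
  then obtain \<eta> where "\<eta> > 0" "\<And>s. s \<in> {0..1} \<Longrightarrow> dist s t < \<eta> \<Longrightarrow> step (A t) (subarc (trace A) t s) (A s)"
    using J(3) unfolding standard_at_def by blast
  then show "\<exists>T. openin (top_of_set J) T \<and> t \<in> T \<and> (\<forall>s\<in>T. step (A t) (subarc (trace A) t s) (A s))"
    using t J(2) by (intro exI [of _ "J \<inter> ball t \<eta>"]) (auto simp: dist_commute openin_open_Int)
qed

text \<open>
  Classes over \<open>x\<close> that can be joined by arbitrarily short loops are equal.  The family that has the value \<open>p\<close> at
  0 and \<open>q\<close> at all later times is a lift of the constant path at \<open>x\<close>, and telescoping applies with the whole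
  unit interval as the set of times, which has no gaps.
\<close>

lemma cantor_products_hausdorff:
  assumes cp: cantor_products
    and pq: "path_in X p" "path_in X q" "pathstart p = pathstart q" "pathfinish p = x" "pathfinish q = x"
    and near: "\<And>\<rho>. 0 < \<rho> \<Longrightarrow> \<exists>\<epsilon>. path_image \<epsilon> \<subseteq> ball x \<rho> \<and> step p \<epsilon> q"
  shows "p \<simeq> q"
proof -
  define P where "P t = (if t = 0 then p else q)" for t :: real
  have x: "x \<in> X" using pq by (metis pathfinish_in_path_image subsetD)
  have stay: "\<exists>\<epsilon>. path_image \<epsilon> \<subseteq> ball x \<rho> \<and> step (P t) \<epsilon> (P t)" if "0 < \<rho>" for \<rho> t
    using that pq step_refl by (intro exI [of _ "\<lambda>_. x"]) (auto simp: P_def path_image_def)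
  have "step (P 0) (\<lambda>_. x) (P 1)"
  proof (rule telescope [OF cp, where T = "{0..1}" and b = "pathstart p" and P = P and x = x])
    fix t \<rho> :: real assume t: "t \<in> {0..1}" and \<rho>: "0 < \<rho>"
    show "\<exists>\<eta>>0. \<forall>s\<in>{0..1}. dist s t < \<eta> \<longrightarrow> (\<exists>\<epsilon>. path_image \<epsilon> \<subseteq> ball x \<rho> \<and> step (P t) \<epsilon> (P s))"
    proof (cases "t = 0")
      case True
      have "\<exists>\<epsilon>. path_image \<epsilon> \<subseteq> ball x \<rho> \<and> step (P t) \<epsilon> (P s)" for s
        using near [OF \<rho>] stay [OF \<rho>, of 0] by (cases "s = 0") (auto simp: P_def True)
      then show ?thesis by (intro exI [of _ 1]) auto
    next
      case False
      have "P s = P t" if "dist s t < t" for s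
        using that False by (auto simp: P_def dist_real_def)
      then have "\<exists>\<epsilon>. path_image \<epsilon> \<subseteq> ball x \<rho> \<and> step (P t) \<epsilon> (P s)" if "dist s t < t" for s
        using that stay [OF \<rho>, of t] by simp
      then show ?thesis using False t by (intro exI [of _ t]) auto
    qed
  next
    fix u v :: real assume uv: "u \<in> {0..1}" "v \<in> {0..1}" "u < v" "{0..1} \<inter> {u<..<v} = {}"
    have "(u + v) / 2 \<in> {0..1} \<inter> {u<..<v}" using uv(1-3) by (auto simp: field_simps)
    with uv(4) show "step (P u) (subarc (\<lambda>_. x) u v) (P v)" by blast
  qed (use x pq path_in_const in \<open>auto simp: P_def\<close>)
  then have "step p (\<lambda>_. x) q" by (simp add: P_def)
  moreover have "step p (\<lambda>_. x) p" using pq by (simp add: step_refl)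
  ultimately show ?thesis using step_target by blast
qed

text \<open>
  Moving \<open>A s\<close> back along the trace to time 0 gives a class over the same point as \<open>A 0\<close>.  It does not depend on
  \<open>s\<close>, and for small \<open>s\<close> it is seen to differ from \<open>A 0\<close> by a short loop.
\<close>

lemma standard_from_left:
  assumes cp: cantor_products and A: "path_lift x0 A"
    and std: "\<And>t. 0 < t \<Longrightarrow> t < 1 \<Longrightarrow> standard_at A t" and s: "0 < s" "s < 1"
  shows "step (A 0) (subarc (trace A) 0 s) (A s)"
proof -
  let ?g = "trace A"
  note g = path_in_trace [OF A] and AD = path_liftD [OF A]
  define q where "q = A s +++ subarc ?g s 0"
  have q: "step (A s) (subarc ?g s 0) q"
    unfolding q_def using s AD path_in_subarc [OF g, of s 0]
    by (intro step_self path_in_join) (auto simp: pathstart_compose)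
  have "A 0 \<simeq> q"
  proof (rule cantor_products_hausdorff [OF cp, where x = "trace A 0"])
    show "path_in X q" "pathstart (A 0) = pathstart q" "pathfinish q = trace A 0"
      using step_paths [OF q] AD(2) [of 0] AD(2) [of s] s by (auto simp: pathfinish_compose)
    fix \<rho> :: real assume "0 < \<rho>"
    then obtain \<eta> where \<eta>: "\<eta> > 0" "\<And>s. s \<in> {0..1} \<Longrightarrow> dist s 0 < \<eta> \<Longrightarrow>
       ?g s \<in> ball (?g 0) \<rho> \<and> (\<exists>\<epsilon>. path_image \<epsilon> \<subseteq> ball (?g 0) \<rho> \<and> step (A 0) \<epsilon> (A s))"
      using trace_close [OF A, of 0 \<rho>] by auto
    define s' where "s' = min s (\<eta> / 2)"
    have s': "0 < s'" "s' \<le> s" "s' < \<eta>" "s' \<in> {0..1}" using s \<eta>(1) by (auto simp: s'_def)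
    then obtain \<epsilon> where \<epsilon>: "path_image \<epsilon> \<subseteq> ball (?g 0) \<rho>" "step (A 0) \<epsilon> (A s')"
      using \<eta>(2) [of s'] by (auto simp: dist_real_def)
    have "step (A s') (subarc ?g s' s) (A s)"
      using std s s' by (intro standard_interval [OF A, of "{0<..<1}"]) auto
    then have "step (A s') (subarc ?g s' 0) q"
      using q step_subarc [OF _ g, of "A s'" s' s "A s" 0 q] s s' by auto
    then have "step (A 0) (\<epsilon> +++ subarc ?g s' 0) q"
      using \<epsilon>(2) step_join by blast
    moreover have "path_image (subarc ?g s' 0) \<subseteq> ball (?g 0) \<rho>"
      unfolding path_image_subarc using s' \<eta>(2) by (auto simp: closed_segment_eq_real_ivl dist_real_def)
    ultimately show "\<exists>\<epsilon>. path_image \<epsilon> \<subseteq> ball (?g 0) \<rho> \<and> step (A 0) \<epsilon> q"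
      using \<epsilon>(1) subset_path_image_join by metis
  qed (use AD in auto)
  then have "step (A s) (subarc ?g s 0) (A 0)" using q sym step_cong3 by blast
  then show ?thesis by (simp only: step_subarc_reverse)
qed

lemma standard_across:
  assumes cp: cantor_products and A: "path_lift x0 A"
    and std: "\<And>t. 0 < t \<Longrightarrow> t < 1 \<Longrightarrow> standard_at A t"
  shows "step (A 0) (trace A) (A 1)"
proof -
  let ?B = "A \<circ> linepath 1 0"
  have lp: "linepath 1 0 t = 1 - t" for t :: real by (simp add: linepath_def)
  have "step (?B 0) (subarc (trace ?B) 0 (1 / 2)) (?B (1 / 2))"
  proof (rule standard_from_left [OF cp path_lift_subarc [OF A]])
    show "standard_at ?B t" if "0 < t" "t < 1" for t
      using std [of "1 - t"] that by (intro standard_at_subarc) (auto simp: lp)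
  qed auto
  moreover have "subarc (trace ?B) 0 (1 / 2) = subarc (trace A) 1 (1 / 2)"
    by (auto simp: linepath_def field_simps)
  moreover have "?B 0 = A 1" "?B (1 / 2) = A (1 / 2)" by (simp_all add: lp)
  ultimately have "step (A 1) (subarc (trace A) 1 (1 / 2)) (A (1 / 2))" by metis
  then have "step (A (1 / 2)) (subarc (trace A) (1 / 2) 1) (A 1)"
    by (simp only: step_subarc_reverse)
  moreover have "step (A 0) (subarc (trace A) 0 (1 / 2)) (A (1 / 2))"
    using std by (intro standard_from_left [OF cp A]) auto
  ultimately have "step (A 0) (subarc (trace A) 0 1) (A 1)"
    using step_subarc [OF _ path_in_trace [OF A], of "A 0" 0 "1 / 2" "A (1 / 2)" 1 "A 1"] by simp
  then show ?thesis by (simp only: subarc_0_1)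
qed

text \<open>
  The times at which the trace is at \<open>x\<close> form a closed set.  Up to its last member telescoping applies, since the
  lift is standard across the gaps; from there on, the lift is standard at all later times.
\<close>

lemma standard_through_point:
  assumes cp: cantor_products and A: "path_lift x0 A" and x: "trace A 0 = x"
    and std: "\<And>t. t \<in> {0..1} \<Longrightarrow> trace A t \<noteq> x \<Longrightarrow> standard_at A t"
  shows "step (A 0) (trace A) (A 1)"
proof -
  let ?g = "trace A"
  note g = path_in_trace [OF A]
  have closed_g: "closed {t \<in> {0..1}. h t = x}" if "path h" for h
    using that continuous_closed_preimage_constant [of "{0..1}" h x] by (simp add: path_def)
  define e where "e = Sup {t \<in> {0..1}. ?g t = x}"
  have "0 \<in> {t \<in> {0..1}. ?g t = x}" using x by simp
  moreover have bdd: "bdd_above {t \<in> {0..1}. ?g t = x}" by (rule bdd_aboveI [of _ 1]) auto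
  ultimately have "e \<in> {t \<in> {0..1}. ?g t = x}"
    unfolding e_def using closed_g g by (intro closed_contains_Sup) blast+
  then have e: "e \<in> {0..1}" "?g e = x" by auto
  have after: "standard_at A t" if "e < t" "t \<le> 1" for t
  proof (rule std)
    show "t \<in> {0..1}" using that e by auto
    show "?g t \<noteq> x"
    proof
      assume "?g t = x"
      with \<open>t \<in> {0..1}\<close> have "t \<le> e" unfolding e_def using bdd by (intro cSup_upper) auto
      with that show False by simp
    qed
  qed
  let ?B = "A \<circ> linepath 0 e"
  have B: "path_lift x0 ?B" using e by (intro path_lift_subarc [OF A]) auto
  define T where "T = {t \<in> {0..1}. trace ?B t = x}"
  have lp: "linepath 0 e t = e * t" for t by (simp add: linepath_def)
  have "step (?B 0) (trace ?B) (?B 1)"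
  proof (rule telescope [OF cp, where T = T and x = x and b = x0 and P = ?B])
    show "path_in X (trace ?B)" by (rule path_in_trace [OF B])
    then show "closed T" unfolding T_def by (intro closed_g) auto
    show "0 \<in> T" "1 \<in> T" using x e by (auto simp: T_def lp)
    show "path_in X (?B t) \<and> pathstart (?B t) = x0 \<and> pathfinish (?B t) = x" if "t \<in> T" for t
      using that path_liftD [OF B, of t] by (auto simp: T_def)
    show "\<exists>\<eta>>0. \<forall>s\<in>T. dist s t < \<eta> \<longrightarrow> (\<exists>\<epsilon>. path_image \<epsilon> \<subseteq> ball x \<rho> \<and> step (?B t) \<epsilon> (?B s))"
      if "t \<in> T" "0 < \<rho>" for t \<rho>
      using that path_liftD(3) [OF B, of t \<rho>] by (fastforce simp: T_def)
    fix u v assume uv: "u \<in> T" "v \<in> T" "u < v" "T \<inter> {u<..<v} = {}"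
    then have uv01: "u \<in> {0..1}" "v \<in> {0..1}" by (auto simp: T_def)
    let ?C = "?B \<circ> linepath u v"
    have C: "path_lift x0 ?C" by (rule path_lift_subarc [OF B uv01])
    have "standard_at ?C t" if t: "0 < t" "t < 1" for t
    proof -
      have "linepath u v t = u + t * (v - u)" by (simp add: linepath_def algebra_simps)
      moreover have "0 < t * (v - u)" "t * (v - u) < 1 * (v - u)"
        using t uv by (auto intro: mult_strict_right_mono)
      ultimately have in_uv: "linepath u v t \<in> {u<..<v}" by auto
      then have "linepath u v t \<in> {0..1}" using uv01 by auto
      then have "trace ?B (linepath u v t) \<noteq> x" using in_uv uv(4) by (auto simp: T_def)
      moreover have "linepath 0 e (linepath u v t) \<in> {0..1}"
        using e \<open>linepath u v t \<in> {0..1}\<close> linepath_01 [of 0 e "linepath u v t"] by simp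
      ultimately have "standard_at A (linepath 0 e (linepath u v t))"
        by (intro std) auto
      then show ?thesis
        using e uv01 t \<open>linepath u v t \<in> {0..1}\<close> standard_at_subarc [of "?B" u v t]
          standard_at_subarc [of A 0 e "linepath u v t"] by simp
    qed
    then have "step (?C 0) (trace ?C) (?C 1)" by (rule standard_across [OF cp C])
    moreover have "trace ?C = subarc (trace ?B) u v" by auto
    ultimately show "step (?B u) (subarc (trace ?B) u v) (?B v)"
      by (simp add: linepath_def)
  qed (auto simp: T_def)
  moreover have "trace ?B = subarc ?g 0 e" by auto
  ultimately have 1: "step (A 0) (subarc ?g 0 e) (A e)"
    by (simp add: linepath_def)
  show ?thesis
  proof (cases "e = 1")
    case True
    with 1 show ?thesis by (simp only: subarc_0_1)
  next
    case False
    with e have "e < 1" by auto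
    let ?D = "A \<circ> linepath e 1"
    have "standard_at ?D t" if t: "0 < t" "t < 1" for t
    proof (rule standard_at_subarc [OF after])
      have "linepath e 1 t = e + t * (1 - e)" by (simp add: linepath_def algebra_simps)
      moreover have "0 < t * (1 - e)" "t * (1 - e) < 1 * (1 - e)"
        using t \<open>e < 1\<close> by (auto intro: mult_strict_right_mono)
      ultimately show "e < linepath e 1 t" "linepath e 1 t \<le> 1" by auto
    qed (use e t in auto)
    then have "step (?D 0) (trace ?D) (?D 1)"
      using e by (intro standard_across [OF cp path_lift_subarc [OF A]]) auto
    moreover have "trace ?D = subarc ?g e 1" by auto
    ultimately have "step (A e) (subarc ?g e 1) (A 1)" by (simp add: linepath_def)
    then have "step (A 0) (subarc ?g 0 1) (A 1)"
      using step_subarc [OF 1 g, of 1 "A 1"] e by auto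
    then show ?thesis by (simp only: subarc_0_1)
  qed
qed

text \<open>
  Over a point with a ball in which all loops at that point are trivial, a lift has no choice but to follow its
  trace.  Near a point of \<open>W\<close> the trace meets no other point of \<open>W\<close>, so that the preceding lemma applies.  Being
  standard everywhere locally, the lift is standard.
\<close>

theorem cantor_products_imp_unique_lifts:
  assumes cp: cantor_products
    and trivial: "\<And>x. x \<in> X - W \<Longrightarrow> \<exists>\<rho>>0. \<forall>q. path_in X q \<longrightarrow> path_image q \<subseteq> ball x \<rho> \<longrightarrow>
        pathstart q = x \<longrightarrow> pathfinish q = x \<longrightarrow> q \<simeq> (\<lambda>_. x)"
    and isolated: "\<And>x. x \<in> W \<Longrightarrow> \<exists>\<rho>>0. W \<inter> ball x \<rho> \<subseteq> {x}"
  shows "unique_lifts x0"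
  unfolding unique_lifts_def
proof (intro allI impI)
  fix A assume A: "path_lift x0 A"
  let ?g = "trace A"
  note g = path_in_trace [OF A]
  have gX: "?g t \<in> X" if "t \<in> {0..1}" for t
    using that g by (auto simp: path_image_def)
  have std_off: "standard_at A t" if t: "t \<in> {0..1}" and "?g t \<notin> W" for t
  proof -
    obtain \<rho> where \<rho>: "\<rho> > 0" "\<And>q. path_in X q \<Longrightarrow> path_image q \<subseteq> ball (?g t) \<rho> \<Longrightarrow>
        pathstart q = ?g t \<Longrightarrow> pathfinish q = ?g t \<Longrightarrow> q \<simeq> (\<lambda>_. ?g t)"
      using trivial [of "?g t"] gX [OF t] \<open>?g t \<notin> W\<close> by blast
    obtain \<eta> where \<eta>: "\<eta> > 0" "\<And>s. s \<in> {0..1} \<Longrightarrow> dist s t < \<eta> \<Longrightarrow>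
       ?g s \<in> ball (?g t) \<rho> \<and> (\<exists>\<epsilon>. path_image \<epsilon> \<subseteq> ball (?g t) \<rho> \<and> step (A t) \<epsilon> (A s))"
      using trace_close [OF A t \<rho>(1)] by blast
    have "step (A t) (subarc ?g t s) (A s)" if s: "s \<in> {0..1}" "dist s t < \<eta>" for s
    proof -
      obtain \<epsilon> where \<epsilon>: "path_image \<epsilon> \<subseteq> ball (?g t) \<rho>" "step (A t) \<epsilon> (A s)"
        using \<eta>(2) [OF s] by blast
      note \<epsilon>' = step_paths [OF \<epsilon>(2)]
      have "path_image (subarc ?g s t) \<subseteq> ball (?g t) \<rho>"
      proof -
        have "u \<in> {0..1}" "dist u t < \<eta>" if "u \<in> closed_segment s t" for u
          using that s t by (auto simp: closed_segment_eq_real_ivl dist_real_def split: if_splits)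
        then show ?thesis unfolding path_image_subarc using \<eta>(2) by blast
      qed
      then have "\<epsilon> +++ subarc ?g s t \<simeq> (\<lambda>_. ?g t)"
        using \<epsilon> \<epsilon>' path_in_subarc [OF g s(1) t]
        by (intro \<rho>(2)) (auto simp: path_image_join pathstart_compose pathfinish_compose)
      then have "step \<epsilon> (subarc ?g s t) (\<lambda>_. ?g t)"
        using \<epsilon>' by (simp add: step_def pathstart_compose)
      then have "step (\<lambda>_. ?g t) (subarc ?g t s) \<epsilon>" by (simp only: step_subarc_reverse)
      moreover have "(\<lambda>_. ?g t) +++ subarc ?g t s \<simeq> subarc ?g t s"
        using path_in_subarc [OF g t s(1)] by (intro const_left) (auto simp: pathstart_compose)
      ultimately have "\<epsilon> \<simeq> subarc ?g t s"
        unfolding step_def using sym trans by blast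
      then show ?thesis using \<epsilon>(2) step_cong2 by blast
    qed
    then show ?thesis using \<eta>(1) unfolding standard_at_def by blast
  qed
  have "standard_at A t" if t: "t \<in> {0..1}" for t
  proof (cases "?g t \<in> W")
    case False
    with t show ?thesis by (rule std_off)
  next
    case True
    then obtain \<rho> where \<rho>: "\<rho> > 0" "W \<inter> ball (?g t) \<rho> \<subseteq> {?g t}" using isolated by blast
    obtain \<eta> where \<eta>: "\<eta> > 0" "\<And>s. s \<in> {0..1} \<Longrightarrow> dist s t < \<eta> \<Longrightarrow> ?g s \<in> ball (?g t) \<rho>"
      using trace_close [OF A t \<rho>(1)] by metis
    have "step (A t) (subarc ?g t s) (A s)" if s: "s \<in> {0..1}" "dist s t < \<eta>" for s
    proof -
      let ?B = "A \<circ> linepath t s"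
      have "step (?B 0) (trace ?B) (?B 1)"
      proof (rule standard_through_point [OF cp path_lift_subarc [OF A t s(1)]])
        fix u :: real assume u: "u \<in> {0..1}" and "trace ?B u \<noteq> ?g t"
        then have ne: "?g (linepath t s u) \<noteq> ?g t" by simp
        have "linepath t s u \<in> closed_segment t s" using u by (rule linepath_in_segment)
        then have "dist (linepath t s u) t < \<eta>"
          using s(2) by (auto simp: closed_segment_eq_real_ivl dist_real_def split: if_splits)
        then have "?g (linepath t s u) \<in> ball (?g t) \<rho>"
          using linepath_01 [OF t s(1) u] by (rule \<eta>(2) [rotated])
        then have "?g (linepath t s u) \<notin> W" using \<rho>(2) ne by blast
        then show "standard_at ?B u"
          using std_off [OF linepath_01 [OF t s(1) u]] by (intro standard_at_subarc t s(1) u)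
      qed (simp add: linepath_def)
      moreover have "trace ?B = subarc ?g t s" by auto
      ultimately show ?thesis by (simp add: linepath_def)
    qed
    then show ?thesis using \<eta>(1) unfolding standard_at_def by blast
  qed
  then have "step (A 0) (subarc ?g 0 1) (A 1)"
    by (intro standard_interval [OF A, of "{0..1}"]) auto
  then show "step (A 0) ?g (A 1)" by (simp only: subarc_0_1)
qed

end

section \<open>Paths modulo a subgroup of the fundamental group\<close>

abbreviation loop_in :: "'a::topological_space set \<Rightarrow> 'a \<Rightarrow> (real \<Rightarrow> 'a) \<Rightarrow> bool" where
  "loop_in X x p \<equiv> path_in X p \<and> pathstart p = x \<and> pathfinish p = x"

lemma carrier_fundamental_group: "c \<in> carrier (fundamental_group X x0) \<longleftrightarrow> (\<exists>p. loop_in X x0 p \<and> c = path_class X p)"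
  by (auto simp: fundamental_group_def)

lemma path_class_in_carrier: "loop_in X x0 p \<Longrightarrow> path_class X p \<in> carrier (fundamental_group X x0)"
  by (auto simp: carrier_fundamental_group)

lemma one_fundamental_group: "\<one>\<^bsub>fundamental_group X x0\<^esub> = path_class X (\<lambda>_. x0)"
  by (simp add: fundamental_group_def)

lemma inv_path_class:
  assumes "loop_in X x0 p"
  shows "inv\<^bsub>fundamental_group X x0\<^esub> path_class X p = path_class X (reversepath p)"
proof -
  have "x0 \<in> X" using assms by (metis pathstart_in_path_image subsetD)
  then interpret group "fundamental_group X x0" by (rule group_fundamental_group)
  have "homotopic_paths X (reversepath p +++ p) (\<lambda>_. x0)"
    using assms homotopic_paths_inverse_right [of "reversepath p" X] by simp
  then have "path_class X (reversepath p) \<otimes>\<^bsub>fundamental_group X x0\<^esub> path_class X p = \<one>\<^bsub>fundamental_group X x0\<^esub>"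
    using assms by (simp add: fundamental_group_mult one_fundamental_group path_class_eq_iff path_image_join)
  then show ?thesis
    using assms by (intro inv_equality) (auto simp: path_class_in_carrier)
qed

text \<open>
  Paths anywhere in \<open>X\<close> are compared by means of all ways \<open>d\<close> to reach their common start from \<open>x0\<close>.  Asking for
  all of them, and not for one, makes the relation compatible with concatenation.
\<close>

definition cong_mod :: "'a::topological_space set \<Rightarrow> 'a \<Rightarrow> (real \<Rightarrow> 'a) set set \<Rightarrow> (real \<Rightarrow> 'a) \<Rightarrow> (real \<Rightarrow> 'a) \<Rightarrow> bool" where
  "cong_mod X x0 K p q \<longleftrightarrow> path_in X p \<and> path_in X q \<and> pathstart p = pathstart q \<and> pathfinish p = pathfinish q \<and>
     (\<forall>d. path_in X d \<longrightarrow> pathstart d = x0 \<longrightarrow> pathfinish d = pathstart p \<longrightarrow>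
        path_class X ((d +++ p) +++ reversepath (d +++ q)) \<in> K)"

context
  fixes X :: "'a::topological_space set" and x0 :: 'a and K :: "(real \<Rightarrow> 'a) set set"
  assumes x0: "x0 \<in> X" and K: "subgroup K (fundamental_group X x0)"
begin

interpretation G: group "fundamental_group X x0"
  using x0 by (rule group_fundamental_group)

interpretation h: path_congruence X "homotopic_paths X"
  by (rule path_congruence_homotopic_paths)

lemma step_from_base:
  "path_in X a \<Longrightarrow> pathstart a = x0 \<Longrightarrow> h.step (\<lambda>_. x0) a a"
  by (simp add: h.step_def h.const_left)

lemma same_coset_trans:
  assumes "path_in X a" "path_in X b" "path_in X c" "pathstart a = x0" "pathstart b = x0" "pathstart c = x0"
    "pathfinish a = pathfinish b" "pathfinish b = pathfinish c"
    "path_class X (a +++ reversepath b) \<in> K" "path_class X (b +++ reversepath c) \<in> K"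
  shows "path_class X (a +++ reversepath c) \<in> K"
proof -
  have loops: "path_in X (a +++ reversepath b)" "path_in X (a +++ reversepath c)" "path_in X (b +++ reversepath c)"
    using assms(1-8) by (intro path_in_join; simp)+
  have "h.step (a +++ reversepath b) b a"
    using assms(1-8) h.step_reverse [OF h.step_self [OF loops(1)]] by simp
  moreover have "h.step a (reversepath c) (a +++ reversepath c)"
    using assms(1-8) loops by (intro h.step_self) auto
  moreover have "h.step (\<lambda>_. x0) (a +++ reversepath b) (a +++ reversepath b)"
    using loops assms(1-8) by (intro step_from_base) auto
  ultimately have "h.step (\<lambda>_. x0) ((a +++ reversepath b) +++ (b +++ reversepath c)) (a +++ reversepath c)"
    by (blast intro: h.step_join)
  moreover have "h.step (\<lambda>_. x0) (a +++ reversepath c) (a +++ reversepath c)"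
    using loops assms(1-8) by (intro step_from_base) auto
  ultimately have "homotopic_paths X ((a +++ reversepath b) +++ (b +++ reversepath c)) (a +++ reversepath c)"
    by (rule h.step_unique)
  moreover have "path_class X ((a +++ reversepath b) +++ (b +++ reversepath c)) \<in> K"
    using subgroup.m_closed [OF K assms(9,10)] loops assms(1-8) by (simp add: fundamental_group_mult)
  ultimately show ?thesis
    using path_class_eq_iff h.paths by metis
qed

lemma same_coset_sym:
  assumes "path_in X a" "path_in X b" "pathstart a = x0" "pathstart b = x0" "pathfinish a = pathfinish b"
    "path_class X (a +++ reversepath b) \<in> K"
  shows "path_class X (b +++ reversepath a) \<in> K"
proof -
  have "loop_in X x0 (a +++ reversepath b)" using assms by (simp add: path_image_join)
  then have "path_class X (reversepath (a +++ reversepath b)) \<in> K"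
    using subgroup.m_inv_closed [OF K assms(6)] by (simp add: inv_path_class)
  then show ?thesis using assms by (simp add: reversepath_joinpaths)
qed

lemma same_coset_homotopic:
  assumes "homotopic_paths X a b" "pathstart a = x0"
  shows "path_class X (a +++ reversepath b) \<in> K"
proof -
  note * = h.paths [OF assms(1)] h.ends [OF assms(1)]
  have "homotopic_paths X (a +++ reversepath b) (b +++ reversepath b)"
    using assms * by (intro homotopic_paths_join) auto
  also have "homotopic_paths X (b +++ reversepath b) (\<lambda>_. x0)"
    using h.inverse_right [of b] assms * by simp
  finally have "path_class X (a +++ reversepath b) = \<one>\<^bsub>fundamental_group X x0\<^esub>"
    using h.paths by (metis one_fundamental_group path_class_eq_iff)
  then show ?thesis using subgroup.one_closed [OF K] by simp
qed

lemma same_coset_append: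
  assumes "path_in X a" "path_in X b" "path_in X c" "pathstart a = x0" "pathstart b = x0"
    "pathfinish a = pathfinish b" "pathfinish b = pathstart c" "path_class X (a +++ reversepath b) \<in> K"
  shows "path_class X ((a +++ c) +++ reversepath (b +++ c)) \<in> K"
proof -
  have loops: "path_in X (a +++ reversepath b)" "path_in X (a +++ c)" "path_in X (reversepath b)"
    using assms(1-7) by (intro path_in_join; simp)+ (use assms in simp)
  have 1: "h.step (\<lambda>_. x0) (a +++ c) (a +++ c)"
    using loops assms by (intro step_from_base) auto
  have 2: "h.step (a +++ c) (reversepath c) a"
    using loops assms by (intro h.step_reverse h.step_self) auto
  have 3: "h.step a (reversepath b) (a +++ reversepath b)"
    using loops assms by (intro h.step_self) auto
  have "h.step (\<lambda>_. x0) ((a +++ c) +++ (reversepath c +++ reversepath b)) (a +++ reversepath b)"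
    by (intro h.step_join [OF 1] h.step_join [OF 2] 3)
  moreover have "h.step (\<lambda>_. x0) (a +++ reversepath b) (a +++ reversepath b)"
    using loops assms by (intro step_from_base) auto
  ultimately have "homotopic_paths X ((a +++ c) +++ (reversepath c +++ reversepath b)) (a +++ reversepath b)"
    by (rule h.step_unique)
  then have "path_class X ((a +++ c) +++ reversepath (b +++ c)) = path_class X (a +++ reversepath b)"
    using h.paths assms by (metis path_class_eq_iff reversepath_joinpaths)
  then show ?thesis using assms by simp
qed

text \<open>
  For concatenations, change the second factor first, which is a comparison along the longer approach path
  \<open>d +++ p\<close>, and then the first factor, whose common continuation cancels.
\<close>

lemma path_congruence_cong_mod: "path_congruence X (cong_mod X x0 K)"
proof
  fix p q
  show "cong_mod X x0 K p q \<Longrightarrow> path_in X p \<and> path_in X q"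
    and "cong_mod X x0 K p q \<Longrightarrow> pathstart p = pathstart q \<and> pathfinish p = pathfinish q"
    by (simp_all add: cong_mod_def)
  show "cong_mod X x0 K p q" if "homotopic_paths X p q"
    unfolding cong_mod_def
    using that h.paths [OF that] h.ends [OF that]
    by (auto intro!: same_coset_homotopic h.join)
  show "cong_mod X x0 K q p" if "cong_mod X x0 K p q"
  proof -
    have "path_class X ((d +++ q) +++ reversepath (d +++ p)) \<in> K"
      if "path_in X d" "pathstart d = x0" "pathfinish d = pathstart q" for d
      using that \<open>cong_mod X x0 K p q\<close> unfolding cong_mod_def
      by (intro same_coset_sym [of "d +++ p" "d +++ q"]) (auto simp: path_image_join)
    then show ?thesis using that by (simp add: cong_mod_def)
  qed
  show "cong_mod X x0 K p r" if "cong_mod X x0 K p q" "cong_mod X x0 K q r" for r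
  proof -
    have "path_class X ((d +++ p) +++ reversepath (d +++ r)) \<in> K"
      if "path_in X d" "pathstart d = x0" "pathfinish d = pathstart p" for d
      using that \<open>cong_mod X x0 K p q\<close> \<open>cong_mod X x0 K q r\<close> unfolding cong_mod_def
      by (intro same_coset_trans [of "d +++ p" "d +++ q" "d +++ r"]) (auto simp: path_image_join)
    then show ?thesis using that by (simp add: cong_mod_def)
  qed
  show "cong_mod X x0 K (p +++ q) (p' +++ q')"
    if "cong_mod X x0 K p p'" "cong_mod X x0 K q q'" and e: "pathfinish p = pathstart q" for p' q'
  proof -
    have p: "path_in X p" "path_in X p'" "pathstart p = pathstart p'" "pathfinish p = pathfinish p'"
      and q: "path_in X q" "path_in X q'" "pathstart q = pathstart q'" "pathfinish q = pathfinish q'"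
      using that by (auto simp: cong_mod_def)
    have "path_class X ((d +++ (p +++ q)) +++ reversepath (d +++ (p' +++ q'))) \<in> K"
      if d: "path_in X d" "pathstart d = x0" "pathfinish d = pathstart p" for d
    proof -
      have paths: "path_in X (d +++ p)" "path_in X (d +++ p')"
        "path_in X ((d +++ p) +++ q)" "path_in X ((d +++ p) +++ q')" "path_in X ((d +++ p') +++ q')"
        "path_in X (d +++ (p +++ q))" "path_in X (d +++ (p' +++ q'))"
        using d p q e by (auto simp: path_image_join)
      have "path_class X ((d +++ (p +++ q)) +++ reversepath ((d +++ p) +++ q)) \<in> K"
        using d p q e by (intro same_coset_homotopic homotopic_paths_assoc) auto
      moreover have "path_class X (((d +++ p) +++ q) +++ reversepath ((d +++ p) +++ q')) \<in> K"
        using \<open>cong_mod X x0 K q q'\<close> paths d e by (auto simp: cong_mod_def)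
      moreover have "path_class X (((d +++ p) +++ q') +++ reversepath ((d +++ p') +++ q')) \<in> K"
        using \<open>cong_mod X x0 K p p'\<close> paths d e p q by (intro same_coset_append) (auto simp: cong_mod_def)
      moreover have "path_class X (((d +++ p') +++ q') +++ reversepath (d +++ (p' +++ q'))) \<in> K"
        using d p q e by (intro same_coset_homotopic h.assoc) auto
      ultimately show ?thesis
        using same_coset_trans [of "d +++ (p +++ q)" "(d +++ p) +++ q" "(d +++ p) +++ q'"]
          same_coset_trans [of "d +++ (p +++ q)" "(d +++ p) +++ q'" "(d +++ p') +++ q'"]
          same_coset_trans [of "d +++ (p +++ q)" "(d +++ p') +++ q'" "d +++ (p' +++ q')"]
          paths d p q e by simp
    qed
    then show ?thesis
      using p q e by (simp add: cong_mod_def path_image_join)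
  qed
qed

end

text \<open>A different approach path conjugates the element to be tested, and normality absorbs this.\<close>

lemma cong_mod_iff_normal:
  assumes x0: "x0 \<in> X" and K: "K \<lhd> fundamental_group X x0"
    and "path_in X a" "path_in X b" "pathstart a = x0" "pathstart b = x0" "pathfinish a = pathfinish b"
  shows "cong_mod X x0 K a b \<longleftrightarrow> path_class X (a +++ reversepath b) \<in> K"
proof
  have sub: "subgroup K (fundamental_group X x0)" using K by (rule normal_imp_subgroup)
  interpret h: path_congruence X "homotopic_paths X" by (rule path_congruence_homotopic_paths)
  note base = step_from_base [OF x0 sub]
  {
    fix d assume d: "path_in X d" "pathstart d = x0" "pathfinish d = x0"
    have loops: "path_in X (d +++ a)" "path_in X (d +++ b)" "path_in X (a +++ reversepath b)" "path_in X (d +++ (a +++ reversepath b))"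
      using assms d by (auto simp: path_image_join)
    have 1: "h.step (\<lambda>_. x0) d d" using d base by blast
    have 2: "h.step d (a +++ reversepath b) (d +++ (a +++ reversepath b))"
      using loops d assms by (intro h.step_self) auto
    have 3: "h.step (d +++ (a +++ reversepath b)) (reversepath d) ((d +++ (a +++ reversepath b)) +++ reversepath d)"
      using loops d assms by (intro h.step_self path_in_join) auto
    have 4: "h.step d a (d +++ a)" using loops d assms by (intro h.step_self) auto
    have 5: "h.step (d +++ a) (reversepath b) (d +++ (a +++ reversepath b))"
    proof -
      have "path_in X ((d +++ a) +++ reversepath b)" using loops d assms by (intro path_in_join) auto
      then have "h.step (d +++ a) (reversepath b) ((d +++ a) +++ reversepath b)"
        using assms by (intro h.step_self) auto
      from h.step_target [OF h.step_join [OF 4 this] 2] this show ?thesis by (rule h.step_cong3 [rotated])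
    qed
    have "h.step (\<lambda>_. x0) ((d +++ a) +++ (reversepath b +++ reversepath d)) ((d +++ (a +++ reversepath b)) +++ reversepath d)"
      by (intro h.step_join [OF h.step_join [OF 1 4]] h.step_join [OF 5] 3)
    moreover have "h.step (\<lambda>_. x0) ((d +++ (a +++ reversepath b)) +++ reversepath d) ((d +++ (a +++ reversepath b)) +++ reversepath d)"
      by (intro h.step_join [OF h.step_join [OF 1 2]] 3)
    ultimately have "homotopic_paths X ((d +++ a) +++ (reversepath b +++ reversepath d)) ((d +++ (a +++ reversepath b)) +++ reversepath d)"
      by (rule h.step_unique)
    moreover have "reversepath (d +++ b) = reversepath b +++ reversepath d"
      using d assms by (simp add: reversepath_joinpaths)
    ultimately have "path_class X ((d +++ a) +++ reversepath (d +++ b)) = path_class X ((d +++ (a +++ reversepath b)) +++ reversepath d)"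
      using h.paths by (metis path_class_eq_iff)
    also have "\<dots> = path_class X d \<otimes>\<^bsub>fundamental_group X x0\<^esub> path_class X (a +++ reversepath b)
        \<otimes>\<^bsub>fundamental_group X x0\<^esub> inv\<^bsub>fundamental_group X x0\<^esub> path_class X d"
      using d loops assms by (simp add: inv_path_class fundamental_group_mult)
    finally have "path_class X ((d +++ a) +++ reversepath (d +++ b)) = path_class X d \<otimes>\<^bsub>fundamental_group X x0\<^esub> path_class X (a +++ reversepath b)
        \<otimes>\<^bsub>fundamental_group X x0\<^esub> inv\<^bsub>fundamental_group X x0\<^esub> path_class X d" .
  } note conj = this
  show "cong_mod X x0 K a b" if "path_class X (a +++ reversepath b) \<in> K"
  proof -
    have "path_class X ((d +++ a) +++ reversepath (d +++ b)) \<in> K"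
      if "path_in X d" "pathstart d = x0" "pathfinish d = x0" for d
      unfolding conj [OF that] using that \<open>path_class X (a +++ reversepath b) \<in> K\<close>
      by (intro normal.inv_op_closed2 [OF K]) (auto simp: path_class_in_carrier)
    then show ?thesis using assms by (simp add: cong_mod_def)
  qed
  show "path_class X (a +++ reversepath b) \<in> K" if "cong_mod X x0 K a b"
  proof -
    let ?c = "\<lambda>_::real. x0"
    have "path_in X ?c" using x0 by (rule path_in_const)
    then have "path_class X ((?c +++ a) +++ reversepath (?c +++ b)) \<in> K"
      using that assms unfolding cong_mod_def by simp
    moreover have "homotopic_paths X ((?c +++ a) +++ reversepath (?c +++ b)) (a +++ reversepath b)"
      using assms by (intro h.join h.reverse_cong h.const_left) auto
    ultimately show ?thesis using h.paths by (metis path_class_eq_iff)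
  qed
qed

section \<open>Unique path lifting\<close>

locale path_classes =
  fixes X :: "'a::metric_space set" and x0 :: 'a and K :: "(real \<Rightarrow> 'a) set set"
  assumes x0: "x0 \<in> X" and K: "K \<lhd> fundamental_group X x0"
begin

abbreviation cong (infix "\<simeq>" 50) where "cong \<equiv> cong_mod X x0 K"

lemma subgroup_K: "subgroup K (fundamental_group X x0)"
  using K by (rule normal_imp_subgroup)

sublocale metric_path_congruence X "cong_mod X x0 K"
  by (intro metric_path_congruence.intro path_congruence_cong_mod x0 subgroup_K)

abbreviation cls where "cls \<equiv> coset_class X x0 K"

lemma mem_cls:
  assumes "path_in X a" "pathstart a = x0"
  shows "b \<in> cls a \<longleftrightarrow> a \<simeq> b"
proof
  assume "b \<in> cls a"
  then show "a \<simeq> b"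
    using assms cong_mod_iff_normal [OF x0 K, of a b] unfolding coset_class_def by blast
next
  assume "a \<simeq> b"
  then have b: "path_in X b" "pathstart b = x0" "pathfinish a = pathfinish b"
    using assms(2) paths [of a b] ends [of a b] by metis+
  then show "b \<in> cls a"
    using cong_mod_iff_normal [OF x0 K assms(1) b(1) assms(2) b(2,3)] \<open>a \<simeq> b\<close>
    unfolding coset_class_def by blast
qed

lemma cls_eq:
  assumes "path_in X a" "pathstart a = x0" "path_in X b" "pathstart b = x0"
  shows "cls a = cls b \<longleftrightarrow> a \<simeq> b"
proof
  assume "cls a = cls b"
  moreover have "b \<in> cls b" using mem_cls [OF assms(3,4)] refl assms(3) by simp
  ultimately show "a \<simeq> b" using mem_cls [OF assms(1,2)] by simp
next
  assume "a \<simeq> b"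
  then have "a \<simeq> c \<longleftrightarrow> b \<simeq> c" for c using sym [of a b] trans [of a b c] trans [of b a c] by blast
  then show "cls a = cls b" using mem_cls [OF assms(1,2)] mem_cls [OF assms(3,4)] by blast
qed

lemma end_proj_cls: "path_in X a \<Longrightarrow> pathstart a = x0 \<Longrightarrow> end_proj (cls a) = pathfinish a"
  using end_proj_coset_class [OF x0 subgroup_K] by blast

lemma mem_coset_nbhd:
  assumes "path_in X a" "pathstart a = x0" "path_in X b" "pathstart b = x0"
    "U \<subseteq> X"
  shows "cls b \<in> coset_nbhd X x0 K a U \<longleftrightarrow> (\<exists>\<epsilon>. path_image \<epsilon> \<subseteq> U \<and> step a \<epsilon> b)"
proof
  assume "cls b \<in> coset_nbhd X x0 K a U"
  then obtain \<epsilon> where \<epsilon>: "cls b = cls (a +++ \<epsilon>)" "path \<epsilon>" "path_image \<epsilon> \<subseteq> U" "pathstart \<epsilon> = pathfinish a"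
    unfolding coset_nbhd_def by blast
  then have "path_in X (a +++ \<epsilon>)" using assms by (auto simp: path_image_join)
  then have "b \<simeq> a +++ \<epsilon>" using cls_eq \<epsilon>(1) assms by simp
  then have "step a \<epsilon> b" using \<epsilon>(4) sym by (simp add: step_def)
  then show "\<exists>\<epsilon>. path_image \<epsilon> \<subseteq> U \<and> step a \<epsilon> b" using \<epsilon>(3) by blast
next
  assume "\<exists>\<epsilon>. path_image \<epsilon> \<subseteq> U \<and> step a \<epsilon> b"
  then obtain \<epsilon> where \<epsilon>: "path_image \<epsilon> \<subseteq> U" "step a \<epsilon> b" by blast
  then have "cls (a +++ \<epsilon>) = cls b"
    using paths [of "a +++ \<epsilon>" b] assms by (subst cls_eq) (auto simp: step_def)
  then show "cls b \<in> coset_nbhd X x0 K a U"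
    unfolding coset_nbhd_def using \<epsilon> step_paths [OF \<epsilon>(2)] by blast
qed

abbreviation tilde where "tilde \<equiv> tilde_space X x0 K"

lemma topspace_tilde: "topspace tilde \<subseteq> cls ` {a. path_in X a \<and> pathstart a = x0}"
proof -
  have "coset_nbhd X x0 K a U \<subseteq> cls ` {a. path_in X a \<and> pathstart a = x0}"
    if "path_in X a" "pathstart a = x0" "openin (top_of_set X) U" for a U
  proof
    fix c assume "c \<in> coset_nbhd X x0 K a U"
    then obtain \<epsilon> where "c = cls (a +++ \<epsilon>)" "path \<epsilon>" "path_image \<epsilon> \<subseteq> U" "pathstart \<epsilon> = pathfinish a"
      unfolding coset_nbhd_def by blast
    moreover from this have "path_in X (a +++ \<epsilon>)"
      using that openin_imp_subset [OF that(3)] by (intro path_in_join) auto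
    ultimately show "c \<in> cls ` {a. path_in X a \<and> pathstart a = x0}"
      using that by auto
  qed
  then show ?thesis
    unfolding tilde_space_def topology_generated_by_topspace by blast
qed

lemma pathin_tilde_of_lift:
  assumes A: "path_lift x0 A"
  shows "pathin tilde (\<lambda>t. cls (A t))"
  unfolding pathin_def tilde_space_def continuous_on_generated_topo_iff
proof (intro conjI allI impI)
  note AD = path_liftD [OF A]
  fix W assume "W \<in> {coset_nbhd X x0 K \<alpha> U | \<alpha> U. path \<alpha> \<and> path_image \<alpha> \<subseteq> X \<and> pathstart \<alpha> = x0 \<and>
     openin (top_of_set X) U \<and> pathfinish \<alpha> \<in> U}"
  then obtain a U where W: "W = coset_nbhd X x0 K a U" and a: "path_in X a" "pathstart a = x0"
    and U: "openin (top_of_set X) U" by blast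
  have UX: "U \<subseteq> X" using U by (rule openin_imp_subset)
  have "openin (top_of_set {0..1}) {t \<in> {0..1}. cls (A t) \<in> W}"
    unfolding openin_euclidean_subtopology_iff
  proof (intro conjI ballI)
    fix t assume "t \<in> {t \<in> {0..1}. cls (A t) \<in> W}"
    then have t: "t \<in> {0..1}" and "cls (A t) \<in> W" by auto
    then obtain \<epsilon> where \<epsilon>: "path_image \<epsilon> \<subseteq> U" "step a \<epsilon> (A t)"
      using mem_coset_nbhd [OF a AD(1,2) UX] unfolding W by blast
    then have "trace A t \<in> U"
      using step_paths [OF \<epsilon>(2)] by (metis pathfinish_in_path_image subsetD)
    then obtain \<rho> where \<rho>: "\<rho> > 0" "ball (trace A t) \<rho> \<inter> X \<subseteq> U"
      using U by (auto simp: openin_contains_ball)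
    then obtain \<eta> where \<eta>: "\<eta> > 0" "\<And>s. s \<in> {0..1} \<Longrightarrow> dist s t < \<eta> \<Longrightarrow>
        \<exists>\<epsilon>. path_image \<epsilon> \<subseteq> ball (trace A t) \<rho> \<and> step (A t) \<epsilon> (A s)"
      using AD(3) [OF t] by blast
    have "cls (A s) \<in> W" if s: "s \<in> {0..1}" "dist s t < \<eta>" for s
    proof -
      obtain \<epsilon>' where \<epsilon>': "path_image \<epsilon>' \<subseteq> ball (trace A t) \<rho>" "step (A t) \<epsilon>' (A s)" using \<eta>(2) [OF s] by blast
      then have "path_image \<epsilon>' \<subseteq> U" using \<rho>(2) step_paths(2) [OF \<epsilon>'(2)] by blast
      then have "path_image (\<epsilon> +++ \<epsilon>') \<subseteq> U" using \<epsilon>(1) by (intro subset_path_image_join)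
      moreover have "step a (\<epsilon> +++ \<epsilon>') (A s)" using \<epsilon>(2) \<epsilon>'(2) by (rule step_join)
      ultimately show ?thesis
        using mem_coset_nbhd [OF a AD(1,2) UX] s(1) unfolding W by blast
    qed
    then show "\<exists>e>0. \<forall>s\<in>{0..1}. dist s t < e \<longrightarrow> s \<in> {t \<in> {0..1}. cls (A t) \<in> W}"
      using \<eta>(1) by blast
  qed auto
  moreover have "(\<lambda>t. cls (A t)) -` W \<inter> topspace (top_of_set {0..1}) = {t \<in> {0..1}. cls (A t) \<in> W}"
    by auto
  ultimately show "openin (top_of_set {0..1}) ((\<lambda>t. cls (A t)) -` W \<inter> topspace (top_of_set {0..1}))"
    by simp
next
  note AD = path_liftD [OF A]
  have "cls (A t) \<in> coset_nbhd X x0 K (A t) X" if "t \<in> {0..1}" for t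
    using AD(1,2) [OF that] mem_coset_nbhd [of "A t" "A t" X] step_refl [of "A t" "trace A t"] step_paths(2) by blast
  moreover have "trace A t \<in> X" if "t \<in> {0..1}" for t
    using AD(1) [OF that] pathfinish_in_path_image by blast
  ultimately show "(\<lambda>t. cls (A t)) ` topspace (top_of_set {0..1}) \<subseteq>
     \<Union> {coset_nbhd X x0 K \<alpha> U | \<alpha> U. path \<alpha> \<and> path_image \<alpha> \<subseteq> X \<and> pathstart \<alpha> = x0 \<and>
     openin (top_of_set X) U \<and> pathfinish \<alpha> \<in> U}"
    using AD(1,2) openin_subtopology_self [of X] by fastforce
qed

lemma lift_of_pathin_tilde:
  assumes \<alpha>: "pathin tilde \<alpha>"
  obtains A where "path_lift x0 A" "\<And>t. t \<in> {0..1} \<Longrightarrow> \<alpha> t = cls (A t)"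
proof -
  have cont: "continuous_map (top_of_set {0..1}) tilde \<alpha>" using \<alpha> by (simp add: pathin_def)
  have "\<exists>a. path_in X a \<and> pathstart a = x0 \<and> \<alpha> t = cls a" if "t \<in> {0..1}" for t
  proof -
    have "\<alpha> t \<in> topspace tilde"
      using continuous_map_image_subset_topspace [OF cont] that by auto
    then show ?thesis using topspace_tilde by blast
  qed
  then obtain A where A: "\<And>t. t \<in> {0..1} \<Longrightarrow> path_in X (A t) \<and> pathstart (A t) = x0 \<and> \<alpha> t = cls (A t)"
    by metis
  have "path_lift x0 A"
    unfolding path_lift_def
  proof (intro conjI ballI allI impI)
    fix t \<rho> :: real assume t: "t \<in> {0..1}" and \<rho>: "0 < \<rho>"
    let ?U = "X \<inter> ball (trace A t) \<rho>"
    have end_in: "trace A t \<in> ?U" using A [OF t] pathfinish_in_path_image \<rho> by auto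
    have "openin tilde (coset_nbhd X x0 K (A t) ?U)"
      unfolding tilde_space_def using A [OF t] end_in
      by (intro topology_generated_by_Basis) (auto intro!: exI [of _ "A t"] exI [of _ ?U] openin_open_Int)
    then have op: "openin (top_of_set {0..1}) {s \<in> topspace (top_of_set {0..1}). \<alpha> s \<in> coset_nbhd X x0 K (A t) ?U}"
      by (rule openin_continuous_map_preimage [OF cont])
    have "step (A t) (\<lambda>_. trace A t) (A t)" using A [OF t] by (simp add: step_refl)
    moreover have "path_image (\<lambda>_. trace A t) \<subseteq> ?U" using end_in by (auto simp: path_image_def)
    ultimately have "\<alpha> t \<in> coset_nbhd X x0 K (A t) ?U"
      using A [OF t] mem_coset_nbhd [of "A t" "A t" ?U] by auto
    then have "\<exists>\<eta>>0. \<forall>s\<in>{0..1}. dist s t < \<eta> \<longrightarrow> \<alpha> s \<in> coset_nbhd X x0 K (A t) ?U"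
      using op t unfolding openin_euclidean_subtopology_iff by auto
    then show "\<exists>\<eta>>0. \<forall>s\<in>{0..1}. dist s t < \<eta> \<longrightarrow> (\<exists>\<epsilon>. path_image \<epsilon> \<subseteq> ball (trace A t) \<rho> \<and> step (A t) \<epsilon> (A s))"
      using A t mem_coset_nbhd [of "A t" _ ?U] by (metis Int_lower1 Int_subset_iff)
  qed (use A in auto)
  then show thesis using A that by blast
qed

text \<open>
  Two lifts that start at the same class both agree with the standard one.  Conversely, the standard lift
  of the trace of \<open>A\<close> is a lift with the same start and the same trace as \<open>A\<close>.
\<close>

theorem unique_path_lifting_iff: "unique_path_lifting tilde end_proj \<longleftrightarrow> unique_lifts x0"
proof
  assume u: "unique_lifts x0"
  show "unique_path_lifting tilde end_proj"
    unfolding unique_path_lifting_def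
  proof (intro allI impI ballI)
    fix \<alpha> \<beta> t assume \<alpha>\<beta>: "pathin tilde \<alpha>" "pathin tilde \<beta>" "\<alpha> 0 = \<beta> 0" "\<forall>t\<in>{0..1}. end_proj (\<alpha> t) = end_proj (\<beta> t)"
      and t: "t \<in> {0..1::real}"
    obtain A where A: "path_lift x0 A" "\<And>t. t \<in> {0..1} \<Longrightarrow> \<alpha> t = cls (A t)" using lift_of_pathin_tilde \<alpha>\<beta>(1) by blast
    obtain B where B: "path_lift x0 B" "\<And>t. t \<in> {0..1} \<Longrightarrow> \<beta> t = cls (B t)" using lift_of_pathin_tilde \<alpha>\<beta>(2) by blast
    note AD = path_liftD [OF A(1)] and BD = path_liftD [OF B(1)]
    have tr: "trace A s = trace B s" if "s \<in> {0..1}" for s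
      using that \<alpha>\<beta>(4) A(2) B(2) AD(1,2) BD(1,2) by (simp add: end_proj_cls)
    have to_t: "step (C 0) (subarc (trace C) 0 t) (C t)" if "path_lift x0 C" for C
      using path_lift_subarc [OF that, of 0 t] t u unfolding unique_lifts_def
      by (force simp: comp_def linepath_def)
    have "A 0 \<simeq> B 0" using \<alpha>\<beta>(3) A(2) [of 0] B(2) [of 0] AD(1,2) [of 0] BD(1,2) [of 0] by (simp add: cls_eq)
    moreover have "subarc (trace A) 0 t \<simeq> subarc (trace B) 0 t"
      using path_in_subarc [OF path_in_trace [OF A(1)], of 0 t] t tr linepath_01 [of 0 t] by (intro eq_on) auto
    ultimately have "step (B 0) (subarc (trace B) 0 t) (A t)"
      using step_cong [OF to_t [OF A(1)]] refl [OF AD(1) [OF t]] by blast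
    then have "A t \<simeq> B t" using step_target to_t [OF B(1)] by blast
    then show "\<alpha> t = \<beta> t" using A(2) B(2) AD(1,2) BD(1,2) t by (simp add: cls_eq)
  qed
next
  assume u: "unique_path_lifting tilde end_proj"
  show "unique_lifts x0"
    unfolding unique_lifts_def
  proof (intro allI impI)
    fix A assume A: "path_lift x0 A"
    note AD = path_liftD [OF A] and g = path_in_trace [OF A]
    define S where "S t = A 0 +++ subarc (trace A) 0 t" for t
    have S: "step (A 0) (subarc (trace A) 0 t) (S t)" if "t \<in> {0..1}" for t
      unfolding S_def using that AD(1) [of 0] path_in_subarc [OF g, of 0 t]
      by (intro step_self path_in_join) (auto simp: pathstart_compose)
    have S_step: "step (S t) (subarc (trace A) t s) (S s)" if "s \<in> {0..1}" "t \<in> {0..1}" for s t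
      using step_subarc [OF S g] S that by auto
    have S_path: "path_in X (S t)" "pathstart (S t) = x0" "pathfinish (S t) = trace A t" if "t \<in> {0..1}" for t
      using step_paths [OF S [OF that]] AD(2) [of 0] by (auto simp: pathfinish_compose)
    have S_lift: "path_lift x0 S"
      unfolding path_lift_def
    proof (intro conjI ballI allI impI)
      fix t \<rho> :: real assume t: "t \<in> {0..1}" "0 < \<rho>"
      then obtain \<eta> where \<eta>: "\<eta> > 0" "\<And>s. s \<in> {0..1} \<Longrightarrow> dist s t < \<eta> \<Longrightarrow> trace A s \<in> ball (trace A t) \<rho>"
        using trace_close [OF A] by metis
      have "path_image (subarc (trace A) t s) \<subseteq> ball (trace A t) \<rho>" if "s \<in> {0..1}" "dist s t < \<eta>" for s
      proof -
        have "v \<in> {0..1}" "dist v t < \<eta>" if "v \<in> closed_segment t s" for v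
          using that \<open>s \<in> {0..1}\<close> \<open>dist s t < \<eta>\<close> t(1)
          by (auto simp: closed_segment_eq_real_ivl dist_real_def split: if_splits)
        then show ?thesis unfolding path_image_subarc using \<eta>(2) by blast
      qed
      then show "\<exists>\<eta>>0. \<forall>s\<in>{0..1}. dist s t < \<eta> \<longrightarrow> (\<exists>\<epsilon>. path_image \<epsilon> \<subseteq> ball (trace S t) \<rho> \<and> step (S t) \<epsilon> (S s))"
        using \<eta>(1) S_step t(1) unfolding S_path(3) [OF t(1)] by blast
    qed (use S_path in auto)
    have "A 0 \<simeq> S 0"
      using S [of 0] step_target [OF step_refl [of "A 0" "trace A 0"]] AD(1) [of 0] by (simp add: subarc_trivial)
    then have "cls (A 0) = cls (S 0)" using cls_eq AD(1,2) [of 0] S_path(1,2) [of 0] by simp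
    moreover have "end_proj (cls (A t)) = end_proj (cls (S t))" if "t \<in> {0..1}" for t
      using that S_path AD(1,2) by (simp add: end_proj_cls)
    ultimately have "cls (A 1) = cls (S 1)"
      using u [unfolded unique_path_lifting_def, rule_format, OF pathin_tilde_of_lift [OF A] pathin_tilde_of_lift [OF S_lift], of 1]
      by simp
    then have "S 1 \<simeq> A 1" using cls_eq AD(1,2) [of 1] S_path(1,2) [of 1] sym by simp
    then have "step (A 0) (subarc (trace A) 0 1) (A 1)" using S [of 1] step_cong3 by simp
    then show "step (A 0) (trace A) (A 1)" by (simp only: subarc_0_1)
  qed
qed

lemma small_loops_trivial:
  assumes "x \<in> X - non_slsc X"
  shows "\<exists>\<rho>>0. \<forall>q. path_in X q \<longrightarrow> path_image q \<subseteq> ball x \<rho> \<longrightarrow> pathstart q = x \<longrightarrow> pathfinish q = x \<longrightarrow>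
    q \<simeq> (\<lambda>_. x)"
proof -
  obtain U where U: "openin (top_of_set X) U" "x \<in> U"
    "\<And>c. c \<in> carrier (fundamental_group U x) \<Longrightarrow> induced_hom X (\<lambda>y. y) c = \<one>\<^bsub>fundamental_group X x\<^esub>"
    using assms unfolding non_slsc_def by blast
  then obtain \<rho> where \<rho>: "\<rho> > 0" "ball x \<rho> \<inter> X \<subseteq> U" by (auto simp: openin_contains_ball)
  have UX: "U \<subseteq> X" using U(1) by (rule openin_imp_subset)
  have "q \<simeq> (\<lambda>_. x)" if q: "path_in X q" "path_image q \<subseteq> ball x \<rho>" "pathstart q = x" "pathfinish q = x" for q
  proof -
    have qU: "loop_in U x q" using q \<rho>(2) by blast
    have "path_class X ((\<lambda>y. y) \<circ> q) = \<one>\<^bsub>fundamental_group X x\<^esub>"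
      using U(3) [OF path_class_in_carrier [OF qU]] qU UX
      by (subst (asm) induced_hom_path_class) (auto intro: continuous_intros)
    then have "homotopic_paths X q (\<lambda>_. x)"
      using q by (simp add: one_fundamental_group path_class_eq_iff comp_def)
    then show ?thesis by (rule homotopic)
  qed
  with \<rho>(1) show ?thesis by blast
qed

theorem cantor_products_imp_unique_path_lifting:
  assumes cantor_products and "discrete (non_slsc X)"
  shows "unique_path_lifting tilde end_proj"
  unfolding unique_path_lifting_iff
proof (rule cantor_products_imp_unique_lifts [OF assms(1) small_loops_trivial])
  fix x assume "x \<in> non_slsc X"
  then have "x isolated_in non_slsc X" using assms(2) by (rule discreteD [rotated])
  then obtain T where "open T" "T \<inter> non_slsc X = {x}" by (auto simp: isolated_in_def)
  moreover from this obtain \<rho> where "\<rho> > 0" "ball x \<rho> \<subseteq> T"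
    using openE [of T x] by (metis IntE singletonI)
  ultimately show "\<exists>\<rho>>0. non_slsc X \<inter> ball x \<rho> \<subseteq> {x}"
    by blast
qed

end

section \<open>Maps on the Hawaiian earring\<close>

lemma hawaiian_loop_eq: "hawaiian_loop n t = ((1 - cos (2 * pi * t)) / real n, - sin (2 * pi * t) / real n)"
  by (simp add: hawaiian_loop_def diff_divide_distrib)

lemma hawaiian_loop_ends [simp]: "hawaiian_loop n 0 = (0, 0)" "hawaiian_loop n 1 = (0, 0)"
  by (simp_all add: hawaiian_loop_eq)

lemma circle_is_loop_image:
  assumes "n \<ge> 1" "z \<in> hawaiian_circle n"
  obtains t where "t \<in> {0..1}" "z = hawaiian_loop n t"
proof -
  obtain x y where z: "z = (x, y)" by (cases z)
  have "sqrt ((1 / real n - x)\<^sup>2 + y\<^sup>2) = 1 / real n"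
    using assms by (simp add: z hawaiian_circle_def dist_norm norm_Pair)
  then have "(1 / real n - x)\<^sup>2 + y\<^sup>2 = (1 / real n)\<^sup>2"
    by (metis real_sqrt_pow2 sum_power2_ge_zero)
  then have "(real n)\<^sup>2 * ((1 / real n - x)\<^sup>2 + y\<^sup>2) = 1"
    using assms(1) by (simp add: power_divide)
  moreover have "(real n)\<^sup>2 * ((1 / real n - x)\<^sup>2 + y\<^sup>2) = (1 - n * x)\<^sup>2 + (- n * y)\<^sup>2"
    using assms(1) by (simp add: field_simps power2_eq_square)
  ultimately have "(1 - n * x)\<^sup>2 + (- n * y)\<^sup>2 = 1" by simp
  then obtain \<theta> where \<theta>: "0 \<le> \<theta>" "\<theta> < 2 * pi" "1 - n * x = cos \<theta>" "- n * y = sin \<theta>"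
    using sincos_total_2pi by metis
  have "z = hawaiian_loop n (\<theta> / (2 * pi))"
  proof -
    have "2 * pi * (\<theta> / (2 * pi)) = \<theta>" by simp
    moreover have "x = (1 - cos \<theta>) / n" "y = - sin \<theta> / n"
      using assms(1) \<theta>(3,4) by (auto simp: field_simps)
    ultimately show ?thesis unfolding hawaiian_loop_eq by (simp add: z)
  qed
  moreover have "\<theta> / (2 * pi) \<in> {0..1}" using \<theta> by (auto simp: field_simps)
  ultimately show thesis using that by blast
qed

lemma hawaiian_loop_cases:
  assumes "n \<ge> 1" "t \<in> {0..1}"
  obtains "t = 0 \<or> t = 1" "hawaiian_loop n t = (0, 0)" | "0 < t" "t < 1" "0 < fst (hawaiian_loop n t)"
proof (cases "t = 0 \<or> t = 1")
  case True
  then show thesis using that(1) by auto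
next
  case False
  then have t: "0 < t" "t < 1" using assms by auto
  have "cos (2 * pi * t) \<noteq> 1"
  proof
    assume "cos (2 * pi * t) = 1"
    then obtain k :: int where "2 * pi * t = of_int k * (2 * pi)" by (auto simp: cos_one_2pi_int)
    then have "t = of_int k" by simp
    with t show False by auto
  qed
  then have "cos (2 * pi * t) < 1" using cos_le_one [of "2 * pi * t"] by linarith
  then show thesis using that(2) t assms(1) by (simp add: hawaiian_loop_eq)
qed

lemma hawaiian_loop_inj:
  assumes "n \<ge> 1" "m \<ge> 1" "hawaiian_loop n s = hawaiian_loop m t" "0 < s" "s < 1" "0 < t" "t < 1"
  shows "n = m" "s = t"
proof -
  have "hawaiian_loop n s \<noteq> (0, 0)"
    using hawaiian_loop_cases [OF assms(1), of s] assms(4,5) by (metis atLeastAtMost_iff fst_conv less_irrefl less_le)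
  then show nm: "n = m"
    using hawaiian_circle_disjoint [OF assms(1,2)] hawaiian_loop_in_circle assms(3) by metis
  have "cos (2 * pi * s) = cos (2 * pi * t)" "sin (2 * pi * s) = sin (2 * pi * t)"
    using assms(1,3) nm by (auto simp: hawaiian_loop_eq)
  then obtain k :: int where "2 * pi * s = 2 * pi * t + 2 * pi * of_int k"
    using sin_cos_eq_iff [of "2 * pi * s" "2 * pi * t"] by auto
  then have "2 * pi * s = 2 * pi * (t + of_int k)" by (simp add: algebra_simps)
  then have *: "s = t + of_int k" by simp
  then have "\<bar>of_int k :: real\<bar> < 1" using assms by linarith
  then have "k = 0" by linarith
  with * show "s = t" by simp
qed

lemma path_hawaiian_loop: "path (hawaiian_loop n)"
  unfolding path_def hawaiian_loop_def by (intro continuous_intros)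

lemma path_image_hawaiian_loop:
  assumes "n \<ge> 1"
  shows "path_image (hawaiian_loop n) \<subseteq> hawaiian_plus"
  using assms hawaiian_loop_in_circle by (auto simp: path_image_def hawaiian_plus_def hawaiian_def)

lemma null_hawaiian_loops:
  assumes j: "\<And>i. i \<ge> 1 \<Longrightarrow> i \<le> j i"
  shows "null_loops hawaiian_plus (0, 0) (\<lambda>i. hawaiian_loop (j i))"
  unfolding null_loops_def
proof (intro conjI allI impI)
  fix i :: nat assume i: "1 \<le> i"
  then have "j i \<ge> 1" using j [of i] by simp
  then show "path (hawaiian_loop (j i))" "path_image (hawaiian_loop (j i)) \<subseteq> hawaiian_plus"
    "pathstart (hawaiian_loop (j i)) = (0, 0)" "pathfinish (hawaiian_loop (j i)) = (0, 0)"
    using path_image_hawaiian_loop by (simp_all add: path_hawaiian_loop pathstart_def pathfinish_def)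
next
  fix r :: real assume "0 < r"
  then obtain M where M: "M > 0" "2 / real M < r"
    using reals_Archimedean2 [of "2 / r"] by (metis divide_less_eq mult.commute of_nat_0_less_iff pos_divide_less_eq zero_less_divide_iff zero_less_numeral less_trans)
  have "hawaiian_loop (j i) t \<in> ball (0, 0) r" if "i \<ge> M" for i t
  proof -
    have ji: "j i \<ge> M" using j [of i] that M(1) by simp
    have "dist (1 / real (j i), 0) (hawaiian_loop (j i) t) = 1 / real (j i)"
      using hawaiian_loop_in_circle [of "j i" t] by (simp add: hawaiian_circle_def)
    moreover have "dist (0, 0) (1 / real (j i), 0 :: real) = 1 / real (j i)"
      by (simp add: dist_Pair_Pair dist_real_def)
    ultimately have "dist (0, 0) (hawaiian_loop (j i) t) \<le> 2 / real (j i)"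
      using dist_triangle [of "(0, 0)" "hawaiian_loop (j i) t" "(1 / real (j i), 0)"] by simp
    also have "\<dots> \<le> 2 / real M" using ji M(1) by (intro divide_left_mono) auto
    finally show ?thesis using M(2) by simp
  qed
  then show "\<exists>M. \<forall>i\<ge>M. path_image (hawaiian_loop (j i)) \<subseteq> ball (0, 0) r"
    unfolding path_image_def by blast
qed

lemma path_in_whisker: "path_in hawaiian_plus whisker"
  and whisker_ends [simp]: "pathstart whisker = base_plus" "pathfinish whisker = (0, 0)"
proof -
  show "path_in hawaiian_plus whisker"
    unfolding path_def path_image_def whisker_def hawaiian_plus_def
    by (auto intro!: continuous_intros)
  show "pathstart whisker = base_plus" "pathfinish whisker = (0, 0)"
    by (simp_all add: whisker_def base_plus_def pathstart_def pathfinish_def)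
qed

lemma path_in_tau_loop: "path_in hawaiian_plus tau_loop"
  and tau_loop_ends [simp]: "pathstart tau_loop = (0, 0)" "pathfinish tau_loop = (0, 0)"
proof -
  note null = null_hawaiian_loops [of "\<lambda>i. i"]
  show "pathstart tau_loop = (0, 0)" "pathfinish tau_loop = (0, 0)"
    by (simp_all add: tau_loop_eq_cantor_product pathstart_cantor_product pathfinish_cantor_product)
  have "(0, 0) \<in> hawaiian_plus" by (simp add: hawaiian_plus_def)
  then show "path_in hawaiian_plus tau_loop"
    unfolding tau_loop_eq_cantor_product
    using null path_image_hawaiian_loop
    by (intro conjI path_cantor_product path_image_cantor_product) auto
qed

lemma path_image_whisker_tau: "path_image (whisker +++ tau_loop) = hawaiian_plus"
proof
  show "path_image (whisker +++ tau_loop) \<subseteq> hawaiian_plus"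
    using path_in_whisker path_in_tau_loop by (simp add: path_image_join)
  show "hawaiian_plus \<subseteq> path_image (whisker +++ tau_loop)"
  proof
    fix z assume "z \<in> hawaiian_plus"
    then consider n where "n \<ge> 1" "z \<in> hawaiian_circle n" | "z \<in> {-1..0} \<times> {0}"
      by (auto simp: hawaiian_plus_def hawaiian_def)
    then show "z \<in> path_image (whisker +++ tau_loop)"
    proof cases
      case 1
      then obtain s where s: "s \<in> {0..1}" "z = hawaiian_loop n s" by (rule circle_is_loop_image)
      define m k where "m = gap_level n" and "k = gap_pos n"
      note mk = gap_index_level [OF 1(1), folded m_def k_def]
      let ?t = "gap_left m k + s / 3 ^ m"
      have t: "gap_left m k \<le> ?t" "?t \<le> gap_left m k + 1 / 3 ^ m"
        using s(1) by (auto simp: divide_right_mono)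
      have "?t \<in> {0..1}" using t gap_left_bounds [OF mk(1,2)] by auto
      moreover have "tau_loop ?t = z"
        unfolding tau_loop_eq_cantor_product using cantor_product_gap [OF mk(1,2) t, of hawaiian_loop "(0, 0)"] mk(3) s(2) by simp
      ultimately have "z \<in> path_image tau_loop" unfolding path_image_def by blast
      then show ?thesis by (simp add: path_image_join)
    next
      case 2
      then have "z = whisker (fst z + 1)" "fst z + 1 \<in> {0..1}" by (auto simp: whisker_def)
      then have "z \<in> path_image whisker" unfolding path_image_def by blast
      then show ?thesis by (simp add: path_image_join)
    qed
  qed
qed

text \<open>A continuous map from a compact space onto a Hausdorff space is a quotient map.\<close>

lemma continuous_on_image_of_compact:
  fixes f :: "'a::topological_space \<Rightarrow> 'b::t2_space" and g :: "'b \<Rightarrow> 'c::topological_space"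
  assumes "compact S" "continuous_on S f" "continuous_on S (g \<circ> f)"
  shows "continuous_on (f ` S) g"
  unfolding continuous_on_closed_invariant
proof (intro allI impI)
  fix B :: "'c set" assume "closed B"
  then obtain A where A: "closed A" "A \<inter> S = (g \<circ> f) -` B \<inter> S"
    using assms(3) unfolding continuous_on_closed_invariant by blast
  have "compact (f ` (A \<inter> S))"
    using assms A(1) by (intro compact_continuous_image closed_Int_compact) (auto elim: continuous_on_subset)
  then have "closed (f ` (A \<inter> S))" by (rule compact_imp_closed)
  moreover have "f ` (A \<inter> S) \<inter> f ` S = g -` B \<inter> f ` S"
    unfolding A(2) by auto
  ultimately show "\<exists>A. closed A \<and> A \<inter> f ` S = g -` B \<inter> f ` S" by blast
qed

text \<open>
  The whisker followed by \<^const>\<open>tau_loop\<close> is a quotient map from the unit interval onto \<^const>\<open>hawaiian_plus\<close>.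
  Therefore a map with prescribed values on the whisker and on the circles is continuous if its pull-back is, and
  this is the path \<open>d\<close> followed by the Cantor product of the loops \<open>q\<close>.
\<close>

lemma hawaiian_plus_map_exists:
  fixes X :: "'a::metric_space set"
  assumes d: "path_in X d" "pathfinish d = x" and q: "null_loops X x q"
  obtains F where "based_map hawaiian_plus base_plus X (pathstart d) F"
    "\<And>t. t \<in> {0..1} \<Longrightarrow> F (whisker t) = d t"
    "\<And>n t. n \<ge> 1 \<Longrightarrow> t \<in> {0..1} \<Longrightarrow> F (hawaiian_loop n t) = q n t"
proof -
  define coord where "coord z = (SOME c. fst c \<ge> 1 \<and> 0 < snd c \<and> snd c < 1 \<and> hawaiian_loop (fst c) (snd c) = z)"
    for z
  \<comment> \<open>On \<^const>\<open>hawaiian_plus\<close>, the points with nonpositive first coordinate form the whisker.\<close>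
  define F where "F z = (if fst z \<le> 0 then d (fst z + 1) else q (fst (coord z)) (snd (coord z)))" for z :: "real \<times> real"
  have coord: "coord (hawaiian_loop n t) = (n, t)" if "n \<ge> 1" "0 < t" "t < 1" for n t
    unfolding coord_def
  proof (rule some_equality)
    fix c assume "fst c \<ge> 1 \<and> 0 < snd c \<and> snd c < 1 \<and> hawaiian_loop (fst c) (snd c) = hawaiian_loop n t"
    then show "c = (n, t)" using hawaiian_loop_inj [of "fst c" n "snd c" t] that by (cases c) simp
  qed (use that in simp)
  have F_loop: "F (hawaiian_loop n t) = q n t" if "n \<ge> 1" "t \<in> {0..1}" for n t
    using that
  proof (cases rule: hawaiian_loop_cases)
    case 1
    then show ?thesis
      using null_loopsD [OF q that(1)] d(2) by (auto simp: F_def pathfinish_def)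
  next
    case 2
    then show ?thesis using coord [OF that(1) 2(1,2)] by (simp add: F_def)
  qed
  have F_whisker: "F (whisker t) = d t" if "t \<in> {0..1}" for t
    using that by (simp add: F_def whisker_def)
  have F0: "F (0, 0) = x" using d(2) by (simp add: F_def pathfinish_def)
  have F_tau: "F (tau_loop t) = cantor_product x q t" if "t \<in> {0..1}" for t
  proof -
    have "F (tau_loop t) = cantor_product x (\<lambda>i. F \<circ> hawaiian_loop i) t"
      using image_cantor_product [of F "(0, 0)" hawaiian_loop t] by (simp only: tau_loop_eq_cantor_product F0)
    also have "\<dots> = cantor_product x q t"
      using F_loop F0 by (intro cantor_product_cong [OF that]) auto
    finally show ?thesis .
  qed
  have eq: "(F \<circ> (whisker +++ tau_loop)) t = (d +++ cantor_product x q) t" if "t \<in> {0..1}" for t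
    using that F_whisker [of "2 * t"] F_tau [of "2 * t - 1"] by (auto simp: joinpaths_def)
  have xX: "x \<in> X" using d pathfinish_in_path_image by blast
  have prod: "path_in X (d +++ cantor_product x q)"
    using d null_loopsD [OF q] xX
    by (intro path_in_join conjI path_cantor_product [OF q] path_image_cantor_product)
      (auto simp: pathstart_cantor_product)
  have "continuous_on {0..1} (F \<circ> (whisker +++ tau_loop))"
    using prod eq unfolding path_def by (metis (no_types, lifting) continuous_on_cong)
  moreover have "continuous_on {0..1} (whisker +++ tau_loop)"
    using path_in_whisker path_in_tau_loop by (simp flip: path_def)
  ultimately have "continuous_on ((whisker +++ tau_loop) ` {0..1}) F"
    by (intro continuous_on_image_of_compact) auto
  then have "continuous_on hawaiian_plus F"
    using path_image_whisker_tau by (simp add: path_image_def)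
  moreover have "F z \<in> X" if "z \<in> hawaiian_plus" for z
  proof -
    have "z \<in> (whisker +++ tau_loop) ` {0..1}"
      using that path_image_whisker_tau by (simp only: path_image_def)
    then obtain t where "t \<in> {0..1}" "z = (whisker +++ tau_loop) t" by (elim imageE)
    then have "F z = (d +++ cantor_product x q) t" using eq by (simp add: comp_def)
    then show ?thesis using prod \<open>t \<in> {0..1}\<close> unfolding path_image_def by blast
  qed
  moreover have "F base_plus = pathstart d" by (simp add: F_def base_plus_def pathstart_def)
  ultimately have "based_map hawaiian_plus base_plus X (pathstart d) F" by (simp add: based_map_def)
  then show thesis using F_whisker F_loop that by blast
qed

lemma loop_in_hawaiian_loop:
  assumes "n \<ge> 1"
  shows "loop_in hawaiian_plus (0, 0) (hawaiian_loop n)"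
  using path_image_hawaiian_loop [OF assms] by (simp add: path_hawaiian_loop pathstart_def pathfinish_def)

lemma loop_in_whisker:
  assumes "loop_in hawaiian_plus (0, 0) p"
  shows "loop_in hawaiian_plus base_plus (whisker +++ p +++ reversepath whisker)"
  using assms path_in_whisker by (auto simp: path_image_join)

lemma whisker_class_in_carrier:
  "loop_in hawaiian_plus (0, 0) p \<Longrightarrow> whisker_class p \<in> carrier (fundamental_group hawaiian_plus base_plus)"
  unfolding whisker_class_def using loop_in_whisker by (intro path_class_in_carrier) auto

lemma induced_hom_loop:
  assumes "based_map Y y0 X x0 f" "loop_in Y y p"
  shows "induced_hom X f (path_class Y p) = path_class X (f \<circ> p)" "loop_in X (f y) (f \<circ> p)"
proof -
  show "induced_hom X f (path_class Y p) = path_class X (f \<circ> p)"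
    using assms by (intro induced_hom_path_class) (auto simp: based_map_def)
  have "path (f \<circ> p)"
    using assms by (auto simp: based_map_def intro!: path_continuous_image elim: continuous_on_subset)
  then show "loop_in X (f y) (f \<circ> p)"
    using assms by (auto simp: based_map_def path_image_compose pathstart_compose pathfinish_compose Pi_def)
qed

lemma induced_hom_whisker_class:
  assumes "based_map hawaiian_plus base_plus X x0 f" "loop_in hawaiian_plus (0, 0) p"
  shows "induced_hom X f (whisker_class p) =
    path_class X ((f \<circ> whisker) +++ (f \<circ> p) +++ reversepath (f \<circ> whisker))"
  unfolding whisker_class_def
  using induced_hom_loop(1) [OF assms(1) loop_in_whisker [OF assms(2)]]
  by (simp add: path_compose_join path_compose_reversepath)

lemma path_in_image_whisker:
  assumes "based_map hawaiian_plus base_plus X x0 f"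
  shows "path_in X (f \<circ> whisker)" "pathstart (f \<circ> whisker) = x0" "pathfinish (f \<circ> whisker) = f (0, 0)"
proof -
  have "path (f \<circ> whisker)"
    using assms path_in_whisker by (auto simp: based_map_def intro!: path_continuous_image elim: continuous_on_subset)
  then show "path_in X (f \<circ> whisker)"
    using assms path_in_whisker by (auto simp: based_map_def path_image_compose Pi_def)
  show "pathstart (f \<circ> whisker) = x0" "pathfinish (f \<circ> whisker) = f (0, 0)"
    using assms by (simp_all add: pathstart_compose pathfinish_compose based_map_def)
qed

lemma induced_hom_generate:
  fixes X :: "'a::topological_space set" and Y :: "'b::topological_space set"
  assumes f: "based_map Y y0 X x0 f" and y0: "y0 \<in> Y" and K: "subgroup K (fundamental_group X x0)"
    and S: "S \<subseteq> carrier (fundamental_group Y y0)" "induced_hom X f ` S \<subseteq> K"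
  shows "induced_hom X f ` generate (fundamental_group Y y0) S \<subseteq> K"
proof -
  interpret GY: group "fundamental_group Y y0" using y0 by (rule group_fundamental_group)
  have fy0: "f y0 = x0" using f by (simp add: based_map_def)
  have inv_hom: "induced_hom X f (inv\<^bsub>fundamental_group Y y0\<^esub> c) = inv\<^bsub>fundamental_group X x0\<^esub> induced_hom X f c"
    if c: "c \<in> carrier (fundamental_group Y y0)" for c
  proof -
    obtain p where p: "loop_in Y y0 p" "c = path_class Y p" using c carrier_fundamental_group by blast
    have "loop_in Y y0 (reversepath p)" using p(1) by simp
    then show ?thesis
      using p induced_hom_loop [OF f p(1)] induced_hom_loop(1) [OF f, where p = "reversepath p" and y = y0] fy0
      by (simp add: inv_path_class path_compose_reversepath)
  qed
  have mult: "induced_hom X f (c \<otimes>\<^bsub>fundamental_group Y y0\<^esub> e) =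
      induced_hom X f c \<otimes>\<^bsub>fundamental_group X x0\<^esub> induced_hom X f e"
    if ce: "c \<in> carrier (fundamental_group Y y0)" "e \<in> carrier (fundamental_group Y y0)" for c e
  proof -
    obtain p where p: "loop_in Y y0 p" "c = path_class Y p"
      using ce(1) unfolding carrier_fundamental_group by blast
    obtain q where q: "loop_in Y y0 q" "e = path_class Y q"
      using ce(2) unfolding carrier_fundamental_group by blast
    have "loop_in Y y0 (p +++ q)" using p(1) q(1) by (simp add: path_image_join)
    then show ?thesis
      using p q induced_hom_loop [OF f p(1)] induced_hom_loop [OF f q(1)] induced_hom_loop(1) [OF f, where p = "p +++ q" and y = y0] fy0
      by (simp add: fundamental_group_mult path_compose_join)
  qed
  have "induced_hom X f c \<in> K" if "c \<in> generate (fundamental_group Y y0) S" for c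
    using that
  proof (induction c rule: generate.induct)
    case one
    have "loop_in Y y0 (\<lambda>_. y0)" using y0 by (simp add: path_in_const)
    then show ?case
      using subgroup.one_closed [OF K] induced_hom_loop(1) [OF f, where p = "\<lambda>_. y0" and y = y0] fy0
      by (simp add: one_fundamental_group comp_def)
  next
    case (incl c)
    then show ?case using S by blast
  next
    case (inv c)
    then have "induced_hom X f c \<in> K" "c \<in> carrier (fundamental_group Y y0)" using S by blast+
    then show ?case using subgroup.m_inv_closed [OF K] inv_hom by simp
  next
    case (eng c e)
    then have "c \<in> carrier (fundamental_group Y y0)" "e \<in> carrier (fundamental_group Y y0)"
      using GY.generate_in_carrier [OF S(1)] by blast+
    then show ?case using mult subgroup.m_closed [OF K] eng.IH by simp
  qed
  then show ?thesis by blast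
qed

section \<open>From unique lifts to transfinite products\<close>

lemma hawaiian_circle_iff: 
  assumes "n \<ge> 1"
  shows "z \<in> hawaiian_circle n \<longleftrightarrow> (fst z)\<^sup>2 + (snd z)\<^sup>2 = 2 * fst z / real n"
proof -
  obtain x y where z: "z = (x, y)" by (cases z)
  have "z \<in> hawaiian_circle n \<longleftrightarrow> sqrt ((1 / real n - x)\<^sup>2 + y\<^sup>2) = 1 / real n"
    by (simp add: z hawaiian_circle_def dist_norm norm_Pair)
  also have "\<dots> \<longleftrightarrow> (1 / real n - x)\<^sup>2 + y\<^sup>2 = (1 / real n)\<^sup>2"
    by (metis real_sqrt_pow2 real_sqrt_unique sum_power2_ge_zero zero_le_divide_1_iff of_nat_0_le_iff)
  also have "\<dots> \<longleftrightarrow> x\<^sup>2 + y\<^sup>2 = 2 * x / real n"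
    by (simp add: power2_eq_square algebra_simps)
  finally show ?thesis by (simp add: z)
qed

lemma hawaiian_plus_left: "z \<in> hawaiian_plus \<Longrightarrow> fst z \<le> 0 \<Longrightarrow> z \<in> {-1..0} \<times> {0}"
proof -
  assume z: "z \<in> hawaiian_plus" "fst z \<le> 0"
  show ?thesis
  proof (rule ccontr)
    assume ne: "z \<notin> {-1..0} \<times> {0}"
    then obtain n where n: "n \<ge> 1" "z \<in> hawaiian_circle n"
      using z(1) by (auto simp: hawaiian_plus_def hawaiian_def)
    then have "(fst z)\<^sup>2 + (snd z)\<^sup>2 \<le> 0"
      using z(2) by (simp add: hawaiian_circle_iff divide_nonpos_nonneg)
    then have "fst z = 0" "snd z = 0" using sum_power2_le_zero_iff by blast+
    with ne show False by (cases z) auto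
  qed
qed

lemma hawaiian_circle_left: "n \<ge> 1 \<Longrightarrow> z \<in> hawaiian_circle n \<Longrightarrow> fst z \<le> 0 \<Longrightarrow> z = (0, 0)"
proof -
  assume "n \<ge> 1" "z \<in> hawaiian_circle n" "fst z \<le> 0"
  then have "(fst z)\<^sup>2 + (snd z)\<^sup>2 \<le> 0"
    by (simp add: hawaiian_circle_iff divide_nonpos_nonneg)
  then show "z = (0, 0)" by (metis prod.collapse sum_power2_le_zero_iff)
qed

text \<open>
  Off the whisker, the index of the circle through the point \<open>(x, y)\<close> is \<open>2 * x / (x ^ 2 + y ^ 2)\<close>.  This is continuous
  and takes integer values, and is hence constant along the excursion.
\<close>

lemma excursion_in_circle:
  assumes \<sigma>: "path_in hawaiian_plus \<sigma>" and uv: "u \<in> {0..1}" "v \<in> {0..1}" "u < v"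
    and ends: "fst (\<sigma> u) \<le> 0" "fst (\<sigma> v) \<le> 0"
    and out: "\<And>t. u < t \<Longrightarrow> t < v \<Longrightarrow> 0 < fst (\<sigma> t)"
  obtains n where "n \<ge> 1" "\<sigma> ` {u..v} \<subseteq> hawaiian_circle n" "\<sigma> u = (0, 0)" "\<sigma> v = (0, 0)"
proof -
  define N where "N t = 2 * fst (\<sigma> t) / ((fst (\<sigma> t))\<^sup>2 + (snd (\<sigma> t))\<^sup>2)" for t
  have cont: "continuous_on {u..v} \<sigma>"
    using \<sigma> uv by (auto simp: path_def elim!: continuous_on_subset)
  have circ: "\<exists>n\<ge>1. \<sigma> t \<in> hawaiian_circle n \<and> N t = real n" if t: "u < t" "t < v" for t
  proof -
    have "\<sigma> t \<in> hawaiian_plus" using \<sigma> uv t by (auto simp: path_image_def)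
    then obtain n where n: "n \<ge> 1" "\<sigma> t \<in> hawaiian_circle n"
      using out [OF t] by (auto simp: hawaiian_plus_def hawaiian_def)
    then have "N t = 2 * fst (\<sigma> t) / (2 * fst (\<sigma> t) / real n)" by (simp add: N_def hawaiian_circle_iff)
    then have "N t = real n" using out [OF t] n(1) by simp
    with n show ?thesis by blast
  qed
  have contN: "continuous_on {u<..<v} N"
    unfolding N_def
  proof (intro continuous_intros continuous_on_subset [OF cont])
    show "\<forall>t\<in>{u<..<v}. (fst (\<sigma> t))\<^sup>2 + (snd (\<sigma> t))\<^sup>2 \<noteq> 0"
      using out by (metis greaterThanLessThan_iff less_irrefl sum_power2_eq_zero_iff)
  qed auto
  have "N constant_on {u<..<v}"
  proof (rule continuous_discrete_range_constant [OF _ contN])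
    fix t assume t: "t \<in> {u<..<v}"
    have "1 \<le> norm (N s - N t)" if s: "s \<in> {u<..<v}" "N s \<noteq> N t" for s
    proof -
      have "\<exists>n. N r = real n" if "r \<in> {u<..<v}" for r using circ [of r] that by auto
      then obtain n m where "N s = real n" "N t = real m" using s(1) t by metis
      then show ?thesis using s(2) by (cases "n \<le> m") (auto simp: abs_real_def)
    qed
    then show "\<exists>e>0. \<forall>s. s \<in> {u<..<v} \<and> N s \<noteq> N t \<longrightarrow> e \<le> norm (N s - N t)"
      by (intro exI [of _ 1]) auto
  qed auto
  then obtain c where c: "\<And>t. t \<in> {u<..<v} \<Longrightarrow> N t = c" by (auto simp: constant_on_def)
  have "(u + v) / 2 \<in> {u<..<v}" using uv(3) by (auto simp: field_simps)
  then obtain n where n: "n \<ge> 1" "c = real n" using circ [of "(u + v) / 2"] c by auto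
  have "\<sigma> ` {u<..<v} \<subseteq> hawaiian_circle n"
  proof (rule image_subsetI)
    fix t assume "t \<in> {u<..<v}"
    then show "\<sigma> t \<in> hawaiian_circle n" using circ [of t] c [of t] n by auto
  qed
  then have *: "\<sigma> ` closure {u<..<v} \<subseteq> hawaiian_circle n"
    using cont uv(3) by (intro image_closure_subset) (auto simp: hawaiian_circle_def)
  then have "\<sigma> ` {u..v} \<subseteq> hawaiian_circle n" using uv(3) by simp
  moreover from this have "\<sigma> u = (0, 0)" "\<sigma> v = (0, 0)"
    using hawaiian_circle_left [OF n(1)] ends uv(3) by (auto simp: image_subset_iff)
  ultimately show thesis using n(1) that by blast
qed

lemma hawaiian_loop_periodic: "hawaiian_loop n (t + of_int k) = hawaiian_loop n t"
proof -
  have "2 * pi * (t + of_int k) = 2 * pi * t + 2 * pi * of_int k" by (simp add: algebra_simps)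
  then show ?thesis by (simp add: hawaiian_loop_eq sin_add cos_add)
qed

text \<open>
  Up to scale and position, the circle is the unit circle in the complex plane, and a continuous logarithm of the
  path provides the angle.
\<close>

lemma circle_path_lift:
  assumes n: "n \<ge> 1" and q: "path_in (hawaiian_circle n) q"
  obtains \<theta> where "continuous_on {0..1} \<theta>" "\<And>t. t \<in> {0..1} \<Longrightarrow> q t = hawaiian_loop n (\<theta> t)"
proof -
  define c where "c t = Complex (1 - n * fst (q t)) (- n * snd (q t))" for t
  have norm_c: "norm (c t) = 1" if "t \<in> {0..1}" for t
  proof -
    have "q t \<in> hawaiian_circle n" using q that by (auto simp: path_image_def)
    then have "(fst (q t))\<^sup>2 + (snd (q t))\<^sup>2 = 2 * fst (q t) / real n" using n by (simp add: hawaiian_circle_iff)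
    then have "real n * ((fst (q t))\<^sup>2 + (snd (q t))\<^sup>2) = 2 * fst (q t)" using n by simp
    then have "real n * (real n * ((fst (q t))\<^sup>2 + (snd (q t))\<^sup>2)) = real n * (2 * fst (q t))" by simp
    then have "(1 - n * fst (q t))\<^sup>2 + (- n * snd (q t))\<^sup>2 = 1"
      by (simp add: power2_eq_square algebra_simps)
    then show ?thesis by (simp add: c_def cmod_def)
  qed
  have "continuous_on {0..1} q" using q by (simp add: path_def)
  then have "continuous_on (cbox 0 1) c"
    unfolding c_def by (auto simp: Complex_eq intro!: continuous_intros)
  moreover have "c t \<noteq> 0" if "t \<in> cbox 0 1" for t using norm_c that by fastforce
  ultimately obtain g where g: "continuous_on (cbox 0 1) g" "\<And>t. t \<in> cbox 0 1 \<Longrightarrow> c t = exp (g t)"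
    using continuous_logarithm_on_contractible [of "cbox 0 1" c] convex_imp_contractible [of "cbox 0 (1::real)"] by auto
  show thesis
  proof (rule that [of "\<lambda>t. Im (g t) / (2 * pi)"])
    show "continuous_on {0..1} (\<lambda>t. Im (g t) / (2 * pi))"
      using g(1) by (auto intro!: continuous_intros)
    fix t :: real assume t: "t \<in> {0..1}"
    then have ct: "c t = exp (g t)" using g(2) by simp
    then have "exp (Re (g t)) = 1" using norm_c [OF t] by (metis norm_exp_eq_Re)
    then have "c t = cis (Im (g t))" using ct by (simp add: exp_eq_polar)
    then have "cos (Im (g t)) = 1 - n * fst (q t)" "sin (Im (g t)) = - n * snd (q t)"
      by (auto simp: c_def complex_eq_iff)
    then show "q t = hawaiian_loop n (Im (g t) / (2 * pi))"
      using n by (simp add: hawaiian_loop_eq prod_eq_iff)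
  qed
qed

context path_congruence
begin

text \<open>
  A loop in the circle is homotopic to a linear one, which runs through \<open>hawaiian_loop n\<close> an integral number of times.
\<close>

lemma circle_loops_congruent:
  assumes n: "n \<ge> 1" and a: "based_map hawaiian_plus base_plus X x0 a" and b: "based_map hawaiian_plus base_plus X x0 b"
    and ab: "a \<circ> hawaiian_loop n \<simeq> b \<circ> hawaiian_loop n"
    and q: "path_in (hawaiian_circle n) q" "pathstart q = (0, 0)" "pathfinish q = (0, 0)"
  shows "a \<circ> q \<simeq> b \<circ> q"
proof -
  let ?l = "hawaiian_loop n"
  have map_hom: "f \<circ> p \<simeq> f \<circ> p'" if "based_map hawaiian_plus base_plus X x0 f" "homotopic_paths hawaiian_plus p p'" for f p p'
    using that by (intro homotopic homotopic_paths_continuous_image) (auto simp: based_map_def)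
  have sub: "hawaiian_circle n \<subseteq> hawaiian_plus" using n by (auto simp: hawaiian_plus_def hawaiian_def)
  have l_sub: "range ?l \<subseteq> hawaiian_plus"
    using hawaiian_loop_in_circle sub by blast
  have l_cont: "continuous_on UNIV ?l"
    unfolding hawaiian_loop_def by (intro continuous_intros)
  have split: "homotopic_paths hawaiian_plus (subarc ?l u v +++ subarc ?l v w) (subarc ?l u w)" for u v w
    using homotopic_subarc_join [OF l_cont] l_sub by (auto intro: homotopic_paths_subset)
  define S where "S u v \<longleftrightarrow> a \<circ> subarc ?l u v \<simeq> b \<circ> subarc ?l u v" for u v
  have S_trans: "S u w" if "S u v" "S v w" for u v w
  proof -
    have "(a \<circ> subarc ?l u v) +++ (a \<circ> subarc ?l v w) \<simeq> (b \<circ> subarc ?l u v) +++ (b \<circ> subarc ?l v w)"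
      using that unfolding S_def by (intro join) (auto simp: pathstart_compose pathfinish_compose)
    then have "a \<circ> (subarc ?l u v +++ subarc ?l v w) \<simeq> b \<circ> (subarc ?l u v +++ subarc ?l v w)"
      by (simp only: path_compose_join)
    from trans [OF trans [OF sym [OF map_hom [OF a split]] this] map_hom [OF b split]]
    show ?thesis unfolding S_def .
  qed
  have S_sym: "S v u" if "S u v" for u v
    using reverse_cong [OF that [unfolded S_def]] unfolding S_def
    by (simp add: path_compose_reversepath [symmetric] reversepath_subarc)
  have S_next: "S (of_int i) (of_int i + 1)" for i :: int
  proof -
    have "subarc ?l (of_int i) (of_int i + 1) = ?l"
    proof
      fix t
      have "linepath (of_int i) (of_int i + 1) t = t + real_of_int i" by (simp add: linepath_def algebra_simps)
      then show "subarc ?l (of_int i) (of_int i + 1) t = ?l t" by (simp add: hawaiian_loop_periodic)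
    qed
    then show ?thesis using ab by (simp add: S_def)
  qed
  have S_refl: "S u u" if "S u v" for u v using S_trans [OF that S_sym [OF that]] .
  have "S (of_int i) (of_int j)" if "i \<le> j" for i j :: int
    using that
  proof (induction j rule: int_ge_induct)
    case base
    show ?case by (rule S_refl [OF S_next])
  next
    case (step j)
    then show ?case using S_trans [OF step.IH S_next] by simp
  qed
  then have S_int: "S (of_int i) (of_int j)" for i j :: int
    using S_sym by (cases "i \<le> j") auto
  obtain \<theta> where \<theta>: "continuous_on {0..1} \<theta>" "\<And>t. t \<in> {0..1} \<Longrightarrow> q t = ?l (\<theta> t)"
    using circle_path_lift [OF n q(1)] by blast
  have int: "\<exists>i. \<theta> t = of_int i" if "t \<in> {0..1}" "q t = (0, 0)" for t
  proof -
    have "cos (2 * pi * \<theta> t) = 1" using \<theta>(2) [OF that(1)] that(2) n by (simp add: hawaiian_loop_eq)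
    then obtain k :: int where "2 * pi * \<theta> t = of_int k * (2 * pi)" by (auto simp: cos_one_2pi_int)
    then show ?thesis by auto
  qed
  obtain i where i: "\<theta> 0 = of_int i" using int [of 0] q(2) by (auto simp: pathstart_def)
  obtain j where j: "\<theta> 1 = of_int j" using int [of 1] q(3) by (auto simp: pathfinish_def)
  have "homotopic_paths (range ?l) (?l \<circ> \<theta>) (subarc ?l (of_int i) (of_int j))"
    using l_cont \<theta>(1) i j
    by (intro homotopic_paths_through_interval) (auto simp: path_def pathstart_def pathfinish_def linepath_def intro!: continuous_intros)
  then have "homotopic_paths hawaiian_plus (?l \<circ> \<theta>) (subarc ?l (of_int i) (of_int j))"
    using l_sub by (rule homotopic_paths_subset)
  moreover have "homotopic_paths hawaiian_plus q (?l \<circ> \<theta>)"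
    using q(1) sub \<theta>(2) by (intro homotopic_paths_eq) auto
  ultimately have "homotopic_paths hawaiian_plus q (subarc ?l (of_int i) (of_int j))"
    using homotopic_paths_trans by blast
  then show ?thesis
    using trans [OF trans [OF map_hom [OF a] S_int [of i j, unfolded S_def]] sym [OF map_hom [OF b]]] by blast
qed

end

context metric_path_congruence
begin

text \<open>
  Follow \<open>a \<circ> \<sigma>\<close> up to the last time \<open>e t\<close> when \<open>\<sigma>\<close> is on the whisker, where \<open>a\<close> and \<open>b\<close> agree, and \<open>b \<circ> \<sigma>\<close> from
  then on.  At the end of an excursion into a circle the second part is turned into a part of the first, and the
  class does not jump because the two images of the excursion are congruent.  So this is a lift of \<open>b \<circ> \<sigma>\<close>.  It
  ends with the class of \<open>a \<circ> \<sigma>\<close>, and the standard lift ends with that of \<open>b \<circ> \<sigma>\<close>.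
\<close>

theorem unique_lifts_imp_products:
  assumes u: "unique_lifts x0"
    and a: "based_map hawaiian_plus base_plus X x0 a" and b: "based_map hawaiian_plus base_plus X x0 b"
    and whisk: "\<And>t. t \<in> {0..1} \<Longrightarrow> a (whisker t) = b (whisker t)"
    and loops: "\<And>n. n \<ge> 1 \<Longrightarrow> a \<circ> hawaiian_loop n \<simeq> b \<circ> hawaiian_loop n"
    and \<sigma>: "loop_in hawaiian_plus base_plus \<sigma>"
  shows "a \<circ> \<sigma> \<simeq> b \<circ> \<sigma>"
proof -
  let ?a = "a \<circ> \<sigma>" and ?b = "b \<circ> \<sigma>"
  have pa: "path_in X ?a" "pathstart ?a = x0" "pathfinish ?a = x0"
    and pb: "path_in X ?b" "pathstart ?b = x0" "pathfinish ?b = x0"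
    using induced_hom_loop(2) [OF a \<sigma>] induced_hom_loop(2) [OF b \<sigma>] a b by (auto simp: based_map_def)
  have cont_\<sigma>: "continuous_on {0..1} \<sigma>" using \<sigma> by (simp add: path_def)
  define S where "S = {t \<in> {0..1}. fst (\<sigma> t) \<le> 0}"
  have "S = {0..1} \<inter> (\<lambda>t. fst (\<sigma> t)) -` {..0}" by (auto simp: S_def)
  then have "closed S"
    using cont_\<sigma> by (simp only:) (intro continuous_closed_preimage continuous_intros; simp)
  have S01: "S \<subseteq> {0..1}" by (auto simp: S_def)
  have ends: "0 \<in> S" "1 \<in> S"
    using \<sigma> by (auto simp: S_def pathstart_def pathfinish_def base_plus_def)
  have ab: "?a t = ?b t" if "t \<in> S" for t
  proof -
    have "\<sigma> t \<in> {-1..0} \<times> {0}"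
      using that \<sigma> by (intro hawaiian_plus_left) (auto simp: S_def path_image_def)
    then have "\<sigma> t = whisker (fst (\<sigma> t) + 1)" "fst (\<sigma> t) + 1 \<in> {0..1}"
      by (auto simp: whisker_def mem_Times_iff prod_eq_iff)
    then show ?thesis using whisk by (metis comp_apply)
  qed
  define e where "e t = Sup (S \<inter> {0..t})" for t
  have e: "e t \<in> S" "e t \<le> t" "S \<inter> {e t<..t} = {}" if "t \<in> {0..1}" for t
  proof -
    have ne: "0 \<in> S \<inter> {0..t}" using ends that by auto
    have bdd: "bdd_above (S \<inter> {0..t})" by auto
    have "e t \<in> S \<inter> {0..t}"
      unfolding e_def using ne \<open>closed S\<close> bdd by (intro closed_contains_Sup) auto
    then show "e t \<in> S" "e t \<le> t" by auto
    have "s \<le> e t" if "s \<in> S" "s \<le> t" for s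
      unfolding e_def using that S01 bdd by (intro cSup_upper) auto
    then show "S \<inter> {e t<..t} = {}" by force
  qed
  define M where "M t = subarc ?a 0 t" for t
  define A where "A t = M (e t) +++ subarc ?b (e t) t" for t
  have M_step: "step (M s) (subarc ?a s t) (M t)" if "s \<in> {0..1}" "t \<in> {0..1}" for s t
    using subarc_join [OF pa(1), of 0 s t] that by (simp add: step_def M_def pathstart_compose pathfinish_compose)
  have A_step: "step (M (e t)) (subarc ?b (e t) t) (A t)" if "t \<in> {0..1}" for t
  proof -
    have et: "e t \<in> {0..1}" using e(1) [OF that] S01 by blast
    have "path_in X (M (e t))" unfolding M_def using pa(1) et by (intro path_in_subarc) auto
    moreover have "path_in X (subarc ?b (e t) t)" using pb(1) et that by (intro path_in_subarc) auto
    ultimately show ?thesis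
      unfolding A_def using ab [OF e(1) [OF that]]
      by (intro step_self path_in_join) (auto simp: M_def pathstart_compose pathfinish_compose)
  qed
  have A_start: "pathstart (A t) = x0" if "t \<in> {0..1}" for t
    using pa(2) by (simp add: A_def M_def pathstart_compose) (simp add: pathstart_def)
  have A_finish: "pathfinish (A t) = ?b t" for t
    by (simp add: A_def pathfinish_compose)
  \<comment> \<open>The class at \<open>s\<close> may also be reached from the next time \<open>f\<close> on the whisker, going back along \<open>b \<circ> \<sigma>\<close>.  This
    yields continuity from the left at \<open>f\<close>.\<close>
  have backwards: "step (M f) (subarc ?b f s) (A s)" if f: "f \<in> S" and s: "s \<in> {0..1}" "s \<le> f" "S \<inter> {s..<f} = {}" for f s
  proof (cases "s = f")
    case True
    then have "e s = s" using e [OF s(1)] f by (metis IntI empty_iff greaterThanAtMost_iff less_le order_refl)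
    then show ?thesis using A_step [OF s(1)] True by simp
  next
    case False
    then have sf: "s < f" "s \<notin> S" using s by auto
    have es: "e s \<in> S" "e s < s" using e(1,2) [OF s(1)] sf(2) by (auto simp: less_le)
    have f01: "f \<in> {0..1}" and es01: "e s \<in> {0..1}" using f es S01 by blast+
    have out: "0 < fst (\<sigma> t)" if "e s < t" "t < f" for t
    proof -
      have "t \<notin> S"
      proof (cases "t \<le> s")
        case True
        then show ?thesis using that e(3) [OF s(1)] by auto
      next
        case False
        then show ?thesis using that s(3) by auto
      qed
      then show ?thesis using that es01 f01 by (auto simp: S_def)
    qed
    obtain n where n: "n \<ge> 1" "\<sigma> ` {e s..f} \<subseteq> hawaiian_circle n" "\<sigma> (e s) = (0, 0)" "\<sigma> f = (0, 0)"
    proof (rule excursion_in_circle [of \<sigma> "e s" f])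
      show "fst (\<sigma> (e s)) \<le> 0" "fst (\<sigma> f) \<le> 0" using es f by (auto simp: S_def)
    qed (use \<sigma> es01 f01 es sf out in auto)
    have "path_image (subarc \<sigma> (e s) f) \<subseteq> hawaiian_circle n"
      using n(2) es sf by (simp add: path_image_subarc closed_segment_eq_real_ivl)
    moreover have "path (subarc \<sigma> (e s) f)" using path_in_subarc [where g = \<sigma> and u = "e s" and v = f] \<sigma> es01 f01 by blast
    ultimately have "a \<circ> subarc \<sigma> (e s) f \<simeq> b \<circ> subarc \<sigma> (e s) f"
      using n by (intro circle_loops_congruent [OF n(1) a b loops [OF n(1)]]) (auto simp: pathstart_compose pathfinish_compose)
    then have "subarc ?a (e s) f \<simeq> subarc ?b (e s) f" by (simp only: comp_assoc)
    then have "step (M (e s)) (subarc ?b (e s) f) (M f)"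
      using M_step [OF es01 f01] step_cong2 by blast
    then have "step (M f) (subarc ?b f (e s)) (M (e s))" by (simp only: step_subarc_reverse)
    then show ?thesis
      using step_subarc [OF _ pb(1) f01 es01 s(1)] A_step [OF s(1)] by blast
  qed
  have MA: "M t \<simeq> A t" if "t \<in> S" for t
  proof -
    have "t \<in> {0..1}" using that S01 by blast
    then have "step (M t) (subarc ?b t t) (A t)" "path_in X (M t)"
      using backwards [OF that, of t] path_in_subarc [OF pa(1), of 0 t] by (auto simp: M_def)
    moreover have "subarc ?b t t = (\<lambda>_. pathfinish (M t))"
      using ab [OF that] by (simp add: subarc_trivial M_def pathfinish_compose)
    ultimately show ?thesis using step_refl step_target by metis
  qed
  have "path_lift x0 A"
    unfolding path_lift_def
  proof (intro conjI ballI allI impI)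
    fix t :: real assume t: "t \<in> {0..1}"
    show "path (A t)" "path_image (A t) \<subseteq> X" using step_paths [OF A_step [OF t]] by auto
    show "pathstart (A t) = x0" using A_start [OF t] .
    fix \<rho> :: real assume \<rho>: "0 < \<rho>"
    have "continuous_on {0..1} ?a" "continuous_on {0..1} ?b" using pa pb by (simp_all add: path_def)
    then obtain \<eta>1 \<eta>2 where \<eta>1: "\<eta>1 > 0" "\<And>s. s \<in> {0..1} \<Longrightarrow> dist s t < \<eta>1 \<Longrightarrow> ?a s \<in> ball (?a t) \<rho>"
      and \<eta>2: "\<eta>2 > 0" "\<And>s. s \<in> {0..1} \<Longrightarrow> dist s t < \<eta>2 \<Longrightarrow> ?b s \<in> ball (?b t) \<rho>"
      using t \<rho> unfolding continuous_on_iff by (metis dist_commute mem_ball)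
    have seg: "v \<in> {0..1} \<and> dist v t < \<eta>" if "s \<in> {0..1}" "dist s t < \<eta>" "r \<in> {0..1}" "dist r t < \<eta>"
        "v \<in> closed_segment r s" for r s v \<eta>
      using that by (auto simp: closed_segment_eq_real_ivl dist_real_def split: if_splits)
    have img_a: "path_image (subarc ?a r s) \<subseteq> ball (?a t) \<rho>"
      if "s \<in> {0..1}" "dist s t < \<eta>1" "r \<in> {0..1}" "dist r t < \<eta>1" for r s
      unfolding path_image_subarc using \<eta>1(2) seg [OF that] by blast
    have img_b: "path_image (subarc ?b r s) \<subseteq> ball (?b t) \<rho>"
      if "s \<in> {0..1}" "dist s t < \<eta>2" "r \<in> {0..1}" "dist r t < \<eta>2" for r s
      unfolding path_image_subarc using \<eta>2(2) seg [OF that] by blast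
    show "\<exists>\<eta>>0. \<forall>s\<in>{0..1}. dist s t < \<eta> \<longrightarrow>
        (\<exists>\<epsilon>. path_image \<epsilon> \<subseteq> ball (trace A t) \<rho> \<and> step (A t) \<epsilon> (A s))"
    proof (cases "t \<in> S")
      case True
      have "\<exists>\<epsilon>. path_image \<epsilon> \<subseteq> ball (trace A t) \<rho> \<and> step (A t) \<epsilon> (A s)"
        if s: "s \<in> {0..1}" "dist s t < min \<eta>1 \<eta>2" for s
      proof -
        have "\<exists>f\<in>S. dist f t \<le> dist s t \<and> step (M f) (subarc ?b f s) (A s)"
        proof (cases "t \<le> s")
          case ts: True
          have "t \<le> e s" using e(3) [OF s(1)] True ts by force
          then have "dist (e s) t \<le> dist s t" using e(2) [OF s(1)] by (simp add: dist_real_def)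
          then show ?thesis using e(1) [OF s(1)] A_step [OF s(1)] by blast
        next
          case False
          define f where "f = Inf (S \<inter> {s..t})"
          have bdd: "bdd_below (S \<inter> {s..t})" by auto
          have "f \<in> S \<inter> {s..t}"
            unfolding f_def using True False \<open>closed S\<close> bdd by (intro closed_contains_Inf) auto
          moreover have "S \<inter> {s..<f} = {}"
          proof -
            have "f \<le> v" if "v \<in> S" "s \<le> v" "v \<le> t" for v
              unfolding f_def using that bdd by (intro cInf_lower) auto
            then show ?thesis using \<open>f \<in> S \<inter> {s..t}\<close> by force
          qed
          ultimately show ?thesis using backwards [of f s] s(1) False by (intro bexI [of _ f]) (auto simp: dist_real_def)
        qed
        then obtain f where f: "f \<in> S" "dist f t \<le> dist s t" "step (M f) (subarc ?b f s) (A s)" by blast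
        have f01: "f \<in> {0..1}" using f(1) S01 by blast
        have "step (A t) (subarc ?a t f +++ subarc ?b f s) (A s)"
          using step_join [OF step_cong1 [OF M_step [OF t f01] MA [OF True]] f(3)] .
        moreover have "path_image (subarc ?a t f +++ subarc ?b f s) \<subseteq> ball (trace A t) \<rho>"
          using img_a [of f t] img_b [of s f] f f01 s t \<eta>1(1) ab [OF True]
          by (intro subset_path_image_join) (auto simp: A_finish)
        ultimately show ?thesis by blast
      qed
      then show ?thesis using \<eta>1(1) \<eta>2(1) by (intro exI [of _ "min \<eta>1 \<eta>2"]) auto
    next
      case False
      then have "t \<in> - S" by simp
      then obtain \<eta>0 where \<eta>0: "\<eta>0 > 0" "ball t \<eta>0 \<subseteq> - S"
        using \<open>closed S\<close> open_contains_ball [of "- S"] by (auto simp: closed_def)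
      have "\<exists>\<epsilon>. path_image \<epsilon> \<subseteq> ball (trace A t) \<rho> \<and> step (A t) \<epsilon> (A s)"
        if s: "s \<in> {0..1}" "dist s t < min \<eta>0 \<eta>2" for s
      proof -
        have notS: "v \<notin> S" if "dist v t < \<eta>0" for v using \<eta>0(2) that by (auto simp: dist_commute)
        have "S \<inter> {0..s} = S \<inter> {0..t}"
        proof -
          have "dist v t < \<eta>0" if "min s t \<le> v" "v \<le> max s t" for v
            using that s(2) by (auto simp: dist_real_def)
          then have "v \<le> s \<longleftrightarrow> v \<le> t" if "v \<in> S" for v
            using notS that by (smt (verit))
          then show ?thesis by auto
        qed
        then have est: "e s = e t" by (simp add: e_def)
        have "step (A t) (subarc ?b t s) (A s)"
          using step_subarc [OF A_step [OF t] pb(1), of s "A s"] A_step [OF s(1)] e(1) [OF t] S01 t s(1)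
          unfolding est by blast
        moreover have "path_image (subarc ?b t s) \<subseteq> ball (trace A t) \<rho>"
          using img_b [of s t] s t \<eta>2(1) by (simp add: A_finish)
        ultimately show ?thesis by blast
      qed
      then show ?thesis using \<eta>0(1) \<eta>2(1) by (intro exI [of _ "min \<eta>0 \<eta>2"]) auto
    qed
  qed
  then have "step (A 0) (trace A) (A 1)" using u unfolding unique_lifts_def by blast
  moreover have "trace A = ?b" by (rule ext) (rule A_finish)
  moreover have "M 0 = (\<lambda>_. x0)" using pa(2) by (simp add: M_def subarc_trivial pathstart_def)
  moreover have "M 1 = ?a" unfolding M_def by (rule subarc_0_1)
  ultimately have "step (\<lambda>_. x0) ?b ?a"
    using step_cong1 [OF _ sym [OF MA [OF ends(1)]]] step_cong3 [OF _ sym [OF MA [OF ends(2)]]] by metis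
  moreover have "(\<lambda>_. x0) +++ ?b \<simeq> ?b" using pb by (intro const_left)
  ultimately show ?thesis unfolding step_def using sym trans by blast
qed

end

section \<open>Cantor products from transfinite products and from closedness\<close>

lemma loop_in_hawaiian_map_tau:
  assumes j: "\<And>i. i \<ge> 1 \<Longrightarrow> i \<le> j i"
  shows "loop_in hawaiian (0, 0) (hawaiian_map j \<circ> tau_loop)"
    and "t \<in> {0..1} \<Longrightarrow> hawaiian_map j (tau_loop t) = cantor_product (0, 0) (\<lambda>i. hawaiian_loop (j i)) t"
proof -
  have eq: "hawaiian_map j (tau_loop t) = cantor_product (0, 0) (\<lambda>i. hawaiian_loop (j i)) t"
    if t: "t \<in> {0..1}" for t
  proof -
    have loop: "hawaiian_map j (hawaiian_loop i s) = hawaiian_loop (j i) s" if "i \<ge> 1" for i s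
      using hawaiian_map_loop [of i j s] j [of i] that by simp
    have "hawaiian_map j (tau_loop t) = cantor_product (0, 0) (\<lambda>i. hawaiian_map j \<circ> hawaiian_loop i) t"
      using image_cantor_product [of "hawaiian_map j" "(0, 0)" hawaiian_loop t]
      by (simp only: tau_loop_eq_cantor_product) (simp add: hawaiian_map_def)
    also have "\<dots> = cantor_product (0, 0) (\<lambda>i. hawaiian_loop (j i)) t"
      using loop by (intro cantor_product_cong [OF t]) (auto simp: hawaiian_map_def)
    finally show ?thesis .
  qed
  then show "t \<in> {0..1} \<Longrightarrow> hawaiian_map j (tau_loop t) = cantor_product (0, 0) (\<lambda>i. hawaiian_loop (j i)) t"
    by blast
  let ?q = "cantor_product (0, 0) (\<lambda>i. hawaiian_loop (j i))"
  have "path ?q" using null_hawaiian_loops [OF j] by (rule path_cantor_product)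
  then have "path (hawaiian_map j \<circ> tau_loop)"
    by (rule path_eq) (simp add: eq)
  moreover have "path_image ?q \<subseteq> hawaiian"
  proof (rule path_image_cantor_product)
    show "path_image (hawaiian_loop (j i)) \<subseteq> hawaiian" if "i \<ge> 1" for i
      unfolding path_image_def hawaiian_def using j [OF that] that hawaiian_loop_in_circle
      by (intro image_subsetI UN_I [of "j i"]) auto
    show "(0, 0) \<in> hawaiian"
      using hawaiian_loop_in_circle [of 1 0] by (auto simp: hawaiian_def)
  qed simp
  then have "path_image (hawaiian_map j \<circ> tau_loop) \<subseteq> hawaiian"
    using eq by (auto simp: path_image_def)
  moreover have "hawaiian_map j (0, 0) = (0, 0)" by (simp add: hawaiian_map_def)
  ultimately show "loop_in hawaiian (0, 0) (hawaiian_map j \<circ> tau_loop)"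
    by (simp add: pathstart_compose pathfinish_compose)
qed

lemma hawaiian_subset: "hawaiian \<subseteq> hawaiian_plus"
  by (auto simp: hawaiian_plus_def)

lemma loop_in_pair:
  assumes "n \<ge> 1"
  shows "loop_in hawaiian (0, 0) (hawaiian_loop (2 * n - 1) +++ reversepath (hawaiian_loop (2 * n)))"
proof -
  have "loop_in hawaiian (0, 0) (hawaiian_loop m)" if "m \<ge> 1" for m
    using that hawaiian_loop_in_circle [of m]
    by (auto simp: hawaiian_def path_image_def path_hawaiian_loop pathstart_def pathfinish_def)
  then show ?thesis using assms by (simp add: path_image_join)
qed

lemma loop_in_f_odd_tau: "loop_in hawaiian (0, 0) (f_odd \<circ> tau_loop)"
  unfolding f_odd_def by (rule loop_in_hawaiian_map_tau) arith

lemma loop_in_f_even_tau: "loop_in hawaiian (0, 0) (f_even \<circ> tau_loop)"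
  unfolding f_even_def by (rule loop_in_hawaiian_map_tau) arith

lemma loop_in_tau_pair: "loop_in hawaiian (0, 0) ((f_odd \<circ> tau_loop) +++ reversepath (f_even \<circ> tau_loop))"
  using loop_in_f_odd_tau loop_in_f_even_tau by (simp add: path_image_join)

lemma induced_hom_P_group:
  assumes f: "based_map hawaiian_plus base_plus X x0 f" and L: "subgroup L (fundamental_group X x0)"
    and "\<And>n. n \<ge> 1 \<Longrightarrow> induced_hom X f (p_class n) \<in> L"
  shows "induced_hom X f ` P_group \<subseteq> L"
proof -
  have "p_class n \<in> carrier (fundamental_group hawaiian_plus base_plus)" if "n \<ge> 1" for n
    unfolding p_class_def using loop_in_pair [OF that] hawaiian_subset by (intro whisker_class_in_carrier) auto
  moreover have "base_plus \<in> hawaiian_plus" by (simp add: base_plus_def hawaiian_plus_def)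
  ultimately show ?thesis
    unfolding P_group_def using assms by (intro induced_hom_generate [OF f _ L]) auto
qed

context path_classes
begin

lemma path_class_mem_iff:
  assumes "loop_in X x0 a"
  shows "path_class X a \<in> K \<longleftrightarrow> a \<simeq> (\<lambda>_. x0)"
proof -
  have "homotopic_paths X (a +++ reversepath (\<lambda>_. x0)) a"
    using homotopic_paths_const_right [of a X] assms
    by (simp add: homotopic_paths_sym_eq reversepath_def)
  then have "path_class X (a +++ reversepath (\<lambda>_. x0)) = path_class X a"
    using assms by (metis path_class_eq_iff homotopic_paths_sym)
  then show ?thesis
    using cong_mod_iff_normal [OF x0 K, of a "\<lambda>_. x0"] assms path_in_const [OF x0] by simp
qed

lemma rcoset_eq_iff:
  assumes "loop_in X x0 a" "loop_in X x0 b"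
  shows "K #>\<^bsub>fundamental_group X x0\<^esub> path_class X a = K #>\<^bsub>fundamental_group X x0\<^esub> path_class X b \<longleftrightarrow> a \<simeq> b"
proof -
  interpret G: group "fundamental_group X x0" using x0 by (rule group_fundamental_group)
  note carr = path_class_in_carrier [OF assms(1)] path_class_in_carrier [OF assms(2)]
  have "K #>\<^bsub>fundamental_group X x0\<^esub> path_class X a = K #>\<^bsub>fundamental_group X x0\<^esub> path_class X b \<longleftrightarrow>
      path_class X a \<in> K #>\<^bsub>fundamental_group X x0\<^esub> path_class X b"
    using G.repr_independence [OF _ carr(2) subgroup_K] G.rcos_self [OF carr(1) subgroup_K] by metis
  also have "\<dots> \<longleftrightarrow> path_class X (a +++ reversepath b) \<in> K"
    using subgroup.rcos_module [OF subgroup_K G.group_axioms carr(2,1)] assms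
    by (simp add: inv_path_class fundamental_group_mult)
  also have "\<dots> \<longleftrightarrow> a \<simeq> b"
    using cong_mod_iff_normal [OF x0 K, of a b] assms by simp
  finally show ?thesis .
qed

lemma whisker_loops:
  assumes a: "based_map hawaiian_plus base_plus X x0 a" and p: "loop_in hawaiian_plus (0, 0) p"
  shows "loop_in X x0 ((a \<circ> whisker) +++ (a \<circ> p) +++ reversepath (a \<circ> whisker))"
  using path_in_image_whisker [OF a] induced_hom_loop(2) [OF a p] by (simp add: path_image_join)

lemma whisker_class_rcoset_iff:
  assumes a: "based_map hawaiian_plus base_plus X x0 a" and b: "based_map hawaiian_plus base_plus X x0 b"
    and ab: "\<And>t. t \<in> {0..1} \<Longrightarrow> a (whisker t) = b (whisker t)"
    and p: "loop_in hawaiian_plus (0, 0) p"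
  shows "K #>\<^bsub>fundamental_group X x0\<^esub> induced_hom X a (whisker_class p) =
    K #>\<^bsub>fundamental_group X x0\<^esub> induced_hom X b (whisker_class p) \<longleftrightarrow> a \<circ> p \<simeq> b \<circ> p"
proof -
  note aw = path_in_image_whisker [OF a] and bw = path_in_image_whisker [OF b]
  note ap = induced_hom_loop(2) [OF a p] and bp = induced_hom_loop(2) [OF b p]
  have w: "a \<circ> whisker \<simeq> b \<circ> whisker" using aw ab by (intro eq_on) auto
  have ab0: "a (0, 0) = b (0, 0)" using ab [of 1] by (simp add: whisker_def)
  have "(b \<circ> whisker) +++ (b \<circ> p) +++ reversepath (b \<circ> whisker) \<simeq>
      (a \<circ> whisker) +++ (b \<circ> p) +++ reversepath (a \<circ> whisker)"
    using bp bw by (intro join refl sym [OF w] reverse_cong) auto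
  then have "(a \<circ> whisker) +++ (a \<circ> p) +++ reversepath (a \<circ> whisker) \<simeq>
        (b \<circ> whisker) +++ (b \<circ> p) +++ reversepath (b \<circ> whisker) \<longleftrightarrow>
      (a \<circ> whisker) +++ (a \<circ> p) +++ reversepath (a \<circ> whisker) \<simeq>
        (a \<circ> whisker) +++ (b \<circ> p) +++ reversepath (a \<circ> whisker)"
    using sym trans by blast
  also have "\<dots> \<longleftrightarrow> a \<circ> p \<simeq> b \<circ> p"
    using aw ap bp ab0 by (intro conjugate_iff) auto
  finally show ?thesis
    using rcoset_eq_iff [OF whisker_loops [OF a p] whisker_loops [OF b p]]
    by (simp only: induced_hom_whisker_class [OF a p] induced_hom_whisker_class [OF b p])
qed

lemma whisker_class_mem_iff:
  assumes f: "based_map hawaiian_plus base_plus X x0 f"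
    and pq: "loop_in hawaiian_plus (0, 0) p" "loop_in hawaiian_plus (0, 0) q"
  shows "induced_hom X f (whisker_class (p +++ reversepath q)) \<in> K \<longleftrightarrow> f \<circ> p \<simeq> f \<circ> q"
proof -
  let ?x = "f (0, 0)" and ?d = "f \<circ> whisker"
  note d = path_in_image_whisker [OF f]
  note p = induced_hom_loop(2) [OF f pq(1)] and q = induced_hom_loop(2) [OF f pq(2)]
  have pair: "loop_in hawaiian_plus (0, 0) (p +++ reversepath q)"
    using pq by (simp add: path_image_join)
  have fpq: "f \<circ> (p +++ reversepath q) = (f \<circ> p) +++ reversepath (f \<circ> q)"
    by (simp add: path_compose_join path_compose_reversepath)
  have "(\<lambda>_. ?x) +++ reversepath ?d \<simeq> reversepath ?d"
    using d by (intro const_left) auto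
  then have "?d +++ (\<lambda>_. ?x) +++ reversepath ?d \<simeq> ?d +++ reversepath ?d"
    using d by (intro join refl) auto
  then have one: "?d +++ (\<lambda>_. ?x) +++ reversepath ?d \<simeq> (\<lambda>_. x0)"
    using trans inverse_right [of ?d] d by metis
  have "induced_hom X f (whisker_class (p +++ reversepath q)) \<in> K \<longleftrightarrow>
      ?d +++ ((f \<circ> p) +++ reversepath (f \<circ> q)) +++ reversepath ?d \<simeq> (\<lambda>_. x0)"
    using path_class_mem_iff [OF whisker_loops [OF f pair]]
    by (simp only: induced_hom_whisker_class [OF f pair] fpq)
  also have "\<dots> \<longleftrightarrow> ?d +++ ((f \<circ> p) +++ reversepath (f \<circ> q)) +++ reversepath ?d \<simeq>
      ?d +++ (\<lambda>_. ?x) +++ reversepath ?d"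
    using one sym trans by blast
  also have "\<dots> \<longleftrightarrow> (f \<circ> p) +++ reversepath (f \<circ> q) \<simeq> (\<lambda>_. ?x)"
    using d p q by (intro conjugate_iff) auto
  also have "\<dots> \<longleftrightarrow> f \<circ> p \<simeq> f \<circ> q"
  proof
    assume "(f \<circ> p) +++ reversepath (f \<circ> q) \<simeq> (\<lambda>_. ?x)"
    then have "step (f \<circ> p) (reversepath (f \<circ> q)) (\<lambda>_. ?x)" using p q by (simp add: step_def)
    from step_reverse [OF this] have "step (\<lambda>_. ?x) (f \<circ> q) (f \<circ> p)"
      by (simp only: reversepath_reversepath)
    moreover have "(\<lambda>_. ?x) +++ (f \<circ> q) \<simeq> f \<circ> q" using q by (intro const_left) auto
    ultimately show "f \<circ> p \<simeq> f \<circ> q" unfolding step_def using sym trans by blast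
  next
    assume "f \<circ> p \<simeq> f \<circ> q"
    then have "(f \<circ> p) +++ reversepath (f \<circ> q) \<simeq> (f \<circ> q) +++ reversepath (f \<circ> q)"
      using p q by (intro join refl) auto
    then show "(f \<circ> p) +++ reversepath (f \<circ> q) \<simeq> (\<lambda>_. ?x)"
      using trans inverse_right [of "f \<circ> q"] q by metis
  qed
  finally show ?thesis .
qed

lemma path_from_base:
  assumes "path_connected X" "x \<in> X"
  obtains d where "path_in X d" "pathstart d = x0" "pathfinish d = x"
  using assms x0 unfolding path_connected_def by blast

lemma image_cantor_product_loops:
  assumes F: "\<And>n t. n \<ge> 1 \<Longrightarrow> t \<in> {0..1} \<Longrightarrow> F (hawaiian_loop n t) = r n t"
    and j: "\<And>i. i \<ge> 1 \<Longrightarrow> j i \<ge> 1" and t: "t \<in> {0..1}"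
  shows "F (cantor_product (0, 0) (\<lambda>i. hawaiian_loop (j i)) t) = cantor_product (F (0, 0)) (\<lambda>i. r (j i)) t"
proof -
  have "cantor_product (F (0, 0)) (\<lambda>i. F \<circ> hawaiian_loop (j i)) t = cantor_product (F (0, 0)) (\<lambda>i. r (j i)) t"
    using F j by (intro cantor_product_cong [OF t]) auto
  then show ?thesis by (simp only: image_cantor_product)
qed

text \<open>
  Let \<open>a\<close> and \<open>b\<close> send the circles to the loops \<open>q\<close> and \<open>q'\<close>; then they send \<^const>\<open>tau_loop\<close> to the two Cantor
  products.
\<close>

theorem transfinite_products_imp_cantor_products:
  assumes "path_connected X" "transfinite_products X x0 K"
  shows cantor_products
  unfolding cantor_products_def
proof (intro ballI allI impI)
  fix x q q' assume x: "x \<in> X" and q: "null_loops X x q" "null_loops X x q'" and qq: "\<forall>i\<ge>1. q i \<simeq> q' i"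
  obtain d where d: "path_in X d" "pathstart d = x0" "pathfinish d = x" using path_from_base assms(1) x by blast
  obtain a where a: "based_map hawaiian_plus base_plus X x0 a" "\<And>t. t \<in> {0..1} \<Longrightarrow> a (whisker t) = d t"
    "\<And>n t. n \<ge> 1 \<Longrightarrow> t \<in> {0..1} \<Longrightarrow> a (hawaiian_loop n t) = q n t"
    using hawaiian_plus_map_exists [OF d(1,3) q(1)] d(2) by metis
  obtain b where b: "based_map hawaiian_plus base_plus X x0 b" "\<And>t. t \<in> {0..1} \<Longrightarrow> b (whisker t) = d t"
    "\<And>n t. n \<ge> 1 \<Longrightarrow> t \<in> {0..1} \<Longrightarrow> b (hawaiian_loop n t) = q' n t"
    using hawaiian_plus_map_exists [OF d(1,3) q(2)] d(2) by metis
  have ab: "a (whisker t) = b (whisker t)" if "t \<in> {0..1}" for t using a(2) b(2) that by simp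
  have "a \<circ> hawaiian_loop n \<simeq> b \<circ> hawaiian_loop n" if n: "n \<ge> 1" for n
  proof -
    have "q n \<simeq> a \<circ> hawaiian_loop n" "q' n \<simeq> b \<circ> hawaiian_loop n"
      using null_loopsD(1) [OF q(1) n] null_loopsD(1) [OF q(2) n] a(3) b(3) n by (auto intro!: eq_on)
    moreover have "q n \<simeq> q' n" using qq n by blast
    ultimately show ?thesis using sym trans by blast
  qed
  then have c: "K #>\<^bsub>fundamental_group X x0\<^esub> induced_hom X a (c_class n) =
      K #>\<^bsub>fundamental_group X x0\<^esub> induced_hom X b (c_class n)" if "n \<ge> 1" for n
    using whisker_class_rcoset_iff [OF a(1) b(1) ab loop_in_hawaiian_loop] that unfolding c_class_def by blast
  have "whisker_class tau_loop \<in> carrier (fundamental_group hawaiian_plus base_plus)"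
    using path_in_tau_loop by (intro whisker_class_in_carrier) simp
  then have "K #>\<^bsub>fundamental_group X x0\<^esub> induced_hom X a (whisker_class tau_loop) =
      K #>\<^bsub>fundamental_group X x0\<^esub> induced_hom X b (whisker_class tau_loop)"
    using assms(2) [unfolded transfinite_products_def, rule_format, OF a(1) b(1) ab c] by blast
  then have ab_tau: "a \<circ> tau_loop \<simeq> b \<circ> tau_loop"
    using whisker_class_rcoset_iff [OF a(1) b(1) ab] path_in_tau_loop by simp
  have tau: "(f \<circ> tau_loop) t = cantor_product x r t"
    if "\<And>n t. n \<ge> 1 \<Longrightarrow> t \<in> {0..1} \<Longrightarrow> f (hawaiian_loop n t) = r n t" "f (0, 0) = x" "t \<in> {0..1}" for f r t
    using image_cantor_product_loops [of f r "\<lambda>i. i" t] that by (simp add: tau_loop_eq_cantor_product)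
  have a0: "a (0, 0) = x" and b0: "b (0, 0) = x"
    using a(2) [of 1] b(2) [of 1] d(3) by (simp_all add: whisker_def pathfinish_def)
  have "a \<circ> tau_loop \<simeq> cantor_product x q" "b \<circ> tau_loop \<simeq> cantor_product x q'"
    using tau [of a q, OF a(3) a0] tau [of b q', OF b(3) b0] paths [OF ab_tau] by (auto intro!: eq_on)
  then show "cantor_product x q \<simeq> cantor_product x q'"
    using ab_tau sym trans by blast
qed

text \<open>
  A single map sends the odd circles to the loops \<open>q\<close> and the even ones to the loops \<open>q'\<close>.  It maps the
  generators of \<^const>\<open>P_group\<close> into \<open>K\<close>, and the two halves of \<^const>\<open>p_tau\<close> to the two Cantor products.
\<close>

theorem Tg_closed_imp_cantor_products:
  assumes "path_connected X" "Tg_closed hawaiian_plus base_plus P_group p_tau X x0 K"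
  shows cantor_products
  unfolding cantor_products_def
proof (intro ballI allI impI)
  fix x q q' assume x: "x \<in> X" and q: "null_loops X x q" "null_loops X x q'" and qq: "\<forall>i\<ge>1. q i \<simeq> q' i"
  obtain d where d: "path_in X d" "pathstart d = x0" "pathfinish d = x" using path_from_base assms(1) x by blast
  define r where "r n = (if even n then q' (n div 2) else q ((n + 1) div 2))" for n
  have r: "r (2 * i - 1) = q i" "r (2 * i) = q' i" if "i \<ge> 1" for i
    using that by (auto simp: r_def)
  have "null_loops X x r"
    unfolding null_loops_def
  proof (intro conjI allI impI)
    fix i :: nat assume "1 \<le> i"
    then have "i div 2 \<ge> 1" if "even i" using that by (cases i) auto
    then show "path (r i)" "path_image (r i) \<subseteq> X" "pathstart (r i) = x" "pathfinish (r i) = x"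
      using null_loopsD [OF q(1), of "(i + 1) div 2"] null_loopsD [OF q(2), of "i div 2"] \<open>1 \<le> i\<close>
      by (auto simp: r_def)
  next
    fix \<rho> :: real assume "\<rho> > 0"
    then obtain M M' where M: "\<And>i. i \<ge> M \<Longrightarrow> path_image (q i) \<subseteq> ball x \<rho>" "\<And>i. i \<ge> M' \<Longrightarrow> path_image (q' i) \<subseteq> ball x \<rho>"
      using q unfolding null_loops_def by metis
    have "path_image (r i) \<subseteq> ball x \<rho>" if "i \<ge> 2 * (M + M')" for i
    proof -
      have "M \<le> (i + 1) div 2" "M' \<le> i div 2" using that by (simp_all add: less_eq_div_iff_mult_less_eq)
      then show ?thesis using M by (simp add: r_def)
    qed
    then show "\<exists>M. \<forall>i\<ge>M. path_image (r i) \<subseteq> ball x \<rho>" by blast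
  qed
  then obtain F where F: "based_map hawaiian_plus base_plus X x0 F" "\<And>t. t \<in> {0..1} \<Longrightarrow> F (whisker t) = d t"
    "\<And>n t. n \<ge> 1 \<Longrightarrow> t \<in> {0..1} \<Longrightarrow> F (hawaiian_loop n t) = r n t"
    using hawaiian_plus_map_exists [OF d(1,3)] d(2) by metis
  have F0: "F (0, 0) = x" using F(2) [of 1] d(3) by (simp add: whisker_def pathfinish_def)
  have "induced_hom X F (p_class n) \<in> K" if n: "n \<ge> 1" for n
  proof -
    have "q n \<simeq> F \<circ> hawaiian_loop (2 * n - 1)" "q' n \<simeq> F \<circ> hawaiian_loop (2 * n)"
      using null_loopsD(1) [OF q(1) n] null_loopsD(1) [OF q(2) n] F(3) n r [OF n] by (auto intro!: eq_on)
    then have "F \<circ> hawaiian_loop (2 * n - 1) \<simeq> F \<circ> hawaiian_loop (2 * n)"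
      using qq n sym trans by blast
    then show ?thesis
      unfolding p_class_def using n by (subst whisker_class_mem_iff [OF F(1) loop_in_hawaiian_loop loop_in_hawaiian_loop]) auto
  qed
  then have "induced_hom X F ` P_group \<subseteq> K"
    by (rule induced_hom_P_group [OF F(1) subgroup_K])
  then have "induced_hom X F p_tau \<in> K"
    using assms(2) F(1) unfolding Tg_closed_def by blast
  moreover have "loop_in hawaiian_plus (0, 0) (f_odd \<circ> tau_loop)" "loop_in hawaiian_plus (0, 0) (f_even \<circ> tau_loop)"
    using loop_in_f_odd_tau loop_in_f_even_tau hawaiian_subset by blast+
  ultimately have tau: "F \<circ> (f_odd \<circ> tau_loop) \<simeq> F \<circ> (f_even \<circ> tau_loop)"
    unfolding p_tau_def using whisker_class_mem_iff [OF F(1)] by blast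
  have "(F \<circ> (f_odd \<circ> tau_loop)) t = cantor_product x q t" "(F \<circ> (f_even \<circ> tau_loop)) t = cantor_product x q' t"
    if t: "t \<in> {0..1}" for t
  proof -
    have "(F \<circ> (f_odd \<circ> tau_loop)) t = cantor_product x (\<lambda>i. r (2 * i - 1)) t"
      using loop_in_hawaiian_map_tau(2) [of "\<lambda>n. 2 * n - 1", OF _ t]
        image_cantor_product_loops [of F r "\<lambda>i. 2 * i - 1", OF F(3) _ t] F0 by (simp add: f_odd_def)
    also have "\<dots> = cantor_product x q t"
      using r null_loopsD [OF q(1)] by (intro cantor_product_cong [OF t]) auto
    finally show "(F \<circ> (f_odd \<circ> tau_loop)) t = cantor_product x q t" .
    have "(F \<circ> (f_even \<circ> tau_loop)) t = cantor_product x (\<lambda>i. r (2 * i)) t"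
      using loop_in_hawaiian_map_tau(2) [of "\<lambda>n. 2 * n", OF _ t]
        image_cantor_product_loops [of F r "\<lambda>i. 2 * i", OF F(3) _ t] F0 by (simp add: f_even_def)
    also have "\<dots> = cantor_product x q' t"
      using r null_loopsD [OF q(2)] by (intro cantor_product_cong [OF t]) auto
    finally show "(F \<circ> (f_even \<circ> tau_loop)) t = cantor_product x q' t" .
  qed
  then have "F \<circ> (f_odd \<circ> tau_loop) \<simeq> cantor_product x q" "F \<circ> (f_even \<circ> tau_loop) \<simeq> cantor_product x q'"
    using paths [OF tau] by (auto intro!: eq_on)
  then show "cantor_product x q \<simeq> cantor_product x q'"
    using tau sym trans by blast
qed

theorem unique_lifts_imp_transfinite_products:
  assumes "unique_lifts x0"
  shows "transfinite_products X x0 K"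
  unfolding transfinite_products_def
proof (intro allI impI ballI)
  fix a b g
  assume a: "based_map hawaiian_plus base_plus X x0 a" and b: "based_map hawaiian_plus base_plus X x0 b"
    and ab: "\<forall>t\<in>{0..1}. a (whisker t) = b (whisker t)"
    and c: "\<forall>n\<ge>1. K #>\<^bsub>fundamental_group X x0\<^esub> induced_hom X a (c_class n) =
               K #>\<^bsub>fundamental_group X x0\<^esub> induced_hom X b (c_class n)"
    and g: "g \<in> carrier (fundamental_group hawaiian_plus base_plus)"
  obtain \<sigma> where \<sigma>: "loop_in hawaiian_plus base_plus \<sigma>" "g = path_class hawaiian_plus \<sigma>"
    using g unfolding carrier_fundamental_group by blast
  have "a \<circ> hawaiian_loop n \<simeq> b \<circ> hawaiian_loop n" if n: "n \<ge> 1" for n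
  proof -
    show ?thesis
      using whisker_class_rcoset_iff [OF a b bspec [OF ab] loop_in_hawaiian_loop [OF n]] c n unfolding c_class_def by blast
  qed
  then have "a \<circ> \<sigma> \<simeq> b \<circ> \<sigma>"
    using unique_lifts_imp_products [OF assms a b _ _ \<sigma>(1)] ab by blast
  moreover have "a base_plus = x0" "b base_plus = x0" using a b by (simp_all add: based_map_def)
  ultimately show "K #>\<^bsub>fundamental_group X x0\<^esub> induced_hom X a g = K #>\<^bsub>fundamental_group X x0\<^esub> induced_hom X b g"
    using rcoset_eq_iff induced_hom_loop [OF a \<sigma>(1)] induced_hom_loop [OF b \<sigma>(1)] \<sigma>(2) by simp
qed

end

section \<open>The closure of a normal subgroup\<close>

text \<open>Running along \<open>\<eta>\<close> before the image of the whisker conjugates all images by the class of \<open>\<eta>\<close>.\<close>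

lemma rebased_map:
  fixes X :: "'a::metric_space set"
  assumes f: "based_map hawaiian_plus base_plus X x0 f" and \<eta>: "loop_in X x0 \<eta>"
  obtains f' where "based_map hawaiian_plus base_plus X x0 f'"
    "\<And>p. loop_in hawaiian (0, 0) p \<Longrightarrow> induced_hom X f' (whisker_class p) =
      path_class X \<eta> \<otimes>\<^bsub>fundamental_group X x0\<^esub> induced_hom X f (whisker_class p)
        \<otimes>\<^bsub>fundamental_group X x0\<^esub> inv\<^bsub>fundamental_group X x0\<^esub> path_class X \<eta>"
proof -
  let ?d = "f \<circ> whisker" and ?q = "\<lambda>n. f \<circ> hawaiian_loop n"
  note d = path_in_image_whisker [OF f]
  have \<eta>d: "path_in X (\<eta> +++ ?d)" "pathfinish (\<eta> +++ ?d) = f (0, 0)" "pathstart (\<eta> +++ ?d) = x0"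
    using d \<eta> by (auto simp: path_image_join)
  have 0: "(0, 0) \<in> hawaiian_plus" by (simp add: hawaiian_plus_def)
  have "null_loops X (f (0, 0)) ?q"
    unfolding null_loops_def
  proof (intro conjI allI impI)
    fix i :: nat assume i: "1 \<le> i"
    from induced_hom_loop(2) [OF f loop_in_hawaiian_loop [OF i]]
    show "path (?q i)" "path_image (?q i) \<subseteq> X" "pathstart (?q i) = f (0, 0)" "pathfinish (?q i) = f (0, 0)"
      by auto
  next
    fix \<rho> :: real assume "\<rho> > 0"
    moreover have "continuous_on hawaiian_plus f" using f by (simp add: based_map_def)
    ultimately obtain \<delta> where \<delta>: "\<delta> > 0" "\<And>z. z \<in> hawaiian_plus \<Longrightarrow> dist z (0, 0) < \<delta> \<Longrightarrow> dist (f z) (f (0, 0)) < \<rho>"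
      using 0 unfolding continuous_on_iff by metis
    obtain M where M: "\<And>i. i \<ge> M \<Longrightarrow> path_image (hawaiian_loop i) \<subseteq> ball (0, 0) \<delta>"
      using null_hawaiian_loops [of "\<lambda>i. i"] \<delta>(1) unfolding null_loops_def by blast
    have "path_image (?q i) \<subseteq> ball (f (0, 0)) \<rho>" if i: "i \<ge> M + 1" for i
    proof -
      have "path_image (hawaiian_loop i) \<subseteq> hawaiian_plus \<inter> ball (0, 0) \<delta>"
        using path_image_hawaiian_loop [of i] M [of i] i by simp
      then show ?thesis using \<delta>(2) by (auto simp: path_image_compose dist_commute subset_iff)
    qed
    then show "\<exists>M. \<forall>i\<ge>M. path_image (?q i) \<subseteq> ball (f (0, 0)) \<rho>" by blast
  qed
  then obtain f' where f': "based_map hawaiian_plus base_plus X x0 f'"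
    "\<And>t. t \<in> {0..1} \<Longrightarrow> f' (whisker t) = (\<eta> +++ ?d) t"
    "\<And>n t. n \<ge> 1 \<Longrightarrow> t \<in> {0..1} \<Longrightarrow> f' (hawaiian_loop n t) = ?q n t"
    using hawaiian_plus_map_exists [OF \<eta>d(1,2)] \<eta>d(3) by metis
  have agree: "f' z = f z" if "z \<in> hawaiian" for z
  proof -
    obtain n where n: "n \<ge> 1" "z \<in> hawaiian_circle n" using \<open>z \<in> hawaiian\<close> by (auto simp: hawaiian_def)
    then obtain t where "t \<in> {0..1}" "z = hawaiian_loop n t" by (rule circle_is_loop_image)
    then show ?thesis using f'(3) n(1) by simp
  qed
  interpret h: path_congruence X "homotopic_paths X" by (rule path_congruence_homotopic_paths)
  have "induced_hom X f' (whisker_class p) =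
      path_class X \<eta> \<otimes>\<^bsub>fundamental_group X x0\<^esub> induced_hom X f (whisker_class p)
        \<otimes>\<^bsub>fundamental_group X x0\<^esub> inv\<^bsub>fundamental_group X x0\<^esub> path_class X \<eta>"
    if p: "loop_in hawaiian (0, 0) p" for p
  proof -
    have p': "loop_in hawaiian_plus (0, 0) p" using p hawaiian_subset by auto
    let ?w = "f \<circ> p"
    note w = induced_hom_loop(2) [OF f p']
    have conj: "loop_in X x0 (?d +++ ?w +++ reversepath ?d)"
      using d w by (simp add: path_image_join)
    have 1: "homotopic_paths X (\<eta> +++ ?d) (f' \<circ> whisker)"
      using homotopic_paths_eq [OF conjunct1 [OF \<eta>d(1)] conjunct2 [OF \<eta>d(1)]] f'(2) by simp
    have 2: "homotopic_paths X ?w (f' \<circ> p)"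
      using w p agree by (intro homotopic_paths_eq) (auto simp: path_image_def image_subset_iff)
    have "homotopic_paths X ((\<eta> +++ ?d) +++ ?w +++ reversepath (\<eta> +++ ?d))
        ((f' \<circ> whisker) +++ (f' \<circ> p) +++ reversepath (f' \<circ> whisker))"
      by (rule h.join [OF 1 h.join [OF 2 h.reverse_cong [OF 1]]]) (use d w \<eta> in auto)
    moreover have "homotopic_paths X ((\<eta> +++ ?d) +++ ?w +++ reversepath (\<eta> +++ ?d))
        ((\<eta> +++ (?d +++ ?w +++ reversepath ?d)) +++ reversepath \<eta>)"
    proof -
      define c where "c = (\<lambda>_::real. x0)"
      have s1: "h.step c \<eta> \<eta>" using \<eta> by (simp add: h.step_def c_def h.const_left)
      have s2: "h.step \<eta> ?d (\<eta> +++ ?d)" using \<eta>d \<eta> d by (intro h.step_self) auto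
      have s3: "h.step (\<eta> +++ ?d) ?w ((\<eta> +++ ?d) +++ ?w)"
        using path_in_join [OF \<eta>d(1), of ?w] \<eta>d(2) w by (intro h.step_self) auto
      note s3' = h.step_paths(3) [OF s3]
      have s4: "h.step ((\<eta> +++ ?d) +++ ?w) (reversepath ?d) (((\<eta> +++ ?d) +++ ?w) +++ reversepath ?d)"
        using d w by (intro h.step_self path_in_join [OF s3']) auto
      note s4' = h.step_paths(3) [OF s4]
      have s5: "h.step (((\<eta> +++ ?d) +++ ?w) +++ reversepath ?d) (reversepath \<eta>) ((((\<eta> +++ ?d) +++ ?w) +++ reversepath ?d) +++ reversepath \<eta>)"
        using d \<eta> by (intro h.step_self path_in_join [OF s4']) auto
      have "h.step c ((\<eta> +++ ?d) +++ ?w +++ reversepath ?d +++ reversepath \<eta>) ((((\<eta> +++ ?d) +++ ?w) +++ reversepath ?d) +++ reversepath \<eta>)"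
        by (intro h.step_join [OF h.step_join [OF s1 s2]] h.step_join [OF s3] h.step_join [OF s4] s5)
      moreover have "h.step c ((\<eta> +++ (?d +++ ?w +++ reversepath ?d)) +++ reversepath \<eta>) ((((\<eta> +++ ?d) +++ ?w) +++ reversepath ?d) +++ reversepath \<eta>)"
        by (intro h.step_join [OF h.step_join [OF s1 h.step_join [OF s2 h.step_join [OF s3 s4]]] s5])
      ultimately show ?thesis
        using \<eta> d by (simp add: reversepath_joinpaths h.step_unique)
    qed
    ultimately have "path_class X ((f' \<circ> whisker) +++ (f' \<circ> p) +++ reversepath (f' \<circ> whisker)) =
        path_class X ((\<eta> +++ (?d +++ ?w +++ reversepath ?d)) +++ reversepath \<eta>)"
      using h.paths by (metis path_class_eq_iff)
    then show ?thesis
      using conj \<eta> by (simp add: induced_hom_whisker_class [OF f'(1) p'] induced_hom_whisker_class [OF f p']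
          inv_path_class fundamental_group_mult path_image_join)
  qed
  with f'(1) that show thesis by blast
qed

text \<open>
  The preimage of a closed subgroup under an inner automorphism is again closed, by rerouting the whiskers of the test
  maps.  As it also contains \<open>N\<close>, it takes part in the intersection that defines the closure.
\<close>

theorem normal_Tg_closure:
  fixes X :: "'a::metric_space set"
  assumes x0: "x0 \<in> X" and N: "N \<lhd> fundamental_group X x0"
  defines "C \<equiv> Tg_closure hawaiian_plus base_plus P_group p_tau X x0 N"
  shows "C \<lhd> fundamental_group X x0" "Tg_closed hawaiian_plus base_plus P_group p_tau X x0 C"
proof -
  let ?G = "fundamental_group X x0"
  interpret G: group ?G using x0 by (rule group_fundamental_group)
  let ?closed = "Tg_closed hawaiian_plus base_plus P_group p_tau X x0"
  define \<F> where "\<F> = {L. subgroup L ?G \<and> ?closed L \<and> N \<subseteq> L}"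
  have C: "C = \<Inter>\<F>" by (simp add: C_def Tg_closure_def \<F>_def)
  have tau_pair: "loop_in hawaiian_plus (0, 0) ((f_odd \<circ> tau_loop) +++ reversepath (f_even \<circ> tau_loop))"
    using loop_in_tau_pair hawaiian_subset by auto
  have tau_carrier: "induced_hom X f p_tau \<in> carrier ?G" if f: "based_map hawaiian_plus base_plus X x0 f" for f
    using induced_hom_loop [OF f loop_in_whisker [OF tau_pair]] f
    by (simp add: p_tau_def whisker_class_def based_map_def path_class_in_carrier)
  have "N \<subseteq> carrier ?G" using N normal_imp_subgroup subgroup.subset by blast
  then have "carrier ?G \<in> \<F>"
    using tau_carrier G.subgroup_self by (simp add: \<F>_def Tg_closed_def)
  then have sub: "subgroup C ?G"
    unfolding C by (intro G.subgroups_Inter) (auto simp: \<F>_def)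
  show "?closed C"
    unfolding C Tg_closed_def
  proof (intro allI impI InterI)
    fix f L assume "based_map hawaiian_plus base_plus X x0 f" "induced_hom X f ` P_group \<subseteq> \<Inter>\<F>" "L \<in> \<F>"
    then show "induced_hom X f p_tau \<in> L" unfolding \<F>_def Tg_closed_def by blast
  qed
  have conj: "{h \<in> carrier ?G. g \<otimes>\<^bsub>?G\<^esub> h \<otimes>\<^bsub>?G\<^esub> inv\<^bsub>?G\<^esub> g \<in> L} \<in> \<F>"
    if L: "L \<in> \<F>" and g: "g \<in> carrier ?G" for L g
  proof -
    let ?L = "{h \<in> carrier ?G. g \<otimes>\<^bsub>?G\<^esub> h \<otimes>\<^bsub>?G\<^esub> inv\<^bsub>?G\<^esub> g \<in> L}"
    have LG: "subgroup L ?G" and Lc: "?closed L" and NL: "N \<subseteq> L" using L by (auto simp: \<F>_def)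
    have split: "g \<otimes>\<^bsub>?G\<^esub> (h \<otimes>\<^bsub>?G\<^esub> k) \<otimes>\<^bsub>?G\<^esub> inv\<^bsub>?G\<^esub> g =
        (g \<otimes>\<^bsub>?G\<^esub> h \<otimes>\<^bsub>?G\<^esub> inv\<^bsub>?G\<^esub> g) \<otimes>\<^bsub>?G\<^esub> (g \<otimes>\<^bsub>?G\<^esub> k \<otimes>\<^bsub>?G\<^esub> inv\<^bsub>?G\<^esub> g)"
      if "h \<in> carrier ?G" "k \<in> carrier ?G" for h k
      using that g by (simp add: G.m_assoc G.inv_solve_left)
    have inv: "g \<otimes>\<^bsub>?G\<^esub> inv\<^bsub>?G\<^esub> h \<otimes>\<^bsub>?G\<^esub> inv\<^bsub>?G\<^esub> g = inv\<^bsub>?G\<^esub> (g \<otimes>\<^bsub>?G\<^esub> h \<otimes>\<^bsub>?G\<^esub> inv\<^bsub>?G\<^esub> g)"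
      if "h \<in> carrier ?G" for h
      using that g by (simp add: G.inv_mult_group G.m_assoc)
    have "subgroup ?L ?G"
      using g split inv subgroup.m_closed [OF LG] subgroup.m_inv_closed [OF LG] subgroup.one_closed [OF LG]
      by (intro G.subgroupI) auto
    moreover have "?closed ?L"
      unfolding Tg_closed_def
    proof (intro allI impI)
      fix f assume f: "based_map hawaiian_plus base_plus X x0 f" and P: "induced_hom X f ` P_group \<subseteq> ?L"
      obtain \<eta> where \<eta>: "loop_in X x0 \<eta>" "g = path_class X \<eta>" using g unfolding carrier_fundamental_group by blast
      obtain f' where f': "based_map hawaiian_plus base_plus X x0 f'"
        "\<And>p. loop_in hawaiian (0, 0) p \<Longrightarrow> induced_hom X f' (whisker_class p) =
           g \<otimes>\<^bsub>?G\<^esub> induced_hom X f (whisker_class p) \<otimes>\<^bsub>?G\<^esub> inv\<^bsub>?G\<^esub> g"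
        using rebased_map [OF f \<eta>(1)] unfolding \<eta>(2) by blast
      have "induced_hom X f' (p_class n) \<in> L" if "n \<ge> 1" for n
      proof -
        have "p_class n \<in> P_group" using that unfolding P_group_def by (intro generate.incl) auto
        then have "induced_hom X f (p_class n) \<in> ?L" using P by blast
        then show ?thesis using f'(2) [OF loop_in_pair [OF that]] by (simp add: p_class_def)
      qed
      then have "induced_hom X f' ` P_group \<subseteq> L" by (rule induced_hom_P_group [OF f'(1) LG])
      then have "induced_hom X f' p_tau \<in> L" using Lc f'(1) unfolding Tg_closed_def by blast
      then show "induced_hom X f p_tau \<in> ?L"
        using f'(2) [OF loop_in_tau_pair] tau_carrier [OF f] by (simp add: p_tau_def)
    qed
    moreover have "N \<subseteq> ?L"
      using NL \<open>N \<subseteq> carrier ?G\<close> g normal.inv_op_closed2 [OF N] by blast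
    ultimately show ?thesis by (simp add: \<F>_def)
  qed
  have "g \<otimes>\<^bsub>?G\<^esub> h \<otimes>\<^bsub>?G\<^esub> inv\<^bsub>?G\<^esub> g \<in> C" if "g \<in> carrier ?G" "h \<in> C" for g h
    using conj [OF _ that(1)] that(2) unfolding C by blast
  then show "C \<lhd> ?G" using sub by (simp add: G.normal_inv_iff)
qed

theorem corollary7p14:
  fixes X :: "'a::metric_space set" and x0 :: 'a and N :: "(real \<Rightarrow> 'a) set set"
  assumes "path_connected X" and "x0 \<in> X"
    and "discrete (non_slsc X)"
    and "N \<lhd> fundamental_group X x0"
  shows "(unique_path_lifting (tilde_space X x0 N) end_proj \<longleftrightarrow> transfinite_products X x0 N) \<and>
    unique_path_lifting
      (tilde_space X x0 (Tg_closure hawaiian_plus base_plus P_group p_tau X x0 N)) end_proj"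
proof -
  let ?C = "Tg_closure hawaiian_plus base_plus P_group p_tau X x0 N"
  interpret N: path_classes X x0 N by (rule path_classes.intro) (use assms in auto)
  interpret C: path_classes X x0 ?C
    using assms(2) normal_Tg_closure(1) [OF assms(2,4)] by (rule path_classes.intro)
  have "unique_path_lifting (tilde_space X x0 N) end_proj \<longleftrightarrow> transfinite_products X x0 N"
    using N.unique_path_lifting_iff N.unique_lifts_imp_transfinite_products
      N.transfinite_products_imp_cantor_products [OF assms(1)]
      N.cantor_products_imp_unique_path_lifting [OF _ assms(3)] by blast
  moreover have "unique_path_lifting (tilde_space X x0 ?C) end_proj"
    using C.Tg_closed_imp_cantor_products [OF assms(1)] normal_Tg_closure(2) [OF assms(2,4)]
      C.cantor_products_imp_unique_path_lifting [OF _ assms(3)] by blast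
  ultimately show ?thesis ..
qed

end
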